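(* Let $I=\mathbb R$ and let the speed measure be $m(dx)=2\,dx$, i.e. the diffusion is a Brownian motion $W$ on $\mathbb R$. Let $a_h(y)=\sqrt h$ for all $h\in(0,1)$, $y\in\mathbb R$. Then $$\frac12\int_{(y-a_h(y),y+a_h(y))}(a_h(y)-|u-y|)\,m(du)=h\qquad\text{for all }y\in\mathbb R,\ h\in(0,1),$$ and for all $p\in[4,\infty)$, $y\in\mathbb R$, $T\in(0,\infty)$ and $h\in(0,1\wedge T)$ we have $$\big\|W_{\tau^h_{\lfloor T/h\rfloor}}-W_T\big\|_{L^p(P_y)}\ge\big\|W_{\tau^h_{\lfloor T/h\rfloor}}-W_T\big\|_{L^4(P_y)}\ge\left(\frac{(T-h)\operatorname{Var}(H_{-1,1}(W))}{4}\right)^{\frac14}h^{\frac14}.$$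
   Context: Under $P_y$, $W$ is a Brownian motion with $P_y[W_0=y]=1$. For $h\in(0,1)$ the stopping times $(\tau^h_k)_{k\in\mathbb N_0}$ are defined by $\tau^h_0=0$ and $\tau^h_{k+1}=\inf\{t\ge\tau^h_k:|W_t-W_{\tau^h_k}|=\sqrt h\}$. $H_{-1,1}(W)=\inf\{t\ge0:W_t\in\{-1,1\}\}$ is the first exit time from $(-1,1)$; its variance is taken for a Brownian motion started in $0$ (i.e. under $P_0$). *)

theory Defs
  imports "HOL-Probability.Probability"
begin

text \<open>Time is \<open>{0..}\<close> inside \<^typ>\<open>real\<close>; values \<open>W t\<close> for \<open>t < 0\<close> carry no meaning.
  Paths are continuous for every outcome, not merely almost surely, so that the hitting times
  below are measurable without completing \<open>M\<close>.\<close>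

definition brownian_motion :: "'a measure \<Rightarrow> (real \<Rightarrow> 'a \<Rightarrow> real) \<Rightarrow> real \<Rightarrow> bool" where
  "brownian_motion M W y \<longleftrightarrow>
     prob_space M \<and>
     (\<forall>t\<ge>0. W t \<in> borel_measurable M) \<and>
     (AE \<omega> in M. W 0 \<omega> = y) \<and>
     (\<forall>\<omega>\<in>space M. continuous_on {0..} (\<lambda>t. W t \<omega>)) \<and>
     (\<forall>s t. 0 \<le> s \<and> s < t \<longrightarrow>
        distributed M lborel (\<lambda>\<omega>. W t \<omega> - W s \<omega>) (normal_density 0 (sqrt (t - s)))) \<and>
     (\<forall>(n::nat) (t::nat \<Rightarrow> real). 0 \<le> t 0 \<and> (\<forall>i<n. t i < t (Suc i)) \<longrightarrow>
        prob_space.indep_vars M (\<lambda>_. borel) (\<lambda>i \<omega>. W (t (Suc i)) \<omega> - W (t i) \<omega>) {..<n})"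

text \<open>Random times are extended real valued, with \<open>Inf {} = \<infinity>\<close>.\<close>

definition exit_time :: "real \<Rightarrow> real \<Rightarrow> (real \<Rightarrow> 'a \<Rightarrow> real) \<Rightarrow> 'a \<Rightarrow> ereal" where
  "exit_time a b W \<omega> = Inf (ereal ` {t. 0 \<le> t \<and> W t \<omega> \<in> {a, b}})"

text \<open>Evaluation of a process at a random time. Where the time is \<open>\<infinity>\<close> (a null event for
  the times used here) \<^const>\<open>real_of_ereal\<close> returns \<open>0\<close>, giving \<open>W 0\<close>.\<close>

definition at_time :: "(real \<Rightarrow> 'a \<Rightarrow> real) \<Rightarrow> ('a \<Rightarrow> ereal) \<Rightarrow> 'a \<Rightarrow> real" where
  "at_time W \<sigma> \<omega> = W (real_of_ereal (\<sigma> \<omega>)) \<omega>"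

text \<open>Once some time is \<open>\<infinity>\<close>, the index set of the next infimum is empty, so all later
  times are \<open>\<infinity>\<close> as well.\<close>

primrec tau :: "(real \<Rightarrow> 'a \<Rightarrow> real) \<Rightarrow> real \<Rightarrow> nat \<Rightarrow> 'a \<Rightarrow> ereal" where
  "tau W h 0 = (\<lambda>\<omega>. 0)"
| "tau W h (Suc k) = (\<lambda>\<omega>. Inf (ereal `
     {t. tau W h k \<omega> \<le> ereal t \<and> \<bar>W t \<omega> - at_time W (tau W h k) \<omega>\<bar> = sqrt h}))"

text \<open>The \<open>L\<^sup>p\<close> norm with value \<open>\<infinity>\<close> when the \<open>p\<close>-th absolute moment is infinite.\<close>

definition Lp_norm :: "'a measure \<Rightarrow> real \<Rightarrow> ('a \<Rightarrow> real) \<Rightarrow> ennreal" where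
  "Lp_norm M p X =
     (let I = (\<integral>\<^sup>+ \<omega>. ennreal (\<bar>X \<omega>\<bar> powr p) \<partial>M)
      in if I = \<infinity> then \<infinity> else ennreal (enn2real I powr (1 / p)))"

end

theory Submission
  imports Defs
begin

text \<open>
  Let \<open>X\<close> be the displacement of a Brownian motion between two stopping times and \<open>s\<close> the time
  elapsed between them. Both \<open>s - X\<^sup>2\<close> and \<open>X\<^sup>4 - 6 X\<^sup>2 s + 3 s\<^sup>2\<close> have expectation zero
  (\<open>moment_identities\<close>), and the lower bound is read off from these two facts.

  Apply the second identity to the earlier and the later of \<open>\<tau>\<^sub>n\<close> and \<open>T\<close>, so that \<open>X\<close> is up to its
  sign the difference of the values at \<open>\<tau>\<^sub>n\<close> and \<open>T\<close>, and \<open>s = \<bar>\<tau>\<^sub>n - T\<bar>\<close>. Since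
  \<open>6 X\<^sup>2 s \<le> 9 X\<^sup>4 + s\<^sup>2\<close>, the identity yields \<open>E s\<^sup>2 \<le> 4 E X\<^sup>4\<close> (\<open>time_error_le_space_error\<close>): an
  approximation that runs on a wrong clock pays for it in space. The factor 4 is the one in the claim.

  Over one step of the walk \<open>\<bar>X\<bar>\<close> equals \<open>sqrt h\<close>, so the identities turn into equations for
  the length of the step: its mean is \<open>h\<close>, its second moment is \<open>5 h\<^sup>2 / 3\<close>, and it is uncorrelated with the
  time at which it starts (\<open>tau_step_identities\<close>). Summing up, \<open>\<tau>\<^sub>n\<close> has mean \<open>n h\<close> and variance
  \<open>2 n h\<^sup>2 / 3\<close>, whence \<open>E (\<tau>\<^sub>n - T)\<^sup>2 \<ge> 2 n h\<^sup>2 / 3\<close>. For \<open>h = n = 1\<close> this is the exit time of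
  \<open>(-1, 1)\<close>, whose variance is therefore \<open>2 / 3\<close>. With \<open>n = \<lfloor>T / h\<rfloor>\<close> one has
  \<open>n h \<ge> T - h\<close>, which gives the bound for the fourth moment; larger exponents follow from the monotonicity of the norms on a probability space.

  The two identities come from the exponential martingale
  \<open>exp (i \<theta> W\<^sub>t + \<theta>\<^sup>2 t / 2)\<close>. It is bounded on bounded time intervals, so optional stopping at a bounded
  time follows by discretising the time and passing to the limit by dominated convergence
  (\<open>wald_optional\<close>). Expanding
  \<open>cos (\<theta> X) exp (\<theta>\<^sup>2 s / 2)\<close> in powers of \<open>\<theta>\<close> and comparing the coefficients of \<open>\<theta>\<^sup>2\<close> and
  \<open>\<theta>\<^sup>4\<close> produces the polynomials (\<open>moments_from_exponential\<close>). The hitting times are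
  unbounded; they are first cut off at a level \<open>N\<close>, where the identities bound their moments uniformly in \<open>N\<close>.
\<close>

section \<open>Independence of the past from later increments\<close>

text \<open>The normalisation is such that \<open>wald_exp \<theta> t (W\<^sub>t - W\<^sub>0)\<close> is a martingale: the time factor
  cancels the Gaussian characteristic function of the space factor.\<close>

definition wald_exp :: "real \<Rightarrow> real \<Rightarrow> real \<Rightarrow> complex" where
  "wald_exp \<theta> t x = iexp (\<theta> * x) * complex_of_real (exp (\<theta>\<^sup>2 * t / 2))"

lemma wald_exp_add: "wald_exp \<theta> s x * wald_exp \<theta> t z = wald_exp \<theta> (s + t) (x + z)"
proof -
  have 1: "iexp (\<theta> * (x + z)) = iexp (\<theta> * x) * iexp (\<theta> * z)"
    by (simp add: distrib_left exp_add)
  have 2: "exp (\<theta>\<^sup>2 * (s + t) / 2) = exp (\<theta>\<^sup>2 * s / 2) * exp (\<theta>\<^sup>2 * t / 2)"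
    by (simp add: distrib_left add_divide_distrib exp_add)
  show ?thesis unfolding wald_exp_def 1 2 by (simp only: of_real_mult mult_ac)
qed

lemma norm_wald_exp [simp]: "norm (wald_exp \<theta> t x) = exp (\<theta>\<^sup>2 * t / 2)"
  by (simp add: wald_exp_def norm_mult)

lemma norm_wald_exp_le: "t \<le> t' \<Longrightarrow> norm (wald_exp \<theta> t x) \<le> exp (\<theta>\<^sup>2 * t' / 2)"
  by (simp add: mult_left_mono)

lemma Re_wald_exp: "Re (wald_exp \<theta> t x) = cos (\<theta> * x) * exp (\<theta>\<^sup>2 * t / 2)"
  by (simp add: wald_exp_def Re_exp)

lemma continuous_wald_exp [continuous_intros]:
  assumes "continuous_on S f" "continuous_on S g"
  shows "continuous_on S (\<lambda>z. wald_exp \<theta> (f z) (g z))"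
  unfolding wald_exp_def using assms by (intro continuous_intros) auto

lemma tendsto_wald_exp [tendsto_intros]:
  assumes "(f \<longlongrightarrow> t) G" "(g \<longlongrightarrow> x) G"
  shows "((\<lambda>z. wald_exp \<theta> (f z) (g z)) \<longlongrightarrow> wald_exp \<theta> t x) G"
  unfolding wald_exp_def using assms by (intro tendsto_intros) auto

lemma measurable_wald_exp [measurable (raw)]:
  assumes [measurable]: "f \<in> borel_measurable M" "g \<in> borel_measurable M"
  shows "(\<lambda>z. wald_exp \<theta> (f z) (g z)) \<in> borel_measurable M"
  unfolding wald_exp_def by measurable

locale brownian = 
  fixes M :: "'a measure" and W :: "real \<Rightarrow> 'a \<Rightarrow> real" and y :: real
  assumes brownian: "brownian_motion M W y"
begin

sublocale prob_space M
  using brownian by (simp add: brownian_motion_def)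

text \<open>The starting point is subtracted because the increments alone are known to be independent of each
  other; \<open>W 0\<close> is constant only almost surely. All hitting times of the walk depend on \<open>B\<close> alone.\<close>

definition B :: "real \<Rightarrow> 'a \<Rightarrow> real" where
  "B t \<omega> = W t \<omega> - W 0 \<omega>"

lemma measurable_W: "0 \<le> t \<Longrightarrow> W t \<in> borel_measurable M"
  using brownian by (simp add: brownian_motion_def)

lemma measurable_B: "0 \<le> t \<Longrightarrow> B t \<in> borel_measurable M"
  unfolding B_def[abs_def] by (intro borel_measurable_diff measurable_W) auto

lemma B_0 [simp]: "B 0 \<omega> = 0"
  by (simp add: B_def)

lemma B_diff: "B t \<omega> - B s \<omega> = W t \<omega> - W s \<omega>"
  by (simp add: B_def)

lemma continuous_W: "\<omega> \<in> space M \<Longrightarrow> continuous_on {0..} (\<lambda>t. W t \<omega>)"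
  using brownian by (simp add: brownian_motion_def)

lemma continuous_B: "\<omega> \<in> space M \<Longrightarrow> continuous_on {0..} (\<lambda>t. B t \<omega>)"
  unfolding B_def by (intro continuous_intros continuous_W)

lemma distributed_increment:
  assumes "0 \<le> s" "s < t"
  shows "distributed M lborel (\<lambda>\<omega>. B t \<omega> - B s \<omega>) (normal_density 0 (sqrt (t - s)))"
proof -
  have "\<forall>s t. 0 \<le> s \<and> s < t \<longrightarrow>
        distributed M lborel (\<lambda>\<omega>. W t \<omega> - W s \<omega>) (normal_density 0 (sqrt (t - s)))"
    using brownian unfolding brownian_motion_def by blast
  then show ?thesis using assms by (simp add: B_diff)
qed

lemma indep_increments:
  assumes "0 \<le> u 0" "\<And>i. i < n \<Longrightarrow> u i < u (Suc i)"
  shows "indep_vars (\<lambda>_. borel) (\<lambda>i \<omega>. B (u (Suc i)) \<omega> - B (u i) \<omega>) {..<n::nat}"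
proof -
  have "\<forall>(n::nat) (t::nat \<Rightarrow> real). 0 \<le> t 0 \<and> (\<forall>i<n. t i < t (Suc i)) \<longrightarrow>
        prob_space.indep_vars M (\<lambda>_. borel) (\<lambda>i \<omega>. W (t (Suc i)) \<omega> - W (t i) \<omega>) {..<n}"
    using brownian unfolding brownian_motion_def by blast
  then show ?thesis using assms by (simp add: B_diff)
qed

definition values_at :: "real set \<Rightarrow> 'a \<Rightarrow> real \<Rightarrow> real" where
  "values_at J \<omega> = (\<lambda>s\<in>J. B s \<omega>)"

text \<open>Sorted in time, the values at finitely many times up to \<open>t\<close> are partial sums of consecutive increments, all
  of which precede the one from \<open>t\<close> to \<open>v\<close>. The increment is wrapped into a function on a singleton because both
  sides of \<^const>\<open>prob_space.indep_var\<close> must have the same type.\<close>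

lemma indep_values_increment:
  assumes J: "finite J" "J \<subseteq> {0..t}" and t: "0 < t" "t < v"
  shows "indep_var (PiM J (\<lambda>_. borel)) (values_at J)
           (PiM {v} (\<lambda>_. borel)) (\<lambda>\<omega>. \<lambda>_\<in>{v}. B v \<omega> - B t \<omega>)"
proof -
  \<comment> \<open>Adding 0 and \<open>t\<close> makes the increments start at \<open>B 0 = 0\<close> and end at \<open>B t\<close>.\<close>
  define J' where "J' = J \<union> {0, t}"
  define xs where "xs = sorted_list_of_set J'"
  define n where "n = length xs - 1"
  define u where "u i = (if i \<le> n then xs ! i else v)" for i
  have finJ': "finite J'" using J by (simp add: J'_def)
  have set_xs: "set xs = J'" and sorted: "sorted_wrt (<) xs"
    using finJ' unfolding xs_def by (simp_all add: strict_sorted_list_of_set)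
  have len: "length xs = Suc n"
    using set_xs unfolding n_def J'_def by (cases xs) auto
  have J'sub: "J' \<subseteq> {0..t}" using J t by (auto simp: J'_def)
  have u_mem: "u i \<in> J'" if "i \<le> n" for i
    using that len set_xs by (auto simp: u_def intro!: nth_mem[of i xs, simplified set_xs])
  have u_inc: "u i < u j" if "i < j" "j \<le> n" for i j
    using sorted that len by (auto simp: u_def sorted_wrt_iff_nth_less)
  have ex_u: "\<exists>i\<le>n. u i = s" if "s \<in> J'" for s
    using that set_xs len by (auto simp: u_def in_set_conv_nth less_Suc_eq_le)
  have u0: "u 0 = 0"
  proof -
    obtain i where i: "i \<le> n" "u i = 0" using ex_u[of 0] by (auto simp: J'_def)
    have "u 0 \<in> {0..t}" using u_mem[of 0] J'sub by auto
    then show ?thesis using i u_inc[of 0 i] by (cases "i = 0") auto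
  qed
  have un: "u n = t"
  proof -
    obtain i where i: "i \<le> n" "u i = t" using ex_u[of t] by (auto simp: J'_def)
    have "u n \<in> {0..t}" using u_mem[of n] J'sub by auto
    then show ?thesis using i u_inc[of i n] by (cases "i = n") auto
  qed
  have uv: "u (Suc n) = v" by (simp add: u_def)
  have step: "u i < u (Suc i)" if "i < Suc n" for i
    using that u_inc[of i "Suc i"] un uv t by (cases "i = n") auto
  let ?D = "\<lambda>i \<omega>. B (u (Suc i)) \<omega> - B (u i) \<omega>"
  have ind: "indep_vars (\<lambda>_. borel) ?D {..<Suc n}"
    by (rule indep_increments) (use u0 step in auto)
  have iv: "indep_var (PiM {..<n} (\<lambda>_. borel)) (\<lambda>\<omega>. restrict (\<lambda>i. ?D i \<omega>) {..<n})
             (PiM {n} (\<lambda>_. borel)) (\<lambda>\<omega>. restrict (\<lambda>i. ?D i \<omega>) {n})"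
    by (rule indep_var_restrict[OF ind]) auto
  have tele: "(\<Sum>i<k. ?D i \<omega>) = B (u k) \<omega>" for k \<omega>
    using sum_lessThan_telescope[of "\<lambda>i. B (u i) \<omega>" k] u0 by simp
  obtain idx where idx: "\<And>s. s \<in> J \<Longrightarrow> idx s \<le> n \<and> u (idx s) = s"
    using ex_u by (metis J'_def UnI1)
  let ?Y1 = "\<lambda>x. \<lambda>s\<in>J. \<Sum>i<idx s. x i :: real"
  have m1: "?Y1 \<in> measurable (PiM {..<n} (\<lambda>_. borel)) (PiM J (\<lambda>_. borel))"
  proof (rule measurable_restrict)
    fix s assume "s \<in> J"
    then have "idx s \<le> n" using idx by auto
    then show "(\<lambda>x. \<Sum>i<idx s. x i :: real) \<in> borel_measurable (PiM {..<n} (\<lambda>_. borel))"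
      by (intro borel_measurable_sum) auto
  qed
  let ?Y2 = "\<lambda>x. \<lambda>_\<in>{v}. x n :: real"
  have m2: "?Y2 \<in> measurable (PiM {n} (\<lambda>_. borel)) (PiM {v} (\<lambda>_. borel))"
    by (intro measurable_restrict measurable_component_singleton) auto
  have "indep_var (PiM J (\<lambda>_. borel)) (?Y1 \<circ> (\<lambda>\<omega>. restrict (\<lambda>i. ?D i \<omega>) {..<n}))
             (PiM {v} (\<lambda>_. borel)) (?Y2 \<circ> (\<lambda>\<omega>. restrict (\<lambda>i. ?D i \<omega>) {n}))"
    by (rule indep_var_compose[OF iv m1 m2])
  also have "?Y1 \<circ> (\<lambda>\<omega>. restrict (\<lambda>i. ?D i \<omega>) {..<n}) = values_at J"
  proof (intro ext)
    fix \<omega> s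
    have "(\<Sum>i<idx s. restrict (\<lambda>i. ?D i \<omega>) {..<n} i) = B s \<omega>" if "s \<in> J"
    proof -
      have "(\<Sum>i<idx s. restrict (\<lambda>i. ?D i \<omega>) {..<n} i) = (\<Sum>i<idx s. ?D i \<omega>)"
        using idx[OF that] by (intro sum.cong) auto
      then show ?thesis using tele idx[OF that] by simp
    qed
    then show "(?Y1 \<circ> (\<lambda>\<omega>. restrict (\<lambda>i. ?D i \<omega>) {..<n})) \<omega> s = values_at J \<omega> s"
      by (simp add: values_at_def restrict_def)
  qed
  also have "?Y2 \<circ> (\<lambda>\<omega>. restrict (\<lambda>i. ?D i \<omega>) {n}) = (\<lambda>\<omega>. \<lambda>_\<in>{v}. B v \<omega> - B t \<omega>)"
    by (auto simp: un uv comp_def)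
  finally show ?thesis .
qed

definition cylinders :: "real \<Rightarrow> 'a set set" where
  "cylinders t = {values_at J -` A \<inter> space M | J A. finite J \<and> J \<subseteq> {0..t} \<and> A \<in> sets (PiM J (\<lambda>_. borel))}"

text \<open>The natural filtration of \<open>B\<close>, generated by an intersection-stable family so that
  independence can be checked on the generators.\<close>

definition past :: "real \<Rightarrow> 'a measure" where
  "past t = sigma (space M) (cylinders t)"

lemma cylinders_Pow: "cylinders t \<subseteq> Pow (space M)"
  by (auto simp: cylinders_def)

lemma space_past [simp]: "space (past t) = space M"
  by (simp add: past_def cylinders_Pow)

lemma sets_past: "sets (past t) = sigma_sets (space M) (cylinders t)"
  by (simp add: past_def cylinders_Pow)

lemma cylinders_Int_stable: "Int_stable (cylinders t)"
proof (rule Int_stableI)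
  fix X Y assume "X \<in> cylinders t" "Y \<in> cylinders t"
  then obtain J A K C where
    J: "finite J" "J \<subseteq> {0..t}" "A \<in> sets (PiM J (\<lambda>_. borel))" "X = values_at J -` A \<inter> space M" and
    K: "finite K" "K \<subseteq> {0..t}" "C \<in> sets (PiM K (\<lambda>_. borel))" "Y = values_at K -` C \<inter> space M"
    unfolding cylinders_def by blast
  let ?P = "PiM (J \<union> K) (\<lambda>_. borel :: real measure)"
  let ?E = "((\<lambda>x. restrict x J) -` A \<inter> space ?P) \<inter> ((\<lambda>x. restrict x K) -` C \<inter> space ?P)"
  have "?E \<in> sets ?P"
    by (intro sets.Int measurable_sets[OF measurable_restrict_subset] J K) auto
  moreover have "X \<inter> Y = values_at (J \<union> K) -` ?E \<inter> space M"
  proof -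
    have "restrict (values_at (J \<union> K) \<omega>) J = values_at J \<omega>" "restrict (values_at (J \<union> K) \<omega>) K = values_at K \<omega>"
      "values_at (J \<union> K) \<omega> \<in> space ?P" for \<omega>
      by (simp_all add: values_at_def space_PiM Int_absorb1)
    then show ?thesis unfolding J(4) K(4) by auto
  qed
  moreover have "finite (J \<union> K)" "J \<union> K \<subseteq> {0..t}" using J K by auto
  ultimately show "X \<inter> Y \<in> cylinders t"
    unfolding cylinders_def by blast
qed

lemma measurable_values_at: "J \<subseteq> {0..} \<Longrightarrow> values_at J \<in> measurable M (PiM J (\<lambda>_. borel))"
  unfolding values_at_def[abs_def] by (intro measurable_restrict measurable_B) auto

lemma cylinders_subset: "cylinders t \<subseteq> sets M"
  by (auto simp: cylinders_def intro!: measurable_sets[OF measurable_values_at])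

lemma past_subset: "sets (past t) \<subseteq> sets M"
  unfolding sets_past by (rule sets.sigma_sets_subset[OF cylinders_subset])

lemma past_mono: "s \<le> t \<Longrightarrow> sets (past s) \<subseteq> sets (past t)"
  unfolding sets_past by (rule sigma_sets_mono') (force simp: cylinders_def)


lemma measurable_past_imp: "f \<in> measurable (past s) N \<Longrightarrow> f \<in> measurable M N"
  using past_subset[of s] by (auto simp: measurable_def)

lemma measurable_B_past:
  assumes "0 \<le> s" "s \<le> t" shows "B s \<in> borel_measurable (past t)"
proof (rule measurableI)
  fix S :: "real set" assume S: "S \<in> sets borel"
  have "B s -` S \<inter> space M = values_at {s} -` ((\<lambda>x. x s) -` S \<inter> space (PiM {s} (\<lambda>_. borel))) \<inter> space M"
    by (auto simp: values_at_def space_PiM)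
  moreover have "(\<lambda>x. x s) -` S \<inter> space (PiM {s} (\<lambda>_. borel :: real measure)) \<in> sets (PiM {s} (\<lambda>_. borel))"
    by (intro measurable_sets[OF measurable_component_singleton] S) auto
  ultimately have "B s -` S \<inter> space M \<in> cylinders t"
    unfolding cylinders_def using assms by (intro CollectI exI[of _ "{s}"] exI conjI) auto
  then show "B s -` S \<inter> space (past t) \<in> sets (past t)"
    by (simp add: sets_past sigma_sets.Basic)
qed simp

text \<open>Dynkin's lemma lifts independence from the cylinder sets to the generated \<open>\<sigma>\<close>-algebra.\<close>

lemma indep_past_increment:
  assumes t: "0 < t" "t < v" and Y: "Y \<in> measurable (past t) N"
    and g: "g \<in> measurable borel N'"
  shows "indep_var N Y N' (\<lambda>\<omega>. g (B v \<omega> - B t \<omega>))"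
proof -
  let ?X = "\<lambda>\<omega>. B v \<omega> - B t \<omega>"
  have rv: "?X \<in> borel_measurable M"
    using t by (intro borel_measurable_diff measurable_B) auto
  define G where "G = {?X -` A \<inter> space M | A. A \<in> sets borel}"
  have IG: "Int_stable G"
    unfolding G_def Int_stable_def by (safe, rule_tac x="A \<inter> Aa" in exI) auto
  have GM: "G \<subseteq> sets M" unfolding G_def using rv by auto
  have "indep_set (cylinders t) G"
  proof (rule indep_setI[OF cylinders_subset GM])
    fix a b assume "a \<in> cylinders t" "b \<in> G"
    then obtain J A S where J: "finite J" "J \<subseteq> {0..t}" "A \<in> sets (PiM J (\<lambda>_. borel))" 
      "a = values_at J -` A \<inter> space M" and S: "S \<in> sets borel" "b = ?X -` S \<inter> space M"
      unfolding cylinders_def G_def by blast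
    let ?V = "\<lambda>\<omega>. \<lambda>_\<in>{v}. ?X \<omega>" and ?P = "PiM {v} (\<lambda>_. borel :: real measure)"
    let ?S = "(\<lambda>x. x v) -` S \<inter> space ?P"
    have S': "?S \<in> sets ?P"
      by (intro measurable_sets[OF measurable_component_singleton] S) auto
    have "prob ((\<lambda>x. (values_at J x, ?V x)) -` (A \<times> ?S) \<inter> space M) =
        prob (values_at J -` A \<inter> space M) * prob (?V -` ?S \<inter> space M)"
      by (rule indep_varD[OF indep_values_increment[OF J(1,2) t] J(3) S'])
    moreover have "(\<lambda>x. (values_at J x, ?V x)) -` (A \<times> ?S) \<inter> space M = a \<inter> b"
      "?V -` ?S \<inter> space M = b"
      using J S by (auto simp: space_PiM)
    ultimately show "prob (a \<inter> b) = prob a * prob b" using J S by simp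
  qed
  then have *: "indep_set (sigma_sets (space M) (cylinders t)) (sigma_sets (space M) G)"
    by (rule indep_set_sigma_sets[OF _ cylinders_Int_stable IG])
  have sub: "sigma_sets (space M) {Y -` A \<inter> space M | A. A \<in> sets N} \<subseteq> sigma_sets (space M) (cylinders t)"
    using Y unfolding sets_past[symmetric]
    by (intro sets.sigma_sets_subset[of _ "past t", simplified]) (auto simp: measurable_def)
  have sub': "sigma_sets (space M) {(\<lambda>\<omega>. g (?X \<omega>)) -` A \<inter> space M | A. A \<in> sets N'} \<subseteq> sigma_sets (space M) G"
  proof (rule sigma_sets_mono')
    show "{(\<lambda>\<omega>. g (?X \<omega>)) -` A \<inter> space M | A. A \<in> sets N'} \<subseteq> G"
    proof safe
      fix A assume "A \<in> sets N'"
      then have "g -` A \<in> sets borel" using measurable_sets[OF g] by simp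
      moreover have "(\<lambda>\<omega>. g (?X \<omega>)) -` A \<inter> space M = ?X -` (g -` A) \<inter> space M" by auto
      ultimately show "(\<lambda>\<omega>. g (?X \<omega>)) -` A \<inter> space M \<in> G" unfolding G_def by blast
    qed
  qed
  show ?thesis
    unfolding indep_var_eq
  proof (intro conjI measurable_compose[OF rv g])
    show "Y \<in> measurable M N" by (rule measurable_past_imp[OF Y])
    show "indep_set (sigma_sets (space M) {Y -` A \<inter> space M |A. A \<in> sets N})
          (sigma_sets (space M) {(\<lambda>\<omega>. g (?X \<omega>)) -` A \<inter> space M |A. A \<in> sets N'})"
      using * sub sub' unfolding indep_sets2_eq by blast
  qed
qed

lemma char_increment:
  assumes "0 \<le> s" "s < t"
  shows "(\<integral>\<omega>. iexp (\<theta> * (B t \<omega> - B s \<omega>)) \<partial>M) = complex_of_real (exp (- (\<theta>\<^sup>2) * (t - s) / 2))"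
proof -
  define c where "c = sqrt (t - s)"
  have c: "0 < c" using assms by (simp add: c_def)
  have D: "distributed M lborel (\<lambda>\<omega>. B t \<omega> - B s \<omega>) (normal_density 0 c)"
    using distributed_increment[OF assms] by (simp add: c_def)
  have "distributed M lborel (\<lambda>\<omega>. (B t \<omega> - B s \<omega> - 0) / c) std_normal_density"
    using D c by (subst normal_standard_normal_convert[symmetric]) auto
  then have D': "distributed M lborel (\<lambda>\<omega>. (B t \<omega> - B s \<omega>) / c) std_normal_density" by simp
  have "(\<integral>\<omega>. iexp (\<theta> * (B t \<omega> - B s \<omega>)) \<partial>M) = (\<integral>\<omega>. iexp ((\<theta> * c) * ((B t \<omega> - B s \<omega>) / c)) \<partial>M)"
    using c by simp
  also have "\<dots> = (\<integral>x. iexp ((\<theta> * c) * x) \<partial>distr M lborel (\<lambda>\<omega>. (B t \<omega> - B s \<omega>) / c))"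
    using distributed_measurable[OF D'] by (subst integral_distr) auto
  also have "distr M lborel (\<lambda>\<omega>. (B t \<omega> - B s \<omega>) / c) = std_normal_distribution"
    using D' by (simp add: distributed_def)
  also have "(\<integral>x. iexp ((\<theta> * c) * x) \<partial>std_normal_distribution) = complex_of_real (exp (- ((\<theta> * c)\<^sup>2) / 2))"
    using char_std_normal_distribution by (metis char_def)
  also have "(\<theta> * c)\<^sup>2 = \<theta>\<^sup>2 * (t - s)"
    using assms by (simp add: power_mult_distrib c_def)
  finally show ?thesis by simp
qed

text \<open>The martingale property of the exponential at two fixed times, tested against a bounded variable known
  at the first one: by independence the expectation factorises, and the second factor is 1.\<close>

lemma wald_fixed:
  fixes Y :: "'a \<Rightarrow> complex"
  assumes t: "0 < t" "t < v" and Y: "Y \<in> borel_measurable (past t)" and bdd: "\<And>\<omega>. \<omega> \<in> space M \<Longrightarrow> norm (Y \<omega>) \<le> K"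
  shows "(\<integral>\<omega>. Y \<omega> * wald_exp \<theta> (v - t) (B v \<omega> - B t \<omega>) \<partial>M) = (\<integral>\<omega>. Y \<omega> \<partial>M)"
proof -
  let ?X = "\<lambda>\<omega>. B v \<omega> - B t \<omega>"
  have f: "wald_exp \<theta> (v - t) \<in> borel_measurable borel" by measurable
  have iv: "indep_var borel Y borel (\<lambda>\<omega>. wald_exp \<theta> (v - t) (?X \<omega>))"
    by (rule indep_past_increment[OF t Y f])
  have X: "?X \<in> borel_measurable M" using t by (intro borel_measurable_diff measurable_B) auto
  have i1: "integrable M Y"
    using bdd by (intro integrable_const_bound[where B=K] measurable_past_imp[OF Y]) auto
  have i2: "integrable M (\<lambda>\<omega>. wald_exp \<theta> (v - t) (?X \<omega>))"
    using measurable_compose[OF X f]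
    by (intro integrable_const_bound[where B="exp (\<theta>\<^sup>2 * (v - t) / 2)"]) auto
  have "(\<integral>\<omega>. Y \<omega> * wald_exp \<theta> (v - t) (?X \<omega>) \<partial>M) = (\<integral>\<omega>. Y \<omega> \<partial>M) * (\<integral>\<omega>. wald_exp \<theta> (v - t) (?X \<omega>) \<partial>M)"
    by (rule indep_var_lebesgue_integral[OF iv i1 i2])
  also have "(\<integral>\<omega>. wald_exp \<theta> (v - t) (?X \<omega>) \<partial>M) = (\<integral>\<omega>. iexp (\<theta> * ?X \<omega>) \<partial>M) * exp (\<theta>\<^sup>2 * (v - t) / 2)"
    by (simp add: wald_exp_def)
  also have "\<dots> = 1"
    using t by (subst char_increment) (auto simp flip: of_real_mult exp_add)
  finally show ?thesis by simp
qed

end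

section \<open>Stopping the exponential martingale\<close>

text \<open>The next point of the grid of mesh \<open>1 / c\<close> strictly after \<open>r\<close>. Strictness matters: the grid point is
  \<open>t\<close> exactly if \<open>t - 1 / c \<le> r < t\<close>, which for a random \<open>r\<close> is expressed by the events \<open>r < t\<close> and
  \<open>r < t - 1 / c\<close>.\<close>

definition grid_above :: "real \<Rightarrow> real \<Rightarrow> real" where
  "grid_above c r = (real_of_int \<lfloor>c * r\<rfloor> + 1) / c"

lemma grid_above_bounds:
  assumes "0 < c"
  shows "r < grid_above c r" "grid_above c r \<le> r + 1 / c"
proof -
  have "c * r < real_of_int \<lfloor>c * r\<rfloor> + 1" "real_of_int \<lfloor>c * r\<rfloor> + 1 \<le> c * r + 1" by linarith+
  then show "r < grid_above c r" "grid_above c r \<le> r + 1 / c"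
    using assms by (auto simp: grid_above_def field_simps)
qed

lemma grid_above_tendsto:
  assumes "0 < c0"
  shows "(\<lambda>m::nat. grid_above (real m + c0) r) \<longlonglongrightarrow> r"
proof (rule real_tendsto_sandwich)
  show "\<forall>\<^sub>F m in sequentially. r \<le> grid_above (real m + c0) r"
    using assms by (intro always_eventually allI less_imp_le grid_above_bounds) auto
  show "\<forall>\<^sub>F m in sequentially. grid_above (real m + c0) r \<le> r + 1 / (real m + c0)"
    using assms by (intro always_eventually allI grid_above_bounds) auto
  show "(\<lambda>m::nat. r + 1 / (real m + c0)) \<longlonglongrightarrow> r" by real_asymp
qed auto

context brownian begin

lemma B_tendsto:
  assumes "\<omega> \<in> space M" "f \<longlonglongrightarrow> r" "0 \<le> r" "\<And>m. 0 \<le> f m"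
  shows "(\<lambda>m. B (f m) \<omega>) \<longlonglongrightarrow> B r \<omega>"
  by (rule continuous_on_tendsto_compose[OF continuous_B assms(2)]) (use assms in auto)

text \<open>Paths are continuous, so the value at a random time is the limit of values at grid times, of which there are
  countably many; capping them at \<open>t\<close> keeps the approximations measurable with respect to the past of \<open>t\<close>.\<close>

lemma measurable_B_at:
  assumes g: "g \<in> borel_measurable (past t)" and bds: "\<And>\<omega>. \<omega> \<in> space M \<Longrightarrow> 0 \<le> g \<omega> \<and> g \<omega> \<le> t"
  shows "(\<lambda>\<omega>. B (g \<omega>) \<omega>) \<in> borel_measurable (past t)"
proof (rule borel_measurable_LIMSEQ_real)
  let ?u = "\<lambda>m \<omega>. min (grid_above (real m + 1) (g \<omega>)) t"
  fix \<omega> assume "\<omega> \<in> space (past t)"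
  then have \<omega>: "\<omega> \<in> space M" by simp
  have "(\<lambda>m. ?u m \<omega>) \<longlonglongrightarrow> min (g \<omega>) t"
    by (intro tendsto_min grid_above_tendsto tendsto_const) auto
  then have lim: "(\<lambda>m. ?u m \<omega>) \<longlonglongrightarrow> g \<omega>" using bds[OF \<omega>] by simp
  have pos: "0 \<le> ?u m \<omega>" for m
    using grid_above_bounds(1)[of "real m + 1" "g \<omega>"] bds[OF \<omega>] by auto
  show "(\<lambda>m. B (?u m \<omega>) \<omega>) \<longlonglongrightarrow> B (g \<omega>) \<omega>"
    using B_tendsto[OF \<omega> lim _ pos] bds[OF \<omega>] by auto
next
  fix m
  \<comment> \<open>The maximum with 0 gives a time in the domain of \<open>B\<close> for every integer \<open>k\<close>.\<close>
  let ?f = "\<lambda>k::int. \<lambda>\<omega>. B (min ((max 0 (real_of_int k) + 1) / (real m + 1)) t) \<omega>"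
  have "(\<lambda>\<omega>. ?f \<lfloor>(real m + 1) * g \<omega>\<rfloor> \<omega>) \<in> borel_measurable (past t)"
  proof (rule measurable_compose_countable[where f = ?f and g = "\<lambda>\<omega>. \<lfloor>(real m + 1) * g \<omega>\<rfloor>"])
    show "(\<lambda>\<omega>. \<lfloor>(real m + 1) * g \<omega>\<rfloor>) \<in> measurable (past t) (count_space UNIV)"
      using g by measurable
    fix k
    show "?f k \<in> borel_measurable (past t)"
    proof (cases "0 \<le> t")
      case True
      then show ?thesis by (intro measurable_B_past) auto
    next
      case False
      then have "space (past t) = {}" using bds by fastforce
      then show ?thesis by (simp add: measurable_def)
    qed
  qed
  also have "?this \<longleftrightarrow> (\<lambda>\<omega>. B (min (grid_above (real m + 1) (g \<omega>)) t) \<omega>) \<in> borel_measurable (past t)"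
    using bds by (intro measurable_cong) (auto simp: grid_above_def max_def)
  finally show "(\<lambda>\<omega>. B (min (grid_above (real m + 1) (g \<omega>)) t) \<omega>) \<in> borel_measurable (past t)" .
qed

text \<open>Stopping times in the wide sense: strict inequalities correspond to the filtration made right
  continuous, and they are what approximation from above by grid times requires.\<close>

definition optional :: "('a \<Rightarrow> real) \<Rightarrow> bool" where
  "optional \<rho> \<longleftrightarrow> (\<forall>t. {\<omega> \<in> space M. \<rho> \<omega> < t} \<in> sets (past t))"

lemma optional_min_measurable:
  assumes "optional \<rho>" shows "(\<lambda>\<omega>. min (\<rho> \<omega>) t) \<in> borel_measurable (past t)"
  unfolding borel_measurable_iff_less
proof
  fix a
  show "{\<omega> \<in> space (past t). min (\<rho> \<omega>) t < a} \<in> sets (past t)"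
  proof (cases "t < a")
    case True
    then show ?thesis by (auto simp: min_less_iff_disj intro: sets.top[of "past t", simplified])
  next
    case False
    then have "{\<omega> \<in> space (past t). min (\<rho> \<omega>) t < a} = {\<omega> \<in> space M. \<rho> \<omega> < a}" by auto
    then show ?thesis using assms past_mono[of a t] False by (auto simp: optional_def)
  qed
qed

lemma optional_measurable:
  assumes "optional \<rho>" shows "\<rho> \<in> borel_measurable M"
  unfolding borel_measurable_iff_less using assms past_subset by (auto simp: optional_def)

lemma optional_const: "optional (\<lambda>_. c)"
  unfolding optional_def using sets.top[of "past t" for t] by (auto split: if_splits)

lemma optional_min: "optional \<rho> \<Longrightarrow> optional \<sigma> \<Longrightarrow> optional (\<lambda>\<omega>. min (\<rho> \<omega>) (\<sigma> \<omega>))"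
  unfolding optional_def by (simp add: min_less_iff_disj Collect_disj_eq conj_disj_distribL sets.Un)

lemma optional_max: "optional \<rho> \<Longrightarrow> optional \<sigma> \<Longrightarrow> optional (\<lambda>\<omega>. max (\<rho> \<omega>) (\<sigma> \<omega>))"
proof -
  assume "optional \<rho>" "optional \<sigma>"
  moreover have "{\<omega> \<in> space M. max (\<rho> \<omega>) (\<sigma> \<omega>) < t} = {\<omega> \<in> space M. \<rho> \<omega> < t} \<inter> {\<omega> \<in> space M. \<sigma> \<omega> < t}" for t
    by auto
  ultimately show ?thesis unfolding optional_def by auto
qed

text \<open>Measurability with respect to the \<open>\<sigma>\<close>-algebra of events known immediately after \<open>\<rho>\<close>, spelled out
  for a single variable.\<close>

definition known_before :: "('a \<Rightarrow> real) \<Rightarrow> ('a \<Rightarrow> complex) \<Rightarrow> bool" where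
  "known_before \<rho> Z \<longleftrightarrow> (\<forall>t. (\<lambda>\<omega>. if \<rho> \<omega> < t then Z \<omega> else 0) \<in> borel_measurable (past t))"

lemma known_before_measurable:
  assumes "known_before \<rho> Z" "\<And>\<omega>. \<omega> \<in> space M \<Longrightarrow> \<rho> \<omega> \<le> N"
  shows "Z \<in> borel_measurable M"
proof -
  have "(\<lambda>\<omega>. if \<rho> \<omega> < N + 1 then Z \<omega> else 0) \<in> borel_measurable M"
    using assms(1) by (auto simp: known_before_def intro: measurable_past_imp)
  also have "?this \<longleftrightarrow> Z \<in> borel_measurable M"
    using assms(2) by (intro measurable_cong) force
  finally show ?thesis .
qed

lemma known_before_comp:
  assumes g: "g \<in> borel_measurable borel" and \<rho>: "optional \<rho>" "\<And>\<omega>. \<omega> \<in> space M \<Longrightarrow> 0 \<le> \<rho> \<omega>"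
  shows "known_before \<rho> (\<lambda>\<omega>. g (\<rho> \<omega>, B (\<rho> \<omega>) \<omega>))"
  unfolding known_before_def
proof
  fix t
  let ?r = "\<lambda>\<omega>. min (\<rho> \<omega>) t"
  have *: "(\<lambda>\<omega>. if \<rho> \<omega> < t then g (\<rho> \<omega>, B (\<rho> \<omega>) \<omega>) else 0) =
     (\<lambda>\<omega>. if \<rho> \<omega> < t then g (?r \<omega>, B (?r \<omega>) \<omega>) else 0)" by (auto simp: fun_eq_iff)
  show "(\<lambda>\<omega>. if \<rho> \<omega> < t then g (\<rho> \<omega>, B (\<rho> \<omega>) \<omega>) else 0) \<in> borel_measurable (past t)"
  proof (cases "0 \<le> t")
    case True
    have r: "?r \<in> borel_measurable (past t)" by (rule optional_min_measurable[OF \<rho>(1)])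
    moreover have "(\<lambda>\<omega>. B (?r \<omega>) \<omega>) \<in> borel_measurable (past t)"
      by (rule measurable_B_at[OF r]) (use \<rho>(2) True in auto)
    ultimately have "(\<lambda>\<omega>. g (?r \<omega>, B (?r \<omega>) \<omega>)) \<in> borel_measurable (past t)"
      using g by (intro measurable_compose[OF _ g] borel_measurable_Pair)
    moreover have "{\<omega> \<in> space (past t). \<rho> \<omega> < t} \<in> sets (past t)" using \<rho>(1) by (simp add: optional_def)
    ultimately show ?thesis unfolding * by (intro measurable_If) auto
  next
    case False
    have "(\<lambda>\<omega>. 0 :: complex) \<in> borel_measurable (past t)" by simp
    also have "?this \<longleftrightarrow> ?thesis" using \<rho>(2) False by (intro measurable_cong) force
    finally show ?thesis .
  qed
qed

lemma known_before_later:
  assumes "known_before \<rho> Z" "optional \<sigma>" "\<And>\<omega>. \<omega> \<in> space M \<Longrightarrow> \<rho> \<omega> \<le> \<sigma> \<omega>"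
  shows "known_before \<sigma> Z"
  unfolding known_before_def
proof
  fix t
  have "{\<omega> \<in> space (past t). \<sigma> \<omega> < t} \<in> sets (past t)" using assms(2) by (simp add: optional_def)
  then have "(\<lambda>\<omega>. if \<sigma> \<omega> < t then (if \<rho> \<omega> < t then Z \<omega> else 0) else 0) \<in> borel_measurable (past t)"
    using assms(1) by (intro measurable_If[of _ _ _ _ "\<lambda>\<omega>. \<sigma> \<omega> < t"]) (auto simp: known_before_def)
  also have "?this \<longleftrightarrow> (\<lambda>\<omega>. if \<sigma> \<omega> < t then Z \<omega> else 0) \<in> borel_measurable (past t)"
    using assms(3) by (intro measurable_cong) force
  finally show "(\<lambda>\<omega>. if \<sigma> \<omega> < t then Z \<omega> else 0) \<in> borel_measurable (past t)" .
qed

lemma known_before_mult: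
  assumes "known_before \<rho> Y" "known_before \<rho> Z"
  shows "known_before \<rho> (\<lambda>\<omega>. Y \<omega> * Z \<omega>)"
  unfolding known_before_def
proof
  fix t
  have "(\<lambda>\<omega>. (if \<rho> \<omega> < t then Y \<omega> else 0) * (if \<rho> \<omega> < t then Z \<omega> else 0)) \<in> borel_measurable (past t)"
    using assms by (intro borel_measurable_times) (auto simp: known_before_def)
  then show "(\<lambda>\<omega>. if \<rho> \<omega> < t then Y \<omega> * Z \<omega> else 0) \<in> borel_measurable (past t)"
    by (rule back_subst[of "\<lambda>f. f \<in> _"]) auto
qed

lemma measurable_B_at_optional:
  assumes "optional \<rho>" "\<And>\<omega>. \<omega> \<in> space M \<Longrightarrow> 0 \<le> \<rho> \<omega> \<and> \<rho> \<omega> \<le> N"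
  shows "(\<lambda>\<omega>. B (\<rho> \<omega>) \<omega>) \<in> borel_measurable M"
proof -
  have "(\<lambda>\<omega>. min (\<rho> \<omega>) N) \<in> borel_measurable (past N)" by (rule optional_min_measurable[OF assms(1)])
  then have "\<rho> \<in> borel_measurable (past N)"
    by (rule measurable_cong[THEN iffD1, rotated]) (use assms in auto)
  then show ?thesis
    by (intro measurable_past_imp[OF measurable_B_at]) (use assms in auto)
qed

text \<open>On a grid the claim is a finite sum of instances of \<open>wald_fixed\<close>. The integrands are bounded uniformly in
  the mesh and converge by continuity of the paths, so the claim survives the limit.\<close>

lemma wald_optional:
  fixes Z :: "'a \<Rightarrow> complex"
  assumes \<rho>: "optional \<rho>" and bds: "\<And>\<omega>. \<omega> \<in> space M \<Longrightarrow> 0 \<le> \<rho> \<omega> \<and> \<rho> \<omega> \<le> N" and v: "N < v"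
    and Z: "known_before \<rho> Z" "\<And>\<omega>. \<omega> \<in> space M \<Longrightarrow> norm (Z \<omega>) \<le> K"
  shows "(\<integral>\<omega>. Z \<omega> * wald_exp \<theta> (v - \<rho> \<omega>) (B v \<omega> - B (\<rho> \<omega>) \<omega>) \<partial>M) = (\<integral>\<omega>. Z \<omega> \<partial>M)"
proof -
  define e where "e t \<omega> = wald_exp \<theta> (v - t) (B v \<omega> - B t \<omega>)" for t \<omega>
  \<comment> \<open>The mesh \<open>1 / c m\<close> is below \<open>v - N\<close>, so all grid times stay strictly before \<open>v\<close>.\<close>
  define c0 where "c0 = 1 / (v - N) + 1"
  define c where "c m = real m + c0" for m
  have c0: "0 < c0" using v by (simp add: c0_def add_pos_pos)
  have c: "0 < c m" "N + 1 / c m < v" for m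
  proof -
    show "0 < c m" using c0 by (simp add: c_def)
    have "1 / (v - N) < c m" by (simp add: c_def c0_def)
    then show "N + 1 / c m < v" using v \<open>0 < c m\<close> by (simp add: field_simps)
  qed
  have "0 \<le> N" using bds not_empty by fastforce
  have K: "0 \<le> K" using Z(2) not_empty norm_ge_zero order_trans by blast
  have Zm: "Z \<in> borel_measurable M" by (rule known_before_measurable[OF Z(1)]) (use bds in auto)
  have em: "e t \<in> borel_measurable M" if "0 \<le> t" for t
  proof -
    have [measurable]: "B t \<in> borel_measurable M" "B v \<in> borel_measurable M"
      using that v \<open>0 \<le> N\<close> by (auto intro: measurable_B)
    show ?thesis unfolding e_def by measurable
  qed
  have e_norm: "norm (e t \<omega>) \<le> exp (\<theta>\<^sup>2 * v / 2)" if "0 \<le> t" for t \<omega>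
    unfolding e_def by (rule norm_wald_exp_le) (use that in simp)
  have grid_eq: "(\<integral>\<omega>. Z \<omega> * e (grid_above (c m) (\<rho> \<omega>)) \<omega> \<partial>M) = (\<integral>\<omega>. Z \<omega> \<partial>M)" for m
  proof -
    \<comment> \<open>The grid time is \<open>t j\<close> on the event \<open>idx = j\<close>, which is known at \<open>t j\<close>.\<close>
    define L where "L = nat \<lfloor>c m * N\<rfloor>"
    define idx where "idx \<omega> = nat \<lfloor>c m * \<rho> \<omega>\<rfloor>" for \<omega>
    define t where "t j = (real j + 1) / c m" for j
    define Y where "Y j \<omega> = (if idx \<omega> = j then Z \<omega> else 0)" for j \<omega>
    have cpos: "0 < c m" by (rule c)
    have t: "0 < t j" "t j < v" if "j \<le> L" for j
    proof -
      show "0 < t j" using cpos by (simp add: t_def add_nonneg_pos)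
      have "real j \<le> c m * N" using that cpos \<open>0 \<le> N\<close> unfolding L_def
        by (smt (verit) of_int_floor_le of_nat_floor of_nat_le_iff zero_le_mult_iff nat_floor_neg)
      then have "t j \<le> N + 1 / c m" using cpos by (simp add: t_def field_simps)
      then show "t j < v" using c(2)[of m] by simp
    qed
    have idx_iff: "idx \<omega> = j \<longleftrightarrow> \<rho> \<omega> < t j \<and> \<not> \<rho> \<omega> < real j / c m" if "\<omega> \<in> space M" for \<omega> j
    proof -
      have "0 \<le> c m * \<rho> \<omega>" using bds[OF that] cpos by simp
      then have "idx \<omega> = j \<longleftrightarrow> real j \<le> c m * \<rho> \<omega> \<and> c m * \<rho> \<omega> < real j + 1"
        unfolding idx_def by (auto simp: nat_eq_iff floor_eq_iff)
      then show ?thesis using cpos by (auto simp: t_def field_simps)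
    qed
    have Y_meas: "Y j \<in> borel_measurable (past (t j))" for j
    proof -
      have "{\<omega> \<in> space M. \<rho> \<omega> < real j / c m} \<in> sets (past (real j / c m))"
        using \<rho> by (simp add: optional_def)
      moreover have "real j / c m \<le> t j" using cpos by (simp add: t_def divide_right_mono)
      ultimately have "{\<omega> \<in> space (past (t j)). \<rho> \<omega> < real j / c m} \<in> sets (past (t j))"
        using past_mono by auto
      moreover have "(\<lambda>\<omega>. if \<rho> \<omega> < t j then Z \<omega> else 0) \<in> borel_measurable (past (t j))"
        using Z by (simp add: known_before_def)
      ultimately have "(\<lambda>\<omega>. if \<rho> \<omega> < real j / c m then 0 else (if \<rho> \<omega> < t j then Z \<omega> else 0)) \<in> borel_measurable (past (t j))"
        by (intro measurable_If[of _ _ _ _ "\<lambda>\<omega>. \<rho> \<omega> < real j / c m"]) auto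
      also have "?this \<longleftrightarrow> ?thesis"
        using idx_iff by (intro measurable_cong) (auto simp: Y_def)
      finally show ?thesis .
    qed
    have Y_norm: "norm (Y j \<omega>) \<le> K" if "\<omega> \<in> space M" for j \<omega>
      using Z(2)[OF that] K by (auto simp: Y_def)
    have Y_meas': "Y j \<in> borel_measurable M" for j by (rule measurable_past_imp[OF Y_meas])
    have int_Y: "integrable M (Y j)" for j
      using Y_norm by (intro integrable_const_bound[where B = K] Y_meas') auto
    have int_Ye: "integrable M (\<lambda>\<omega>. Y j \<omega> * e (t j) \<omega>)" if "j \<le> L" for j
      using Y_norm e_norm t[OF that] em[of "t j"] Y_meas' K
      by (intro integrable_const_bound[where B = "K * exp (\<theta>\<^sup>2 * v / 2)"])
         (auto simp: norm_mult intro!: mult_mono borel_measurable_times)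
    have idx_le: "idx \<omega> \<le> L" if "\<omega> \<in> space M" for \<omega>
      unfolding idx_def L_def using bds[OF that] cpos by (intro nat_mono floor_mono mult_left_mono) auto
    have grid: "grid_above (c m) (\<rho> \<omega>) = t (idx \<omega>)" if "\<omega> \<in> space M" for \<omega>
      using bds[OF that] cpos by (simp add: grid_above_def t_def idx_def)
    have "(\<integral>\<omega>. Z \<omega> * e (grid_above (c m) (\<rho> \<omega>)) \<omega> \<partial>M) = (\<integral>\<omega>. (\<Sum>j\<le>L. Y j \<omega> * e (t j) \<omega>) \<partial>M)"
    proof (rule Bochner_Integration.integral_cong)
      fix \<omega> assume \<omega>: "\<omega> \<in> space M"
      have "(\<Sum>j\<le>L. Y j \<omega> * e (t j) \<omega>) = (\<Sum>j\<le>L. if j = idx \<omega> then Z \<omega> * e (t j) \<omega> else 0)"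
        by (intro sum.cong) (auto simp: Y_def)
      also have "\<dots> = Z \<omega> * e (t (idx \<omega>)) \<omega>" using idx_le[OF \<omega>] by (subst sum.delta) auto
      finally show "Z \<omega> * e (grid_above (c m) (\<rho> \<omega>)) \<omega> = (\<Sum>j\<le>L. Y j \<omega> * e (t j) \<omega>)"
        by (simp add: grid[OF \<omega>])
    qed simp
    also have "\<dots> = (\<Sum>j\<le>L. \<integral>\<omega>. Y j \<omega> * e (t j) \<omega> \<partial>M)"
      by (rule Bochner_Integration.integral_sum) (use int_Ye in auto)
    also have "\<dots> = (\<Sum>j\<le>L. \<integral>\<omega>. Y j \<omega> \<partial>M)"
      unfolding e_def by (intro sum.cong refl wald_fixed[OF t Y_meas Y_norm]) auto
    also have "\<dots> = (\<integral>\<omega>. (\<Sum>j\<le>L. Y j \<omega>) \<partial>M)"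
      by (rule Bochner_Integration.integral_sum[symmetric]) (use int_Y in auto)
    also have "\<dots> = (\<integral>\<omega>. Z \<omega> \<partial>M)"
      using idx_le by (intro Bochner_Integration.integral_cong) (auto simp: Y_def sum.delta')
    finally show ?thesis .
  qed
  have \<rho>m: "\<rho> \<in> borel_measurable M" by (rule optional_measurable[OF \<rho>])
  have lim: "(\<lambda>m. Z \<omega> * e (grid_above (c m) (\<rho> \<omega>)) \<omega>) \<longlonglongrightarrow> Z \<omega> * e (\<rho> \<omega>) \<omega>" if \<omega>: "\<omega> \<in> space M" for \<omega>
  proof -
    have g: "(\<lambda>m. grid_above (c m) (\<rho> \<omega>)) \<longlonglongrightarrow> \<rho> \<omega>"
      unfolding c_def by (rule grid_above_tendsto[OF c0])
    have "0 \<le> grid_above (c m) (\<rho> \<omega>)" for m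
      using grid_above_bounds(1)[OF c(1)[of m], of "\<rho> \<omega>"] bds[OF \<omega>] by simp
    then have "(\<lambda>m. B (grid_above (c m) (\<rho> \<omega>)) \<omega>) \<longlonglongrightarrow> B (\<rho> \<omega>) \<omega>"
      using B_tendsto[OF \<omega> g] bds[OF \<omega>] by auto
    then show ?thesis using g unfolding e_def by (intro tendsto_intros) auto
  qed
  have Bm: "(\<lambda>\<omega>. B (\<rho> \<omega>) \<omega>) \<in> borel_measurable M" by (rule measurable_B_at_optional[OF \<rho> bds])
  have m1: "(\<lambda>\<omega>. Z \<omega> * e (\<rho> \<omega>) \<omega>) \<in> borel_measurable M"
  proof -
    have [measurable]: "B v \<in> borel_measurable M" using v \<open>0 \<le> N\<close> by (auto intro: measurable_B)
    show ?thesis using Zm Bm \<rho>m unfolding e_def by measurable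
  qed
  have m2: "(\<lambda>\<omega>. Z \<omega> * e (grid_above (c m) (\<rho> \<omega>)) \<omega>) \<in> borel_measurable M" for m
  proof -
    \<comment> \<open>For nonnegative times the maximum changes nothing; it keeps the index of \<open>e\<close> nonnegative for every integer.\<close>
    have "(\<lambda>\<omega>. e ((max 0 (real_of_int \<lfloor>c m * \<rho> \<omega>\<rfloor>) + 1) / c m) \<omega>) \<in> borel_measurable M"
    proof (rule measurable_compose_countable[where g = "\<lambda>\<omega>. \<lfloor>c m * \<rho> \<omega>\<rfloor>" 
          and f = "\<lambda>k. e ((max 0 (real_of_int k) + 1) / c m)"])
      show "(\<lambda>\<omega>. \<lfloor>c m * \<rho> \<omega>\<rfloor>) \<in> measurable M (count_space UNIV)" using \<rho>m by measurable
    qed (use c(1)[of m] in \<open>auto intro!: em\<close>)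
    also have "?this \<longleftrightarrow> (\<lambda>\<omega>. e (grid_above (c m) (\<rho> \<omega>)) \<omega>) \<in> borel_measurable M"
      using bds c(1)[of m] by (intro measurable_cong) (auto simp: grid_above_def max_def)
    finally show ?thesis using Zm by measurable
  qed
  have "(\<lambda>m. \<integral>\<omega>. Z \<omega> * e (grid_above (c m) (\<rho> \<omega>)) \<omega> \<partial>M) \<longlonglongrightarrow> (\<integral>\<omega>. Z \<omega> * e (\<rho> \<omega>) \<omega> \<partial>M)"
  proof (rule integral_dominated_convergence[where w = "\<lambda>_. K * exp (\<theta>\<^sup>2 * v / 2)"])
    show "AE \<omega> in M. norm (Z \<omega> * e (grid_above (c m) (\<rho> \<omega>)) \<omega>) \<le> K * exp (\<theta>\<^sup>2 * v / 2)" for m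
    proof (rule AE_I2)
      fix \<omega> assume \<omega>: "\<omega> \<in> space M"
      have "0 \<le> grid_above (c m) (\<rho> \<omega>)"
        using grid_above_bounds(1)[OF c(1)[of m], of "\<rho> \<omega>"] bds[OF \<omega>] by simp
      then show "norm (Z \<omega> * e (grid_above (c m) (\<rho> \<omega>)) \<omega>) \<le> K * exp (\<theta>\<^sup>2 * v / 2)"
        unfolding norm_mult using Z(2)[OF \<omega>] e_norm K by (intro mult_mono) auto
    qed
  qed (use lim m1 m2 in auto)
  then have "(\<integral>\<omega>. Z \<omega> * e (\<rho> \<omega>) \<omega> \<partial>M) = (\<integral>\<omega>. Z \<omega> \<partial>M)"
    unfolding grid_eq by (simp add: LIMSEQ_const_iff)
  then show ?thesis by (simp add: e_def)
qed

text \<open>The exponential from \<open>\<rho>\<close> to \<open>v\<close> is the product of those from \<open>\<rho>\<close> to \<open>\<sigma>\<close> and from \<open>\<sigma>\<close> to \<open>v\<close>,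
  and the first factor is known at \<open>\<sigma>\<close>. Two uses of \<open>wald_optional\<close> with a late deterministic
  time \<open>v\<close> therefore compare \<open>\<rho>\<close> with \<open>\<sigma>\<close>.\<close>

lemma wald_between:
  fixes Z :: "'a \<Rightarrow> real"
  assumes opt: "optional \<rho>" "optional \<sigma>"
    and bds: "\<And>\<omega>. \<omega> \<in> space M \<Longrightarrow> 0 \<le> \<rho> \<omega> \<and> \<rho> \<omega> \<le> \<sigma> \<omega> \<and> \<sigma> \<omega> \<le> N"
    and Z: "known_before \<rho> (\<lambda>\<omega>. complex_of_real (Z \<omega>))" "\<And>\<omega>. \<omega> \<in> space M \<Longrightarrow> \<bar>Z \<omega>\<bar> \<le> K"
  shows "(\<integral>\<omega>. Z \<omega> * (cos (\<theta> * (B (\<sigma> \<omega>) \<omega> - B (\<rho> \<omega>) \<omega>)) * exp (\<theta>\<^sup>2 * (\<sigma> \<omega> - \<rho> \<omega>) / 2)) \<partial>M) = (\<integral>\<omega>. Z \<omega> \<partial>M)"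
proof -
  let ?Z = "\<lambda>\<omega>. complex_of_real (Z \<omega>) * wald_exp \<theta> (\<sigma> \<omega> - \<rho> \<omega>) (B (\<sigma> \<omega>) \<omega> - B (\<rho> \<omega>) \<omega>)"
  have bds1: "\<And>\<omega>. \<omega> \<in> space M \<Longrightarrow> 0 \<le> \<rho> \<omega> \<and> \<rho> \<omega> \<le> N"
    and bds2: "\<And>\<omega>. \<omega> \<in> space M \<Longrightarrow> 0 \<le> \<sigma> \<omega> \<and> \<sigma> \<omega> \<le> N"
    and le: "\<And>\<omega>. \<omega> \<in> space M \<Longrightarrow> \<rho> \<omega> \<le> \<sigma> \<omega>"
    using bds by force+
  let ?g = "\<lambda>c. \<lambda>p. wald_exp \<theta> (c * fst p) (c * snd p)"
  have g: "?g c \<in> borel_measurable borel" for c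
    by (intro borel_measurable_continuous_onI continuous_intros)
  have k\<rho>: "known_before \<rho> (\<lambda>\<omega>. ?g (-1) (\<rho> \<omega>, B (\<rho> \<omega>) \<omega>))"
    by (rule known_before_comp[OF g opt(1)]) (use bds1 in auto)
  have k\<sigma>: "known_before \<sigma> (\<lambda>\<omega>. ?g 1 (\<sigma> \<omega>, B (\<sigma> \<omega>) \<omega>))"
    by (rule known_before_comp[OF g opt(2)]) (use bds2 in auto)
  have "known_before \<sigma> (\<lambda>\<omega>. (complex_of_real (Z \<omega>) * ?g (-1) (\<rho> \<omega>, B (\<rho> \<omega>) \<omega>)) * ?g 1 (\<sigma> \<omega>, B (\<sigma> \<omega>) \<omega>))"
    by (rule known_before_mult[OF known_before_later[OF known_before_mult[OF Z(1) k\<rho>] opt(2) le] k\<sigma>])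
  then have known: "known_before \<sigma> ?Z" by (simp add: mult.assoc wald_exp_add)
  have Zb: "norm (?Z \<omega>) \<le> K * exp (\<theta>\<^sup>2 * N / 2)" if "\<omega> \<in> space M" for \<omega>
    unfolding norm_mult using Z(2)[OF that] bds[OF that]
    by (intro mult_mono norm_wald_exp_le) auto
  have "(\<integral>\<omega>. ?Z \<omega> \<partial>M) = (\<integral>\<omega>. ?Z \<omega> * wald_exp \<theta> ((N + 1) - \<sigma> \<omega>) (B (N + 1) \<omega> - B (\<sigma> \<omega>) \<omega>) \<partial>M)"
    by (rule wald_optional[OF opt(2) bds2 _ known Zb, symmetric]) auto
  also have "\<dots> = (\<integral>\<omega>. complex_of_real (Z \<omega>) * wald_exp \<theta> ((N + 1) - \<rho> \<omega>) (B (N + 1) \<omega> - B (\<rho> \<omega>) \<omega>) \<partial>M)"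
    by (simp add: mult.assoc wald_exp_add)
  also have "\<dots> = (\<integral>\<omega>. complex_of_real (Z \<omega>) \<partial>M)"
    by (rule wald_optional[OF opt(1) bds1 _ Z(1)]) (use Z(2) in auto)
  finally have eq: "(\<integral>\<omega>. ?Z \<omega> \<partial>M) = complex_of_real (\<integral>\<omega>. Z \<omega> \<partial>M)" by simp
  have "integrable M ?Z"
    using known_before_measurable[OF known, of N] bds2 Zb
    by (intro integrable_const_bound[where B = "K * exp (\<theta>\<^sup>2 * N / 2)"]) auto
  then have "(\<integral>\<omega>. Re (?Z \<omega>) \<partial>M) = Re (\<integral>\<omega>. ?Z \<omega> \<partial>M)" by (rule integral_Re)
  also have "\<dots> = (\<integral>\<omega>. Z \<omega> \<partial>M)" by (simp add: eq)
  finally show ?thesis by (simp add: Re_wald_exp)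
qed

end

section \<open>From exponentials to polynomial moments\<close>

lemma powers_le_1_plus_sixth:
  fixes x :: real
  shows "x\<^sup>2 \<le> 1 + x ^ 6" "x ^ 4 \<le> 1 + x ^ 6"
proof -
  have 6: "x ^ 6 = (x\<^sup>2) ^ 3" and 4: "x ^ 4 = (x\<^sup>2)\<^sup>2" by (simp_all flip: power_mult)
  have "y \<le> 1 + y ^ 3 \<and> y\<^sup>2 \<le> 1 + y ^ 3" if "0 \<le> y" for y :: real
  proof (cases "y \<le> 1")
    case True
    then show ?thesis using that power_le_one[of y 2] zero_le_power[of y 3] by linarith
  next
    case False
    have "y ^ 1 \<le> y ^ 3" "y ^ 2 \<le> y ^ 3" using False by (intro power_increasing; simp)+
    then show ?thesis by simp
  qed
  from this[of "x\<^sup>2"] show "x\<^sup>2 \<le> 1 + x ^ 6" "x ^ 4 \<le> 1 + x ^ 6" unfolding 4 6 by auto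
qed

text \<open>The Taylor expansion of the real part of \<open>wald_exp\<close> in \<open>\<theta>\<close>. Odd powers vanish, so the first
  omitted term has order \<open>\<theta>\<^sup>6\<close>; the remainder is integrable as soon as \<open>x\<close> has a sixth moment.\<close>

lemma cos_exp_expansion:
  fixes x s N \<theta> :: real
  assumes s: "0 \<le> s" "s \<le> N" and \<theta>: "0 \<le> \<theta>" "\<theta> \<le> 1"
  shows "\<bar>cos (\<theta> * x) * exp (\<theta>\<^sup>2 * s / 2) - 1 - \<theta>\<^sup>2 * ((s - x\<^sup>2) / 2)
           - \<theta> ^ 4 * ((x ^ 4 - 6 * x\<^sup>2 * s + 3 * s\<^sup>2) / 24)\<bar>
         \<le> (2 * N\<^sup>2 + N + N ^ 3 * exp N + exp N) * \<theta> ^ 6 * (1 + x ^ 6)"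
proof -
  define u w where "u = \<theta> * x" and "w = \<theta>\<^sup>2 * s / 2"
  \<comment> \<open>Taylor polynomials of \<open>cos u\<close> and \<open>exp w\<close>. Their product has the claimed coefficients up to \<open>\<theta>\<^sup>4\<close>; each of the five error terms is at most a multiple of \<open>A\<close>.\<close>
  define p q where "p = 1 - u\<^sup>2 / 2 + u ^ 4 / 24" and "q = 1 + w + w\<^sup>2 / 2"
  define A where "A = \<theta> ^ 6 * (1 + x ^ 6)"
  have N: "0 \<le> N" using s by simp
  have \<theta>2: "\<theta>\<^sup>2 \<le> 1" using \<theta> by (simp add: power_le_one)
  have w0: "0 \<le> w" using s by (simp add: w_def)
  have w1: "w \<le> \<theta>\<^sup>2 * N"
  proof -
    have "s / 2 \<le> N" using s by simp
    from mult_left_mono[OF this zero_le_power2[of \<theta>]] show ?thesis by (simp add: w_def)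
  qed
  have wN: "w \<le> N" using w1 mult_right_mono[OF \<theta>2 N] by simp
  have "exp w \<le> exp N" using wN by simp
  have x6: "0 \<le> x ^ 6" by simp
  have A: "\<theta> ^ 6 \<le> A" "\<theta> ^ 6 * x\<^sup>2 \<le> A" "\<theta> ^ 6 * x ^ 4 \<le> A" "\<theta> ^ 6 * x ^ 6 \<le> A"
    unfolding A_def using powers_le_1_plus_sixth[of x] x6 \<theta>
    by (auto intro!: mult_left_mono mult_left_le_one_le simp: mult_left_le)
      (simp_all add: distrib_left)
  have A0: "0 \<le> A" using x6 \<theta> by (simp add: A_def)
  obtain t where t: "cos u = (\<Sum>m<6. cos_coeff m * u ^ m) + (cos (t + 1/2 * real 6 * pi) / fact 6) * u ^ 6"
    using Maclaurin_cos_expansion[of u 6] by auto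
  have "(\<Sum>m<6. cos_coeff m * u ^ m) = p"
  proof -
    have "{..<6} = {0, 1, 2, 3, 4, 5 :: nat}" by auto
    then show ?thesis by (simp add: cos_coeff_def p_def fact_numeral)
  qed
  then have "\<bar>cos u - p\<bar> = \<bar>cos (t + 1/2 * real 6 * pi)\<bar> / fact 6 * u ^ 6"
    using t by (simp add: abs_mult)
  also have "\<dots> \<le> 1 * u ^ 6"
    by (intro mult_right_mono) (auto simp: fact_numeral intro: order_trans[OF abs_cos_le_one])
  finally have r1: "\<bar>cos u - p\<bar> \<le> u ^ 6" by simp
  obtain t' where t': "\<bar>t'\<bar> \<le> \<bar>w\<bar>" "exp w = (\<Sum>m<3. w ^ m / fact m) + (exp t' / fact 3) * w ^ 3"
    using Maclaurin_exp_le[of w 3] by auto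
  have "(\<Sum>m<3. w ^ m / fact m) = q"
    by (simp add: q_def eval_nat_numeral)
  then have "exp w - q = exp t' / 6 * w ^ 3" using t' by (simp add: fact_numeral)
  moreover have "exp t' / 6 * w ^ 3 \<le> exp N * w ^ 3"
  proof (intro mult_right_mono)
    have "exp t' \<le> exp N" using t'(1) w0 wN by simp
    then show "exp t' / 6 \<le> exp N" using exp_gt_zero[of N] by linarith
  qed (use w0 in auto)
  moreover have "0 \<le> exp t' / 6 * w ^ 3" using w0 by simp
  ultimately have r2: "0 \<le> exp w - q" "exp w - q \<le> exp N * w ^ 3" by auto
  have "q \<le> exp N" using r2(1) \<open>exp w \<le> exp N\<close> by linarith
  moreover have "0 \<le> q" using w0 by (simp add: q_def)
  ultimately have q: "0 \<le> q" "q \<le> exp N" by auto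
  have e1: "\<bar>cos u * (exp w - q)\<bar> \<le> N ^ 3 * exp N * A"
  proof -
    have "\<bar>cos u * (exp w - q)\<bar> \<le> 1 * (exp N * w ^ 3)"
      unfolding abs_mult using r2 by (intro mult_mono) auto
    also have "w ^ 3 \<le> (\<theta>\<^sup>2 * N) ^ 3" by (rule power_mono[OF w1 w0])
    also have "(\<theta>\<^sup>2 * N) ^ 3 = N ^ 3 * \<theta> ^ 6" by (simp add: power_mult_distrib flip: power_mult)
    also have "N ^ 3 * \<theta> ^ 6 \<le> N ^ 3 * A" using A N by (intro mult_left_mono) auto
    finally show ?thesis by (simp add: mult_ac)
  qed
  have e2: "\<bar>(cos u - p) * q\<bar> \<le> exp N * A"
  proof -
    have "\<bar>(cos u - p) * q\<bar> \<le> u ^ 6 * exp N"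
      unfolding abs_mult using r1 q by (intro mult_mono) auto
    also have "u ^ 6 = \<theta> ^ 6 * x ^ 6" by (simp add: u_def power_mult_distrib)
    also have "\<theta> ^ 6 * x ^ 6 * exp N \<le> A * exp N" using A by (intro mult_right_mono) auto
    finally show ?thesis by (simp add: mult_ac)
  qed
  have w2: "w\<^sup>2 \<le> \<theta> ^ 4 * N\<^sup>2" using power_mono[OF w1 w0, of 2] by (simp add: power_mult_distrib flip: power_mult)
  have e3: "\<bar>u\<^sup>2 * w\<^sup>2 / 4\<bar> \<le> N\<^sup>2 * A"
  proof -
    have "\<bar>u\<^sup>2 * w\<^sup>2 / 4\<bar> \<le> u\<^sup>2 * w\<^sup>2" by simp
    also have "\<dots> \<le> u\<^sup>2 * (\<theta> ^ 4 * N\<^sup>2)" by (intro mult_left_mono w2) auto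
    also have "\<dots> = N\<^sup>2 * (\<theta> ^ 6 * x\<^sup>2)" by (simp add: u_def power_mult_distrib eval_nat_numeral)
    also have "\<dots> \<le> N\<^sup>2 * A" using A by (intro mult_left_mono) auto
    finally show ?thesis .
  qed
  have e4: "\<bar>u ^ 4 * w / 24\<bar> \<le> N * A"
  proof -
    have u4: "0 \<le> u ^ 4" by simp
    then have "\<bar>u ^ 4 * w / 24\<bar> \<le> u ^ 4 * w" using w0 by (simp add: abs_mult)
    also have "\<dots> \<le> u ^ 4 * (\<theta>\<^sup>2 * N)" by (intro mult_left_mono w1 u4)
    also have "\<dots> = N * (\<theta> ^ 6 * x ^ 4)" by (simp add: u_def power_mult_distrib eval_nat_numeral)
    also have "\<dots> \<le> N * A" using A N by (intro mult_left_mono) auto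
    finally show ?thesis .
  qed
  have e5: "\<bar>u ^ 4 * w\<^sup>2 / 48\<bar> \<le> N\<^sup>2 * A"
  proof -
    have u4: "0 \<le> u ^ 4" by simp
    then have "\<bar>u ^ 4 * w\<^sup>2 / 48\<bar> \<le> u ^ 4 * w\<^sup>2" by (simp add: abs_mult)
    also have "\<dots> \<le> u ^ 4 * (\<theta> ^ 4 * N\<^sup>2)" by (intro mult_left_mono w2 u4)
    also have "\<dots> = (N\<^sup>2 * (\<theta> ^ 6 * x ^ 4)) * \<theta>\<^sup>2" by (simp add: u_def power_mult_distrib eval_nat_numeral)
    also have "\<dots> \<le> (N\<^sup>2 * A) * 1" using A A0 \<theta>2 \<theta> by (intro mult_mono mult_left_mono) auto
    finally show ?thesis by simp
  qed
  have eq: "cos (\<theta> * x) * exp (\<theta>\<^sup>2 * s / 2) - 1 - \<theta>\<^sup>2 * ((s - x\<^sup>2) / 2)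
           - \<theta> ^ 4 * ((x ^ 4 - 6 * x\<^sup>2 * s + 3 * s\<^sup>2) / 24)
       = cos u * (exp w - q) + (cos u - p) * q - u\<^sup>2 * w\<^sup>2 / 4 + u ^ 4 * w / 24 + u ^ 4 * w\<^sup>2 / 48"
  proof -
    have "cos (\<theta> * x) * exp (\<theta>\<^sup>2 * s / 2) = cos u * (exp w - q) + (cos u - p) * q + p * q"
      by (simp add: algebra_simps u_def w_def)
    moreover have "p * q - 1 - \<theta>\<^sup>2 * ((s - x\<^sup>2) / 2) - \<theta> ^ 4 * ((x ^ 4 - 6 * x\<^sup>2 * s + 3 * s\<^sup>2) / 24)
        = - u\<^sup>2 * w\<^sup>2 / 4 + u ^ 4 * w / 24 + u ^ 4 * w\<^sup>2 / 48"
      by (simp add: p_def q_def u_def w_def field_simps power_mult_distrib eval_nat_numeral)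
    ultimately show ?thesis by simp
  qed
  have bound: "(2 * N\<^sup>2 + N + N ^ 3 * exp N + exp N) * \<theta> ^ 6 * (1 + x ^ 6) =
      N ^ 3 * exp N * A + exp N * A + N\<^sup>2 * A + N * A + N\<^sup>2 * A"
    by (simp add: A_def algebra_simps)
  have "\<bar>a + b - c + d + e\<bar> \<le> \<bar>a\<bar> + \<bar>b\<bar> + \<bar>c\<bar> + \<bar>d\<bar> + \<bar>e\<bar>" for a b c d e :: real by linarith
  then show ?thesis
    unfolding eq bound by (rule order_trans) (intro add_mono e1 e2 e3 e4 e5)
qed

lemma even_polynomial_bounded_by_sixth_power:
  fixes a b D :: real
  assumes "\<And>\<theta>. 0 < \<theta> \<Longrightarrow> \<theta> \<le> 1 \<Longrightarrow> \<bar>\<theta>\<^sup>2 * a + \<theta> ^ 4 * b\<bar> \<le> D * \<theta> ^ 6"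
  shows "a = 0" "b = 0"
proof -
  have 1: "\<bar>a + \<theta>\<^sup>2 * b\<bar> \<le> D * \<theta> ^ 4" if "0 < \<theta>" "\<theta> \<le> 1" for \<theta>
  proof -
    have "\<theta>\<^sup>2 * a + \<theta> ^ 4 * b = \<theta>\<^sup>2 * (a + \<theta>\<^sup>2 * b)" by (simp add: distrib_left eval_nat_numeral)
    then have "\<theta>\<^sup>2 * \<bar>a + \<theta>\<^sup>2 * b\<bar> = \<bar>\<theta>\<^sup>2 * a + \<theta> ^ 4 * b\<bar>" by (simp add: abs_mult)
    also have "\<dots> \<le> \<theta>\<^sup>2 * (D * \<theta> ^ 4)" using assms[OF that] by (simp add: eval_nat_numeral mult_ac)
    finally show ?thesis using that by simp
  qed
  have ev: "eventually (\<lambda>\<theta>::real. 0 < \<theta> \<and> \<theta> \<le> 1) (at_right 0)"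
    unfolding eventually_at_right_field by (intro exI[of _ 1]) auto
  have l0: "((\<lambda>\<theta>. D * \<theta> ^ k) \<longlongrightarrow> 0) (at_right (0::real))" if "0 < k" for k
  proof -
    have "((\<lambda>\<theta>. D * \<theta> ^ k) \<longlongrightarrow> D * 0 ^ k) (at_right (0::real))" by (intro tendsto_intros)
    then show ?thesis using that by (simp add: zero_power)
  qed
  have "((\<lambda>\<theta>. \<bar>a + \<theta>\<^sup>2 * b\<bar>) \<longlongrightarrow> 0) (at_right 0)"
    by (rule tendsto_sandwich[OF _ _ tendsto_const l0[of 4]])
       (use ev 1 in \<open>auto elim!: eventually_mono\<close>)
  moreover have "((\<lambda>\<theta>. \<bar>a + \<theta>\<^sup>2 * b\<bar>) \<longlongrightarrow> \<bar>a + 0\<^sup>2 * b\<bar>) (at_right 0)"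
    by (intro tendsto_intros)
  ultimately show a: "a = 0" using tendsto_unique[of "at_right (0::real)"] by fastforce
  have 2: "\<bar>b\<bar> \<le> D * \<theta>\<^sup>2" if "0 < \<theta>" "\<theta> \<le> 1" for \<theta>
  proof -
    have "\<theta>\<^sup>2 * \<bar>b\<bar> \<le> \<theta>\<^sup>2 * (D * \<theta>\<^sup>2)" using 1[OF that] by (simp add: a abs_mult eval_nat_numeral mult_ac)
    then show ?thesis using that by (simp add: zero_power)
  qed
  have "((\<lambda>\<theta>. \<bar>b\<bar>) \<longlongrightarrow> 0) (at_right (0::real))"
    by (rule tendsto_sandwich[OF _ _ tendsto_const l0[of 2]])
       (use ev 2 in \<open>auto elim!: eventually_mono\<close>)
  then show "b = 0" using tendsto_unique[OF _ _ tendsto_const, of "at_right (0::real)"] by fastforce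
qed

text \<open>Integrating the expansion leaves \<open>\<theta>\<^sup>2 a + \<theta>\<^sup>4 b = O(\<theta>\<^sup>6)\<close> with \<open>a\<close> and \<open>b\<close> proportional to the two
  expectations, which forces both to vanish.\<close>

lemma (in prob_space) moments_from_exponential:
  fixes Z X s :: "'a \<Rightarrow> real"
  assumes meas [measurable]: "Z \<in> borel_measurable M" "X \<in> borel_measurable M" "s \<in> borel_measurable M"
    and Z: "\<And>\<omega>. \<omega> \<in> space M \<Longrightarrow> \<bar>Z \<omega>\<bar> \<le> K"
    and s: "\<And>\<omega>. \<omega> \<in> space M \<Longrightarrow> 0 \<le> s \<omega> \<and> s \<omega> \<le> N"
    and X6: "integrable M (\<lambda>\<omega>. X \<omega> ^ 6)"
    and exponential: "\<And>\<theta>. (\<integral>\<omega>. Z \<omega> * (cos (\<theta> * X \<omega>) * exp (\<theta>\<^sup>2 * s \<omega> / 2)) \<partial>M) = (\<integral>\<omega>. Z \<omega> \<partial>M)"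
  shows "(\<integral>\<omega>. Z \<omega> * (s \<omega> - (X \<omega>)\<^sup>2) \<partial>M) = 0"
    and "(\<integral>\<omega>. Z \<omega> * (X \<omega> ^ 4 - 6 * (X \<omega>)\<^sup>2 * s \<omega> + 3 * (s \<omega>)\<^sup>2) \<partial>M) = 0"
proof -
  define C where "C = 2 * N\<^sup>2 + N + N ^ 3 * exp N + exp N"
  have K: "0 \<le> K" using Z not_empty abs_ge_zero order_trans by blast
  have N: "0 \<le> N" using s not_empty by fastforce
  have C: "0 \<le> C" using N by (simp add: C_def)
  let ?a = "\<lambda>\<omega>. (s \<omega> - (X \<omega>)\<^sup>2) / 2"
  let ?b = "\<lambda>\<omega>. (X \<omega> ^ 4 - 6 * (X \<omega>)\<^sup>2 * s \<omega> + 3 * (s \<omega>)\<^sup>2) / 24"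
  have x6: "0 \<le> x ^ 6" "0 \<le> x ^ 4" for x :: real by simp_all
  have intA: "integrable M (\<lambda>\<omega>. 1 + X \<omega> ^ 6)" using X6 by simp
  have int_dom: "integrable M f" if [measurable]: "f \<in> borel_measurable M" 
    and "\<And>\<omega>. \<omega> \<in> space M \<Longrightarrow> \<bar>f \<omega>\<bar> \<le> L * (1 + X \<omega> ^ 6)" for f L
    by (rule Bochner_Integration.integrable_bound[OF integrable_mult_right[OF intA, of L]])
       (use that(2) in \<open>auto intro!: AE_I2 intro: order_trans[OF _ abs_ge_self]\<close>)
  have int_a: "integrable M (\<lambda>\<omega>. Z \<omega> * ?a \<omega>)"
  proof (rule int_dom[of _ "K * (N + 1)"])
    fix \<omega> assume \<omega>: "\<omega> \<in> space M"
    have "0 \<le> (X \<omega>)\<^sup>2" by simp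
    then have "\<bar>?a \<omega>\<bar> \<le> N + (X \<omega>)\<^sup>2" using s[OF \<omega>, THEN conjunct1] s[OF \<omega>, THEN conjunct2]
      unfolding diff_divide_distrib by linarith
    also have "\<dots> \<le> (N + 1) * (1 + X \<omega> ^ 6)"
      using powers_le_1_plus_sixth(1)[of "X \<omega>"] N x6[of "X \<omega>"] mult_nonneg_nonneg[OF N x6(1)[of "X \<omega>"]]
      unfolding ring_distribs by linarith
    finally show "\<bar>Z \<omega> * ?a \<omega>\<bar> \<le> K * (N + 1) * (1 + X \<omega> ^ 6)"
      unfolding abs_mult mult.assoc using Z[OF \<omega>] K by (intro mult_mono) auto
  qed measurable
  have int_b: "integrable M (\<lambda>\<omega>. Z \<omega> * ?b \<omega>)"
  proof (rule int_dom[of _ "K * (1 + N + N\<^sup>2)"])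
    fix \<omega> assume \<omega>: "\<omega> \<in> space M"
    have 1: "(X \<omega>)\<^sup>2 * s \<omega> \<le> (1 + X \<omega> ^ 6) * N"
      using s[OF \<omega>] x6 powers_le_1_plus_sixth(1)[of "X \<omega>"] by (intro mult_mono) (auto intro: add_nonneg_nonneg)
    have 2: "(s \<omega>)\<^sup>2 \<le> N\<^sup>2" using s[OF \<omega>] by (intro power_mono) auto
    have 3: "0 \<le> (X \<omega>)\<^sup>2 * s \<omega>" "0 \<le> N\<^sup>2 * X \<omega> ^ 6" "0 \<le> N * X \<omega> ^ 6" using s[OF \<omega>] x6 N by auto
    have "\<bar>?b \<omega>\<bar> \<le> X \<omega> ^ 4 + (X \<omega>)\<^sup>2 * s \<omega> + (s \<omega>)\<^sup>2"
      using x6(2)[of "X \<omega>"] 3(1) zero_le_power2[of "s \<omega>"]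
      unfolding mult.assoc add_divide_distrib diff_divide_distrib by linarith
    also have "\<dots> \<le> (1 + N + N\<^sup>2) * (1 + X \<omega> ^ 6)"
      using 1 2 3 powers_le_1_plus_sixth(2)[of "X \<omega>"] unfolding ring_distribs mult.commute[of "X \<omega> ^ 6"] by linarith
    finally show "\<bar>Z \<omega> * ?b \<omega>\<bar> \<le> K * (1 + N + N\<^sup>2) * (1 + X \<omega> ^ 6)"
      unfolding abs_mult mult.assoc using Z[OF \<omega>] K by (intro mult_mono) auto
  qed measurable
  have int_Z: "integrable M Z" using Z by (intro integrable_const_bound[where B = K]) auto
  have bound: "\<bar>\<theta>\<^sup>2 * (\<integral>\<omega>. Z \<omega> * ?a \<omega> \<partial>M) + \<theta> ^ 4 * (\<integral>\<omega>. Z \<omega> * ?b \<omega> \<partial>M)\<bar>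
      \<le> (K * C * (\<integral>\<omega>. 1 + X \<omega> ^ 6 \<partial>M)) * \<theta> ^ 6" if \<theta>: "0 < \<theta>" "\<theta> \<le> 1" for \<theta>
  proof -
    let ?e = "\<lambda>\<omega>. cos (\<theta> * X \<omega>) * exp (\<theta>\<^sup>2 * s \<omega> / 2)"
    let ?R = "\<lambda>\<omega>. Z \<omega> * ?e \<omega> - Z \<omega> - \<theta>\<^sup>2 * (Z \<omega> * ?a \<omega>) - \<theta> ^ 4 * (Z \<omega> * ?b \<omega>)"
    have int_e: "integrable M (\<lambda>\<omega>. Z \<omega> * ?e \<omega>)"
    proof (rule integrable_const_bound[where B = "K * (1 * exp N)"])
      show "AE \<omega> in M. norm (Z \<omega> * ?e \<omega>) \<le> K * (1 * exp N)"
      proof (rule AE_I2)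
        fix \<omega> assume \<omega>: "\<omega> \<in> space M"
        have "\<theta>\<^sup>2 * s \<omega> \<le> 1 * N" using s[OF \<omega>] \<theta> by (intro mult_mono) (auto simp: power_le_one)
        then have "\<theta>\<^sup>2 * s \<omega> / 2 \<le> N" using s[OF \<omega>] N by linarith
        then show "norm (Z \<omega> * ?e \<omega>) \<le> K * (1 * exp N)"
          unfolding norm_mult using Z[OF \<omega>] K by (intro mult_mono) auto
      qed
    qed measurable
    have "(\<integral>\<omega>. ?R \<omega> \<partial>M) = - (\<theta>\<^sup>2 * (\<integral>\<omega>. Z \<omega> * ?a \<omega> \<partial>M) + \<theta> ^ 4 * (\<integral>\<omega>. Z \<omega> * ?b \<omega> \<partial>M))"
    proof -
      have "(\<integral>\<omega>. f \<omega> - g \<omega> - c * h \<omega> - d * k \<omega> \<partial>M) =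
          (\<integral>\<omega>. f \<omega> \<partial>M) - (\<integral>\<omega>. g \<omega> \<partial>M) - c * (\<integral>\<omega>. h \<omega> \<partial>M) - d * (\<integral>\<omega>. k \<omega> \<partial>M)"
        if "integrable M f" "integrable M g" "integrable M h" "integrable M k" for f g h k and c d :: real
        using that by simp
      from this[OF int_e int_Z int_a int_b, of "\<theta>\<^sup>2" "\<theta> ^ 4"] exponential[of \<theta>] show ?thesis by linarith
    qed
    then have "\<bar>\<theta>\<^sup>2 * (\<integral>\<omega>. Z \<omega> * ?a \<omega> \<partial>M) + \<theta> ^ 4 * (\<integral>\<omega>. Z \<omega> * ?b \<omega> \<partial>M)\<bar> = \<bar>\<integral>\<omega>. ?R \<omega> \<partial>M\<bar>" by simp
    also have "\<dots> \<le> (\<integral>\<omega>. \<bar>?R \<omega>\<bar> \<partial>M)" by (rule integral_abs_bound)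
    also have "\<dots> \<le> (\<integral>\<omega>. K * C * \<theta> ^ 6 * (1 + X \<omega> ^ 6) \<partial>M)"
    proof (rule integral_mono)
      show "integrable M (\<lambda>\<omega>. \<bar>?R \<omega>\<bar>)"
        by (intro integrable_abs Bochner_Integration.integrable_diff integrable_mult_right int_e int_Z int_a int_b)
      show "integrable M (\<lambda>\<omega>. K * C * \<theta> ^ 6 * (1 + X \<omega> ^ 6))" using intA by simp
      fix \<omega> assume \<omega>: "\<omega> \<in> space M"
      have "?R \<omega> = Z \<omega> * (?e \<omega> - 1 - \<theta>\<^sup>2 * ?a \<omega> - \<theta> ^ 4 * ?b \<omega>)" by (simp add: algebra_simps)
      then have "\<bar>?R \<omega>\<bar> = \<bar>Z \<omega>\<bar> * \<bar>?e \<omega> - 1 - \<theta>\<^sup>2 * ?a \<omega> - \<theta> ^ 4 * ?b \<omega>\<bar>" by (simp add: abs_mult)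
      also have "\<dots> \<le> K * (C * \<theta> ^ 6 * (1 + X \<omega> ^ 6))"
        using Z[OF \<omega>] s[OF \<omega>] \<theta> K unfolding C_def by (intro mult_mono cos_exp_expansion) auto
      finally show "\<bar>?R \<omega>\<bar> \<le> K * C * \<theta> ^ 6 * (1 + X \<omega> ^ 6)" by (simp add: mult_ac)
    qed
    also have "\<dots> = (K * C * (\<integral>\<omega>. 1 + X \<omega> ^ 6 \<partial>M)) * \<theta> ^ 6" by (simp only: integral_mult_right_zero mult_ac)
    finally show ?thesis .
  qed
  have "(\<integral>\<omega>. Z \<omega> * ?a \<omega> \<partial>M) = 0" by (rule even_polynomial_bounded_by_sixth_power(1)[OF bound])
  then show "(\<integral>\<omega>. Z \<omega> * (s \<omega> - (X \<omega>)\<^sup>2) \<partial>M) = 0" by simp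
  have "(\<integral>\<omega>. Z \<omega> * ?b \<omega> \<partial>M) = 0" by (rule even_polynomial_bounded_by_sixth_power(2)[OF bound])
  then show "(\<integral>\<omega>. Z \<omega> * (X \<omega> ^ 4 - 6 * (X \<omega>)\<^sup>2 * s \<omega> + 3 * (s \<omega>)\<^sup>2) \<partial>M) = 0" by simp
qed

section \<open>The hitting times along a path\<close>

declare tau.simps(2) [simp del]

context brownian begin

lemma tau_nonneg: "0 \<le> tau W h k \<omega>"
proof (induction k)
  case (Suc k)
  show ?case unfolding tau.simps
  proof (rule Inf_greatest)
    fix x assume "x \<in> ereal ` {t. tau W h k \<omega> \<le> ereal t \<and> \<bar>W t \<omega> - at_time W (tau W h k) \<omega>\<bar> = sqrt h}"
    then show "0 \<le> x" using Suc by (auto intro: order_trans)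
  qed
qed simp

lemma tau_le_Suc: "tau W h k \<omega> \<le> tau W h (Suc k) \<omega>"
  unfolding tau.simps by (rule Inf_greatest) auto

lemma tau_finite_cases:
  obtains "tau W h k \<omega> = \<infinity>" | s where "tau W h k \<omega> = ereal s" "0 \<le> s"
  using tau_nonneg[of h k \<omega>] by (cases "tau W h k \<omega>") auto

text \<open>By the intermediate value theorem a deviation of at least \<open>sqrt h\<close> implies an earlier one of exactly
  \<open>sqrt h\<close>.\<close>

lemma tau_Suc_le_hit:
  assumes \<omega>: "\<omega> \<in> space M" and s: "tau W h k \<omega> = ereal s" and t: "s \<le> t" "sqrt h \<le> \<bar>B t \<omega> - B s \<omega>\<bar>"
    and h: "0 < h"
  obtains r where "s \<le> r" "r \<le> t" "\<bar>B r \<omega> - B s \<omega>\<bar> = sqrt h" "tau W h (Suc k) \<omega> \<le> ereal r"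
proof -
  have s0: "0 \<le> s" using tau_nonneg[of h k \<omega>] s by simp
  have "continuous_on {s..t} (\<lambda>r. \<bar>B r \<omega> - B s \<omega>\<bar>)"
    using s0 by (intro continuous_intros continuous_on_subset[OF continuous_B[OF \<omega>]]) auto
  then obtain r where r: "s \<le> r" "r \<le> t" "\<bar>B r \<omega> - B s \<omega>\<bar> = sqrt h"
    using IVT'[of "\<lambda>r. \<bar>B r \<omega> - B s \<omega>\<bar>" s "sqrt h" t] t h by auto
  have "tau W h (Suc k) \<omega> \<le> ereal r"
    unfolding tau.simps using r s by (intro Inf_lower) (auto simp: at_time_def B_diff)
  then show ?thesis using that r by blast
qed

lemma B_before_tau_Suc:
  assumes \<omega>: "\<omega> \<in> space M" and s: "tau W h k \<omega> = ereal s" and t: "s \<le> t" "ereal t \<le> tau W h (Suc k) \<omega>"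
    and h: "0 < h"
  shows "\<bar>B t \<omega> - B s \<omega>\<bar> \<le> sqrt h"
proof (rule ccontr)
  assume *: "\<not> ?thesis"
  obtain r where "s \<le> r" "r \<le> t" "\<bar>B r \<omega> - B s \<omega>\<bar> = sqrt h" "tau W h (Suc k) \<omega> \<le> ereal r"
    using tau_Suc_le_hit[OF \<omega> s t(1) _ h] * by auto
  with t(2) have "ereal t \<le> ereal r" by (metis order_trans)
  with \<open>r \<le> t\<close> have "r = t" by simp
  with \<open>\<bar>B r \<omega> - B s \<omega>\<bar> = sqrt h\<close> * show False by simp
qed

text \<open>The set of hitting times is closed by continuity, so a finite infimum is attained.\<close>

lemma B_at_tau_Suc:
  assumes \<omega>: "\<omega> \<in> space M" and r: "tau W h (Suc k) \<omega> = ereal r"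
  obtains s where "tau W h k \<omega> = ereal s" "0 \<le> s" "s \<le> r" "\<bar>B r \<omega> - B s \<omega>\<bar> = sqrt h"
proof -
  obtain s where s: "tau W h k \<omega> = ereal s" "0 \<le> s" "s \<le> r"
    using tau_le_Suc[of h k \<omega>] r by (cases h k \<omega> rule: tau_finite_cases) auto
  let ?S = "{t. s \<le> t \<and> \<bar>B t \<omega> - B s \<omega>\<bar> = sqrt h}"
  have S: "{t. tau W h k \<omega> \<le> ereal t \<and> \<bar>W t \<omega> - at_time W (tau W h k) \<omega>\<bar> = sqrt h} = ?S"
    using s by (auto simp: at_time_def B_diff)
  have Inf: "Inf (ereal ` ?S) = ereal r" using r unfolding tau.simps S .
  have ne: "?S \<noteq> {}"
  proof
    assume "?S = {}"
    then have "Inf (ereal ` ?S) = \<infinity>" by (simp add: top_ereal_def del: Collect_empty_eq)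
    then show False using Inf by simp
  qed
  have "closed (?S)"
  proof -
    have "closed {t \<in> {s..}. \<bar>B t \<omega> - B s \<omega>\<bar> = sqrt h}"
      using s by (intro continuous_closed_preimage_constant[of "{s..}" "\<lambda>t. \<bar>B t \<omega> - B s \<omega>\<bar>"] continuous_intros 
           continuous_on_subset[OF continuous_B[OF \<omega>]]) auto
    then show ?thesis by simp
  qed
  moreover have bdd: "bdd_below ?S" by (rule bdd_belowI[of _ s]) auto
  ultimately have "Inf ?S \<in> ?S" using ne by (intro closed_contains_Inf)
  moreover have "Inf (ereal ` ?S) = ereal (Inf ?S)"
  proof (rule antisym)
    show "Inf (ereal ` ?S) \<le> ereal (Inf ?S)" using \<open>Inf ?S \<in> ?S\<close> by (intro Inf_lower) auto
    show "ereal (Inf ?S) \<le> Inf (ereal ` ?S)" 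
      by (rule Inf_greatest) (use bdd in \<open>auto intro!: cInf_lower\<close>)
  qed
  ultimately have "r \<in> ?S" using Inf by simp
  then show ?thesis using that s by auto
qed

text \<open>Cutting off at a level \<open>N\<close> gives bounded optional times, to which \<open>moment_identities\<close> applies,
  and takes care of infinite values.\<close>

definition tau_trunc :: "real \<Rightarrow> nat \<Rightarrow> real \<Rightarrow> 'a \<Rightarrow> real" where
  "tau_trunc h k N \<omega> = real_of_ereal (min (tau W h k \<omega>) (ereal N))"

lemma tau_trunc_infinite: "tau W h k \<omega> = \<infinity> \<Longrightarrow> tau_trunc h k N \<omega> = N"
  by (simp add: tau_trunc_def)

lemma tau_trunc_finite: "tau W h k \<omega> = ereal s \<Longrightarrow> tau_trunc h k N \<omega> = min s N"
  by (simp add: tau_trunc_def min_def)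

lemma tau_trunc_0: "0 \<le> N \<Longrightarrow> tau_trunc h 0 N \<omega> = 0"
  by (simp add: tau_trunc_def)

lemma tau_trunc_bounds:
  assumes "0 \<le> N" shows "0 \<le> tau_trunc h k N \<omega>" "tau_trunc h k N \<omega> \<le> N"
  using assms by (cases h k \<omega> rule: tau_finite_cases; simp add: tau_trunc_finite tau_trunc_infinite)+

lemma ereal_tau_trunc: "ereal (tau_trunc h k N \<omega>) = min (tau W h k \<omega>) (ereal N)"
  by (cases h k \<omega> rule: tau_finite_cases) (auto simp: tau_trunc_finite tau_trunc_infinite)

lemma tau_trunc_le_Suc: "tau_trunc h k N \<omega> \<le> tau_trunc h (Suc k) N \<omega>"
proof -
  have "ereal (tau_trunc h k N \<omega>) \<le> ereal (tau_trunc h (Suc k) N \<omega>)"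
    unfolding ereal_tau_trunc using tau_le_Suc by (intro min.mono) auto
  then show ?thesis by simp
qed

lemma tau_trunc_less_iff: "tau_trunc h k N \<omega> < t \<longleftrightarrow> tau W h k \<omega> < ereal t \<or> N < t"
proof -
  have "tau_trunc h k N \<omega> < t \<longleftrightarrow> ereal (tau_trunc h k N \<omega>) < ereal t" by simp
  then show ?thesis unfolding ereal_tau_trunc by (simp add: min_less_iff_disj)
qed

lemma B_tau_trunc_step:
  assumes \<omega>: "\<omega> \<in> space M" and h: "0 < h" and N: "0 \<le> N"
  shows "\<bar>B (tau_trunc h (Suc k) N \<omega>) \<omega> - B (tau_trunc h k N \<omega>) \<omega>\<bar> \<le> sqrt h"
proof (cases "ereal N \<le> tau W h k \<omega>")
  case True
  moreover from this have "ereal N \<le> tau W h (Suc k) \<omega>" using tau_le_Suc[of h k \<omega>] by (rule order_trans)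
  ultimately have "tau_trunc h k N \<omega> = N" "tau_trunc h (Suc k) N \<omega> = N" by (simp_all add: tau_trunc_def min_absorb2)
  then show ?thesis using h by simp
next
  case False
  then obtain s where s: "tau W h k \<omega> = ereal s" "0 \<le> s" "s < N"
    by (cases h k \<omega> rule: tau_finite_cases) auto
  then have Rk: "tau_trunc h k N \<omega> = s" by (simp add: tau_trunc_finite)
  show ?thesis unfolding Rk
  proof (rule B_before_tau_Suc[OF \<omega> s(1) _ _ h])
    show "s \<le> tau_trunc h (Suc k) N \<omega>" using tau_trunc_le_Suc[of h k N \<omega>] Rk by simp
    show "ereal (tau_trunc h (Suc k) N \<omega>) \<le> tau W h (Suc k) \<omega>" unfolding ereal_tau_trunc by simp
  qed
qed

lemma optional_tau_trunc_if:
  assumes "\<And>t. {\<omega> \<in> space M. tau W h k \<omega> < ereal t} \<in> sets (past t)"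
  shows "optional (tau_trunc h k N)"
  unfolding optional_def
proof
  fix t
  show "{\<omega> \<in> space M. tau_trunc h k N \<omega> < t} \<in> sets (past t)"
    using assms[of t] sets.top[of "past t"] by (cases "N < t") (simp_all add: tau_trunc_less_iff)
qed

text \<open>The right-hand side involves countably many times only, which makes the event measurable. It says that
  before some time \<open>r < t\<close> the path comes arbitrarily close to the level \<open>sqrt h\<close>; by compactness it
  then reaches the level up to time \<open>r\<close>.\<close>

lemma tau_Suc_less_iff:
  assumes \<omega>: "\<omega> \<in> space M" and h: "0 < h"
  shows "tau W h (Suc k) \<omega> < ereal t \<longleftrightarrow>
    (\<exists>r\<in>\<rat>. r < t \<and> (\<forall>n::nat. \<exists>q\<in>\<rat>. q < r \<and> tau W h k \<omega> < ereal q
        \<and> sqrt h - 1 / (real n + 1) < \<bar>B q \<omega> - B (tau_trunc h k q \<omega>) \<omega>\<bar>))" (is "?L \<longleftrightarrow> ?R")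
proof
  assume ?L
  then obtain u where u: "tau W h (Suc k) \<omega> = ereal u" "u < t"
    by (cases h "Suc k" \<omega> rule: tau_finite_cases) auto
  obtain s where s: "tau W h k \<omega> = ereal s" "0 \<le> s" "s \<le> u" "\<bar>B u \<omega> - B s \<omega>\<bar> = sqrt h"
    by (rule B_at_tau_Suc[OF \<omega> u(1)])
  have "s \<noteq> u" using s(4) h by auto
  then have su: "s < u" using s(3) by simp
  obtain r where r: "r \<in> \<rat>" "u < r" "r < t" using Rats_dense_in_real[OF u(2)] by auto
  have "\<exists>q\<in>\<rat>. q < r \<and> tau W h k \<omega> < ereal q \<and> sqrt h - 1 / (real n + 1) < \<bar>B q \<omega> - B (tau_trunc h k q \<omega>) \<omega>\<bar>" for n :: nat
  proof -
    have "((\<lambda>x. \<bar>B x \<omega> - B s \<omega>\<bar>) \<longlongrightarrow> \<bar>B u \<omega> - B s \<omega>\<bar>) (at_left u)"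
    proof -
      have "((\<lambda>x. B x \<omega>) \<longlongrightarrow> B u \<omega>) (at u within {0..})"
        using continuous_B[OF \<omega>] s su by (auto simp: continuous_on_def)
      then have "((\<lambda>x. B x \<omega>) \<longlongrightarrow> B u \<omega>) (at u within {0..} \<inter> {..<u})"
        by (rule tendsto_within_subset) auto
      also have "at u within {0..} \<inter> {..<u} = at_left u"
        using s su by (intro at_within_nhd[of u "{0<..}"]) auto
      finally show ?thesis by (intro tendsto_intros)
    qed
    then have "eventually (\<lambda>x. sqrt h - 1 / (real n + 1) < \<bar>B x \<omega> - B s \<omega>\<bar>) (at_left u)"
      by (rule order_tendstoD) (use s(4) in simp)
    then obtain b where b: "b < u" "\<And>x. b < x \<Longrightarrow> x < u \<Longrightarrow> sqrt h - 1 / (real n + 1) < \<bar>B x \<omega> - B s \<omega>\<bar>"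
      unfolding eventually_at_left_field by auto
    obtain q where q: "q \<in> \<rat>" "max b s < q" "q < u" using Rats_dense_in_real[of "max b s" u] b su by auto
    then have "tau_trunc h k q \<omega> = s" using s by (simp add: tau_trunc_finite)
    then show ?thesis using q b(2)[of q] s r by (intro bexI[of _ q]) auto
  qed
  then show ?R using r by blast
next
  assume ?R
  then obtain r where r: "r < t" and q: "\<And>n::nat. \<exists>q. q < r \<and> tau W h k \<omega> < ereal q
        \<and> sqrt h - 1 / (real n + 1) < \<bar>B q \<omega> - B (tau_trunc h k q \<omega>) \<omega>\<bar>" by blast
  from q[of 0] obtain s where s: "tau W h k \<omega> = ereal s" "0 \<le> s" "s < r"
    by (cases h k \<omega> rule: tau_finite_cases) auto
  have "continuous_on {s..r} (\<lambda>x. \<bar>B x \<omega> - B s \<omega>\<bar>)"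
    using s by (intro continuous_intros continuous_on_subset[OF continuous_B[OF \<omega>]]) auto
  then obtain x where x: "x \<in> {s..r}" "\<And>y. y \<in> {s..r} \<Longrightarrow> \<bar>B y \<omega> - B s \<omega>\<bar> \<le> \<bar>B x \<omega> - B s \<omega>\<bar>"
    using continuous_attains_sup[of "{s..r}" "\<lambda>x. \<bar>B x \<omega> - B s \<omega>\<bar>"] s by auto
  have "sqrt h - 1 / (real n + 1) \<le> \<bar>B x \<omega> - B s \<omega>\<bar>" for n :: nat
  proof -
    from q[of n] obtain q where "q < r" "tau W h k \<omega> < ereal q" "sqrt h - 1 / (real n + 1) < \<bar>B q \<omega> - B (tau_trunc h k q \<omega>) \<omega>\<bar>"
      by blast
    moreover from this have "tau_trunc h k q \<omega> = s" "s \<le> q" using s by (simp_all add: tau_trunc_finite)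
    ultimately show ?thesis using x(2)[of q] by simp
  qed
  moreover have "(\<lambda>n::nat. sqrt h - 1 / (real n + 1)) \<longlonglongrightarrow> sqrt h - 0"
    by (intro tendsto_diff tendsto_const) real_asymp
  ultimately have "sqrt h \<le> \<bar>B x \<omega> - B s \<omega>\<bar>" by (intro LIMSEQ_le_const2) auto
  then obtain u where "u \<le> x" "tau W h (Suc k) \<omega> \<le> ereal u"
    using tau_Suc_le_hit[OF \<omega> s(1) _ _ h, of x] x(1) by auto
  then have "tau W h (Suc k) \<omega> \<le> ereal r" using x(1) by (auto intro: order_trans)
  then show ?L using r by (auto intro: le_less_trans)
qed

lemma tau_less_in_past:
  assumes h: "0 < h"
  shows "{\<omega> \<in> space M. tau W h k \<omega> < ereal t} \<in> sets (past t)"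
proof (induction k arbitrary: t)
  case 0
  show ?case using sets.top[of "past t"] by (cases "0 < t") simp_all
next
  case (Suc k)
  note opt = optional_tau_trunc_if[OF Suc.IH]
  let ?G = "\<lambda>n q. {\<omega> \<in> space M. tau W h k \<omega> < ereal q \<and> sqrt h - 1 / (real n + 1) < \<bar>B q \<omega> - B (tau_trunc h k q \<omega>) \<omega>\<bar>}"
  have G: "?G n q \<in> sets (past q)" for n :: nat and q
  proof (cases "0 \<le> q")
    case True
    have "(\<lambda>\<omega>. min (tau_trunc h k q \<omega>) q) \<in> borel_measurable (past q)" by (rule optional_min_measurable[OF opt])
    then have "tau_trunc h k q \<in> borel_measurable (past q)" using tau_trunc_bounds[OF True] by (simp add: min_absorb1)
    then have [measurable]: "(\<lambda>\<omega>. B (tau_trunc h k q \<omega>) \<omega>) \<in> borel_measurable (past q)"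
      by (rule measurable_B_at) (use tau_trunc_bounds[OF True] in auto)
    have [measurable]: "B q \<in> borel_measurable (past q)" by (rule measurable_B_past) (use True in auto)
    have "{\<omega> \<in> space (past q). sqrt h - 1 / (real n + 1) < \<bar>B q \<omega> - B (tau_trunc h k q \<omega>) \<omega>\<bar>} \<in> sets (past q)" by measurable
    with Suc.IH[of q] have "{\<omega> \<in> space M. tau W h k \<omega> < ereal q} \<inter> {\<omega> \<in> space (past q). sqrt h - 1 / (real n + 1) < \<bar>B q \<omega> - B (tau_trunc h k q \<omega>) \<omega>\<bar>} \<in> sets (past q)"
      by (rule sets.Int)
    also have "{\<omega> \<in> space M. tau W h k \<omega> < ereal q} \<inter> {\<omega> \<in> space (past q). sqrt h - 1 / (real n + 1) < \<bar>B q \<omega> - B (tau_trunc h k q \<omega>) \<omega>\<bar>} = ?G n q"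
      by auto
    finally show ?thesis .
  next
    case False
    have "\<not> tau W h k \<omega> < ereal q" for \<omega>
    proof
      assume "tau W h k \<omega> < ereal q"
      with tau_nonneg[of h k \<omega>] have "0 < ereal q" by (rule le_less_trans)
      then show False using False by simp
    qed
    then show ?thesis by simp
  qed
  have "{\<omega> \<in> space M. tau W h (Suc k) \<omega> < ereal t} = 
     (\<Union>r\<in>\<rat> \<inter> {..<t}. \<Inter>n. \<Union>q\<in>\<rat> \<inter> {..<r}. ?G n q)"
  proof (intro set_eqI)
    fix \<omega>
    show "\<omega> \<in> {\<omega> \<in> space M. tau W h (Suc k) \<omega> < ereal t} \<longleftrightarrow> 
       \<omega> \<in> (\<Union>r\<in>\<rat> \<inter> {..<t}. \<Inter>n. \<Union>q\<in>\<rat> \<inter> {..<r}. ?G n q)"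
    proof (cases "\<omega> \<in> space M")
      case True
      show ?thesis
        unfolding mem_Collect_eq tau_Suc_less_iff[OF True h, of k t] UN_iff INT_iff Int_iff lessThan_iff
        using True by blast
    next
      case False
      then show ?thesis by simp
    qed
  qed
  moreover have "\<dots> \<in> sets (past t)"
  proof (rule sets.countable_UN')
    show "countable (\<rat> \<inter> {..<t})" by (simp add: countable_rat)
    show "(\<lambda>r. \<Inter>n. \<Union>q\<in>\<rat> \<inter> {..<r}. ?G n q) ` (\<rat> \<inter> {..<t}) \<subseteq> sets (past t)"
    proof (rule image_subsetI)
      fix r assume r: "r \<in> \<rat> \<inter> {..<t}"
      have "?G n q \<in> sets (past t)" if "q < r" for n :: nat and q using subsetD[OF past_mono[of q t] G] that r by auto
      then show "(\<Inter>n. \<Union>q\<in>\<rat> \<inter> {..<r}. ?G n q) \<in> sets (past t)"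
        by (intro sets.countable_INT'[of UNIV] sets.countable_UN' image_subsetI) (auto simp: countable_rat)
    qed
  qed
  ultimately show ?case by simp
qed

lemma optional_tau_trunc: "0 < h \<Longrightarrow> optional (tau_trunc h k N)"
  by (rule optional_tau_trunc_if[OF tau_less_in_past])

end

section \<open>Moments of the hitting times\<close>

text \<open>A form of Fatou's lemma.\<close>

lemma (in prob_space) integrable_limit_of_bounded_expectations:
  fixes f :: "'a \<Rightarrow> real"
  assumes g: "\<And>N::nat. integrable M (g N)" "\<And>N. AE \<omega> in M. 0 \<le> g N \<omega>" "\<And>N. expectation (g N) \<le> C"
    and f [measurable]: "f \<in> borel_measurable M" and lim: "AE \<omega> in M. (\<lambda>N. g N \<omega>) \<longlonglongrightarrow> f \<omega>"
  shows "integrable M f"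
proof -
  have g_meas [measurable]: "g N \<in> borel_measurable M" for N using g(1) by auto
  have "AE \<omega> in M. \<forall>N. 0 \<le> g N \<omega>" using g(2) by (simp add: AE_all_countable)
  with lim have f0: "AE \<omega> in M. 0 \<le> f \<omega>" by eventually_elim (auto intro: LIMSEQ_le_const)
  have "(\<integral>\<^sup>+ \<omega>. ennreal (f \<omega>) \<partial>M) = (\<integral>\<^sup>+ \<omega>. liminf (\<lambda>N. ennreal (g N \<omega>)) \<partial>M)"
    using lim by (intro nn_integral_cong_AE) 
      (auto elim!: eventually_mono intro!: lim_imp_Liminf[symmetric] tendsto_ennrealI)
  also have "\<dots> \<le> liminf (\<lambda>N. \<integral>\<^sup>+ \<omega>. ennreal (g N \<omega>) \<partial>M)"
    by (intro nn_integral_liminf) auto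
  also have "\<dots> \<le> liminf (\<lambda>N. ennreal C)"
    using g by (intro Liminf_mono always_eventually allI) (auto simp: nn_integral_eq_integral intro: ennreal_leI)
  also have "\<dots> < \<infinity>" by (simp add: Liminf_const)
  finally have "(\<integral>\<^sup>+ \<omega>. ennreal (f \<omega>) \<partial>M) < \<infinity>" .
  moreover have "(\<integral>\<^sup>+ \<omega>. ennreal (norm (f \<omega>)) \<partial>M) = (\<integral>\<^sup>+ \<omega>. ennreal (f \<omega>) \<partial>M)"
    using f0 by (intro nn_integral_cong_AE) (auto elim!: eventually_mono)
  ultimately have "(\<integral>\<^sup>+ \<omega>. ennreal (norm (f \<omega>)) \<partial>M) < \<infinity>" by simp
  then show ?thesis by (simp add: integrable_iff_bounded)
qed

context brownian begin

text \<open>For \<open>z = 1\<close> these are the optional stopping identities of the martingales \<open>W\<^sub>t\<^sup>2 - t\<close> and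
  \<open>W\<^sub>t\<^sup>4 - 6 W\<^sub>t\<^sup>2 t + 3 t\<^sup>2\<close> for the motion restarted at time \<open>\<rho>\<close>. The weight \<open>z (\<rho> \<omega>)\<close> expresses that they hold conditionally on the starting
  time of the increment.\<close>

lemma moment_identities:
  assumes opt: "optional \<rho>" "optional \<sigma>"
    and bds: "\<And>\<omega>. \<omega> \<in> space M \<Longrightarrow> 0 \<le> \<rho> \<omega> \<and> \<rho> \<omega> \<le> \<sigma> \<omega> \<and> \<sigma> \<omega> \<le> N"
    and z: "z \<in> borel_measurable borel" "\<And>\<omega>. \<omega> \<in> space M \<Longrightarrow> \<bar>z (\<rho> \<omega>)\<bar> \<le> K"
    and X6: "integrable M (\<lambda>\<omega>. (B (\<sigma> \<omega>) \<omega> - B (\<rho> \<omega>) \<omega>) ^ 6)"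
  shows "(\<integral>\<omega>. z (\<rho> \<omega>) * ((\<sigma> \<omega> - \<rho> \<omega>) - (B (\<sigma> \<omega>) \<omega> - B (\<rho> \<omega>) \<omega>)\<^sup>2) \<partial>M) = 0"
    and "(\<integral>\<omega>. z (\<rho> \<omega>) * ((B (\<sigma> \<omega>) \<omega> - B (\<rho> \<omega>) \<omega>) ^ 4
            - 6 * (B (\<sigma> \<omega>) \<omega> - B (\<rho> \<omega>) \<omega>)\<^sup>2 * (\<sigma> \<omega> - \<rho> \<omega>) + 3 * (\<sigma> \<omega> - \<rho> \<omega>)\<^sup>2) \<partial>M) = 0"
proof -
  have bds1: "\<And>\<omega>. \<omega> \<in> space M \<Longrightarrow> 0 \<le> \<rho> \<omega> \<and> \<rho> \<omega> \<le> N"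
    and bds2: "\<And>\<omega>. \<omega> \<in> space M \<Longrightarrow> 0 \<le> \<sigma> \<omega> \<and> \<sigma> \<omega> \<le> N"
    using bds by force+
  have [measurable]: "\<rho> \<in> borel_measurable M" "\<sigma> \<in> borel_measurable M" "z \<in> borel_measurable borel"
    using opt z(1) by (auto intro: optional_measurable)
  have [measurable]: "(\<lambda>\<omega>. B (\<rho> \<omega>) \<omega>) \<in> borel_measurable M" "(\<lambda>\<omega>. B (\<sigma> \<omega>) \<omega>) \<in> borel_measurable M"
    by (rule measurable_B_at_optional[OF opt(1) bds1] measurable_B_at_optional[OF opt(2) bds2]; assumption)+
  have g: "(\<lambda>p. complex_of_real (z (fst p))) \<in> borel_measurable (borel :: (real \<times> real) measure)"
    by (simp add: borel_prod[symmetric])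
  have "known_before \<rho> (\<lambda>\<omega>. complex_of_real (z (fst (\<rho> \<omega>, B (\<rho> \<omega>) \<omega>))))"
    by (rule known_before_comp[OF g opt(1)]) (use bds1 in auto)
  then have known: "known_before \<rho> (\<lambda>\<omega>. complex_of_real (z (\<rho> \<omega>)))" by simp
  have exponential: "(\<integral>\<omega>. z (\<rho> \<omega>) * (cos (\<theta> * (B (\<sigma> \<omega>) \<omega> - B (\<rho> \<omega>) \<omega>)) * exp (\<theta>\<^sup>2 * (\<sigma> \<omega> - \<rho> \<omega>) / 2)) \<partial>M)
      = (\<integral>\<omega>. z (\<rho> \<omega>) \<partial>M)" for \<theta>
    by (rule wald_between[OF opt bds known z(2)])
  have s: "0 \<le> \<sigma> \<omega> - \<rho> \<omega> \<and> \<sigma> \<omega> - \<rho> \<omega> \<le> N" if "\<omega> \<in> space M" for \<omega> using bds[OF that] by auto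
  show "(\<integral>\<omega>. z (\<rho> \<omega>) * ((\<sigma> \<omega> - \<rho> \<omega>) - (B (\<sigma> \<omega>) \<omega> - B (\<rho> \<omega>) \<omega>)\<^sup>2) \<partial>M) = 0"
    by (rule moments_from_exponential(1)[OF _ _ _ z(2) s X6 exponential]) measurable
  show "(\<integral>\<omega>. z (\<rho> \<omega>) * ((B (\<sigma> \<omega>) \<omega> - B (\<rho> \<omega>) \<omega>) ^ 4
            - 6 * (B (\<sigma> \<omega>) \<omega> - B (\<rho> \<omega>) \<omega>)\<^sup>2 * (\<sigma> \<omega> - \<rho> \<omega>) + 3 * (\<sigma> \<omega> - \<rho> \<omega>)\<^sup>2) \<partial>M) = 0"
    by (rule moments_from_exponential(2)[OF _ _ _ z(2) s X6 exponential]) measurable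
qed

definition time_step :: "real \<Rightarrow> nat \<Rightarrow> real \<Rightarrow> 'a \<Rightarrow> real" where
  "time_step h k N \<omega> = tau_trunc h (Suc k) N \<omega> - tau_trunc h k N \<omega>"

definition space_step :: "real \<Rightarrow> nat \<Rightarrow> real \<Rightarrow> 'a \<Rightarrow> real" where
  "space_step h k N \<omega> = B (tau_trunc h (Suc k) N \<omega>) \<omega> - B (tau_trunc h k N \<omega>) \<omega>"

context
  fixes h :: real
  assumes h: "0 < h"
begin

lemma measurable_tau_trunc [measurable]: "tau_trunc h k N \<in> borel_measurable M"
  by (rule optional_measurable[OF optional_tau_trunc[OF h]])

lemma measurable_B_tau_trunc: "0 \<le> N \<Longrightarrow> (\<lambda>\<omega>. B (tau_trunc h k N \<omega>) \<omega>) \<in> borel_measurable M"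
  by (rule measurable_B_at_optional[OF optional_tau_trunc[OF h], of _ _ N]) (auto intro: tau_trunc_bounds)

lemma measurable_time_step [measurable]: "time_step h k N \<in> borel_measurable M"
  unfolding time_step_def[abs_def] by measurable

lemma measurable_space_step: "0 \<le> N \<Longrightarrow> space_step h k N \<in> borel_measurable M"
  unfolding space_step_def[abs_def] by (intro borel_measurable_diff measurable_B_tau_trunc)

lemma time_step_bounds: "0 \<le> N \<Longrightarrow> 0 \<le> time_step h k N \<omega> \<and> time_step h k N \<omega> \<le> tau_trunc h (Suc k) N \<omega>"
  using tau_trunc_le_Suc[of h k N \<omega>] tau_trunc_bounds[of N h k \<omega>] by (simp add: time_step_def)

lemma space_step_square_le: "\<omega> \<in> space M \<Longrightarrow> 0 \<le> N \<Longrightarrow> (space_step h k N \<omega>)\<^sup>2 \<le> h"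
  using power_mono[OF B_tau_trunc_step[OF _ h, of \<omega> N k] abs_ge_zero, of 2] h by (simp add: space_step_def)

lemma integrable_bounded_step:
  assumes N: "0 \<le> N" and [measurable]: "f \<in> borel_measurable borel" 
    and f: "\<And>r s x. 0 \<le> r \<Longrightarrow> r \<le> N \<Longrightarrow> 0 \<le> s \<Longrightarrow> s \<le> N \<Longrightarrow> x\<^sup>2 \<le> h \<Longrightarrow> \<bar>f (r, s, x)\<bar> \<le> K"
  shows "integrable M (\<lambda>\<omega>. f (tau_trunc h k N \<omega>, time_step h k N \<omega>, space_step h k N \<omega>) :: real)"
proof (rule integrable_const_bound[where B = K])
  have [measurable]: "space_step h k N \<in> borel_measurable M" by (rule measurable_space_step[OF N])
  show "(\<lambda>\<omega>. f (tau_trunc h k N \<omega>, time_step h k N \<omega>, space_step h k N \<omega>)) \<in> borel_measurable M" by measurable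
  show "AE \<omega> in M. norm (f (tau_trunc h k N \<omega>, time_step h k N \<omega>, space_step h k N \<omega>)) \<le> K"
  proof (rule AE_I2)
    fix \<omega> assume "\<omega> \<in> space M"
    then show "norm (f (tau_trunc h k N \<omega>, time_step h k N \<omega>, space_step h k N \<omega>)) \<le> K"
      using tau_trunc_bounds[OF N, of h k \<omega>] tau_trunc_bounds[OF N, of h "Suc k" \<omega>] time_step_bounds[OF N, of k \<omega>] space_step_square_le[OF _ N, of \<omega> k]
      by (auto intro!: f)
  qed
qed

lemma integrable_space_step_6: "0 \<le> N \<Longrightarrow> integrable M (\<lambda>\<omega>. space_step h k N \<omega> ^ 6)"
proof -
  assume N: "0 \<le> N"
  have "\<bar>x ^ 6\<bar> \<le> h ^ 3" if "x\<^sup>2 \<le> h" for x :: real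
    using power_mono[OF that, of 3] by (simp flip: power_mult)
  with integrable_bounded_step[OF N, of "\<lambda>(r, s, x). x ^ 6" "h ^ 3" k] show ?thesis
    by (simp add: borel_prod[symmetric] case_prod_beta')
qed

lemma step_identities:
  assumes N: "0 \<le> N" and z: "z \<in> borel_measurable borel" "\<And>r. 0 \<le> r \<Longrightarrow> r \<le> N \<Longrightarrow> \<bar>z r\<bar> \<le> K"
  shows "(\<integral>\<omega>. z (tau_trunc h k N \<omega>) * (time_step h k N \<omega> - (space_step h k N \<omega>)\<^sup>2) \<partial>M) = 0"
    and "(\<integral>\<omega>. z (tau_trunc h k N \<omega>) * (space_step h k N \<omega> ^ 4 - 6 * (space_step h k N \<omega>)\<^sup>2 * time_step h k N \<omega> + 3 * (time_step h k N \<omega>)\<^sup>2) \<partial>M) = 0"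
proof -
  have "0 \<le> tau_trunc h k N \<omega> \<and> tau_trunc h k N \<omega> \<le> tau_trunc h (Suc k) N \<omega> \<and> tau_trunc h (Suc k) N \<omega> \<le> N" for \<omega>
    using tau_trunc_bounds[OF N] tau_trunc_le_Suc by auto
  note m = moment_identities[OF optional_tau_trunc[OF h] optional_tau_trunc[OF h] this z(1), where K = K]
  show "(\<integral>\<omega>. z (tau_trunc h k N \<omega>) * (time_step h k N \<omega> - (space_step h k N \<omega>)\<^sup>2) \<partial>M) = 0"
    unfolding space_step_def time_step_def using integrable_space_step_6[OF N, of k] z(2)[OF tau_trunc_bounds[OF N]]
    by (intro m(1)) (simp_all add: space_step_def)
  show "(\<integral>\<omega>. z (tau_trunc h k N \<omega>) * (space_step h k N \<omega> ^ 4 - 6 * (space_step h k N \<omega>)\<^sup>2 * time_step h k N \<omega> + 3 * (time_step h k N \<omega>)\<^sup>2) \<partial>M) = 0"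
    unfolding space_step_def time_step_def using integrable_space_step_6[OF N, of k] z(2)[OF tau_trunc_bounds[OF N]]
    by (intro m(2)) (simp_all add: space_step_def)
qed

lemma integrable_steps:
  assumes N: "0 \<le> N"
  shows "integrable M (time_step h k N)" "integrable M (\<lambda>\<omega>. (time_step h k N \<omega>)\<^sup>2)" "integrable M (\<lambda>\<omega>. (space_step h k N \<omega>)\<^sup>2)"
    "integrable M (\<lambda>\<omega>. (space_step h k N \<omega>)\<^sup>2 * time_step h k N \<omega>)" "integrable M (\<lambda>\<omega>. space_step h k N \<omega> ^ 4)"
    "integrable M (tau_trunc h k N)" "integrable M (\<lambda>\<omega>. (tau_trunc h k N \<omega>)\<^sup>2)"
proof -
  have 4: "\<bar>x ^ 4\<bar> \<le> h\<^sup>2" if "x\<^sup>2 \<le> h" for x :: real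
    using power_mono[OF that, of 2] by (simp flip: power_mult)
  have sq: "x\<^sup>2 \<le> N\<^sup>2" if "0 \<le> x" "x \<le> N" for x using that by (rule power_mono[rotated])
  note i = integrable_bounded_step[OF N, where k = k]
  show "integrable M (time_step h k N)"
    using i[of "\<lambda>(r, s, x). s" N] by (simp add: borel_prod[symmetric] case_prod_beta')
  show "integrable M (tau_trunc h k N)"
    using i[of "\<lambda>(r, s, x). r" N] by (simp add: borel_prod[symmetric] case_prod_beta')
  show "integrable M (\<lambda>\<omega>. (time_step h k N \<omega>)\<^sup>2)"
    using i[of "\<lambda>(r, s, x). s\<^sup>2" "N\<^sup>2"] sq by (simp add: borel_prod[symmetric] case_prod_beta')
  show "integrable M (\<lambda>\<omega>. (tau_trunc h k N \<omega>)\<^sup>2)"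
    using i[of "\<lambda>(r, s, x). r\<^sup>2" "N\<^sup>2"] sq by (simp add: borel_prod[symmetric] case_prod_beta')
  show "integrable M (\<lambda>\<omega>. (space_step h k N \<omega>)\<^sup>2)"
    using i[of "\<lambda>(r, s, x). x\<^sup>2" h] by (simp add: borel_prod[symmetric] case_prod_beta')
  show "integrable M (\<lambda>\<omega>. (space_step h k N \<omega>)\<^sup>2 * time_step h k N \<omega>)"
    using i[of "\<lambda>(r, s, x). x\<^sup>2 * s" "h * N"] h by (simp add: borel_prod[symmetric] case_prod_beta' abs_mult mult_mono)
  show "integrable M (\<lambda>\<omega>. space_step h k N \<omega> ^ 4)"
    using i[of "\<lambda>(r, s, x). x ^ 4" "h\<^sup>2"] 4 by (simp add: borel_prod[symmetric] case_prod_beta')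
qed

text \<open>One step moves the path by at most \<open>sqrt h\<close>, also when it is cut off.\<close>

lemma expectation_time_step_le:
  assumes N: "0 \<le> N" shows "expectation (time_step h k N) \<le> h"
proof -
  have "(\<integral>\<omega>. 1 * (time_step h k N \<omega> - (space_step h k N \<omega>)\<^sup>2) \<partial>M) = 0"
    by (rule step_identities(1)[OF N, of "\<lambda>_. 1" 1]) auto
  then have "expectation (time_step h k N) = (\<integral>\<omega>. (space_step h k N \<omega>)\<^sup>2 \<partial>M)"
    using integrable_steps[OF N, of k] by simp
  also have "\<dots> \<le> (\<integral>\<omega>. h \<partial>M)"
    using integrable_steps[OF N, of k] space_step_square_le[OF _ N] by (intro integral_mono) auto
  finally show ?thesis by (simp add: prob_space)
qed

text \<open>The fourth order identity bounds \<open>3 E s\<^sup>2\<close> by \<open>6 E (X\<^sup>2 s) \<le> 6 h E s\<close>.\<close>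

lemma expectation_time_step_square_le:
  assumes N: "0 \<le> N" shows "(\<integral>\<omega>. (time_step h k N \<omega>)\<^sup>2 \<partial>M) \<le> 2 * h\<^sup>2"
proof -
  note int = integrable_steps[OF N, of k]
  have "(\<integral>\<omega>. 1 * (space_step h k N \<omega> ^ 4 - 6 * (space_step h k N \<omega>)\<^sup>2 * time_step h k N \<omega> + 3 * (time_step h k N \<omega>)\<^sup>2) \<partial>M) = 0"
    by (rule step_identities(2)[OF N, of "\<lambda>_. 1" 1]) auto
  then have "(\<integral>\<omega>. space_step h k N \<omega> ^ 4 \<partial>M) - 6 * (\<integral>\<omega>. (space_step h k N \<omega>)\<^sup>2 * time_step h k N \<omega> \<partial>M) + 3 * (\<integral>\<omega>. (time_step h k N \<omega>)\<^sup>2 \<partial>M) = 0"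
    using int by (simp add: mult.assoc)
  moreover have "0 \<le> (\<integral>\<omega>. space_step h k N \<omega> ^ 4 \<partial>M)" by simp
  moreover have "(\<integral>\<omega>. (space_step h k N \<omega>)\<^sup>2 * time_step h k N \<omega> \<partial>M) \<le> (\<integral>\<omega>. h * time_step h k N \<omega> \<partial>M)"
    using int space_step_square_le[OF _ N] time_step_bounds[OF N] by (intro integral_mono mult_right_mono) auto
  moreover have "(\<integral>\<omega>. h * time_step h k N \<omega> \<partial>M) \<le> h\<^sup>2"
    using expectation_time_step_le[OF N, of k] h by (simp add: power2_eq_square)
  ultimately show ?thesis by linarith
qed

lemma tau_trunc_Suc: "tau_trunc h (Suc k) N \<omega> = tau_trunc h k N \<omega> + time_step h k N \<omega>"
  by (simp add: time_step_def)

lemma expectation_tau_trunc_le: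
  assumes N: "0 \<le> N" shows "expectation (tau_trunc h k N) \<le> real k * h"
proof (induction k)
  case 0
  show ?case using N by (simp add: tau_trunc_0)
next
  case (Suc k)
  have "expectation (tau_trunc h (Suc k) N) = expectation (tau_trunc h k N) + expectation (time_step h k N)"
    unfolding tau_trunc_Suc using integrable_steps[OF N, of k] by (intro Bochner_Integration.integral_add)
  then show ?case using Suc expectation_time_step_le[OF N, of k] by (simp add: algebra_simps)
qed

lemma expectation_tau_trunc_square_bounded: "\<exists>C. \<forall>N\<ge>0. (\<integral>\<omega>. (tau_trunc h k N \<omega>)\<^sup>2 \<partial>M) \<le> C"
proof (induction k)
  case 0
  show ?case by (rule exI[of _ 0]) (simp add: tau_trunc_0)
next
  case (Suc k)
  then obtain C where C: "\<And>N. 0 \<le> N \<Longrightarrow> (\<integral>\<omega>. (tau_trunc h k N \<omega>)\<^sup>2 \<partial>M) \<le> C" by auto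
  have "(\<integral>\<omega>. (tau_trunc h (Suc k) N \<omega>)\<^sup>2 \<partial>M) \<le> 2 * C + 4 * h\<^sup>2" if N: "0 \<le> N" for N
  proof -
    have "(\<integral>\<omega>. (tau_trunc h (Suc k) N \<omega>)\<^sup>2 \<partial>M) \<le> (\<integral>\<omega>. 2 * (tau_trunc h k N \<omega>)\<^sup>2 + 2 * (time_step h k N \<omega>)\<^sup>2 \<partial>M)"
    proof (intro integral_mono)
      fix \<omega>
      have "0 \<le> (tau_trunc h k N \<omega> - time_step h k N \<omega>)\<^sup>2" by simp
      then show "(tau_trunc h (Suc k) N \<omega>)\<^sup>2 \<le> 2 * (tau_trunc h k N \<omega>)\<^sup>2 + 2 * (time_step h k N \<omega>)\<^sup>2"
        unfolding tau_trunc_Suc by (simp add: power2_eq_square algebra_simps)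
    qed (use integrable_steps[OF N] in auto)
    also have "\<dots> = 2 * (\<integral>\<omega>. (tau_trunc h k N \<omega>)\<^sup>2 \<partial>M) + 2 * (\<integral>\<omega>. (time_step h k N \<omega>)\<^sup>2 \<partial>M)"
      using integrable_steps[OF N] by simp
    finally show ?thesis using C[OF N] expectation_time_step_square_le[OF N, of k] by simp
  qed
  then show ?case by blast
qed

lemma tau_infinite_event: "{\<omega> \<in> space M. tau W h k \<omega> = \<infinity>} \<in> sets M"
proof -
  have "{\<omega> \<in> space M. tau W h k \<omega> = \<infinity>} = space M - (\<Union>N::nat. {\<omega> \<in> space M. tau W h k \<omega> < ereal (real N)})"
  proof (intro set_eqI)
    fix \<omega>
    show "\<omega> \<in> {\<omega> \<in> space M. tau W h k \<omega> = \<infinity>} \<longleftrightarrow> \<omega> \<in> space M - (\<Union>N::nat. {\<omega> \<in> space M. tau W h k \<omega> < ereal (real N)})"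
      by (cases h k \<omega> rule: tau_finite_cases) (auto intro: reals_Archimedean2)
  qed
  also have "\<dots> \<in> sets M"
    by (intro sets.Diff sets.top sets.countable_UN image_subsetI subsetD[OF past_subset tau_less_in_past[OF h]])
  finally show ?thesis .
qed

text \<open>The cut-off time equals \<open>N\<close> where \<open>\<tau>\<^sub>k\<close> is infinite, while its mean stays below \<open>k h\<close>.\<close>

lemma AE_tau_finite: "AE \<omega> in M. tau W h k \<omega> \<noteq> \<infinity>"
proof -
  let ?A = "{\<omega> \<in> space M. tau W h k \<omega> = \<infinity>}"
  have bound: "real N * prob ?A \<le> real k * h" for N :: nat
  proof -
    have "real N * prob ?A = (\<integral>\<omega>. real N * indicator ?A \<omega> \<partial>M)"
      using tau_infinite_event[of k] by simp
    also have "\<dots> \<le> expectation (tau_trunc h k N)"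
    proof (rule integral_mono)
      show "integrable M (\<lambda>\<omega>. real N * indicator ?A \<omega>)"
        using tau_infinite_event[of k] by (intro integrable_mult_right integrable_real_indicator) (auto simp: emeasure_eq_measure)
      show "real N * indicator ?A \<omega> \<le> tau_trunc h k N \<omega>" for \<omega>
        using tau_trunc_bounds[of "real N" h k] by (auto simp: tau_trunc_infinite indicator_def)
    qed (rule integrable_steps, simp)
    also have "\<dots> \<le> real k * h" by (rule expectation_tau_trunc_le) simp
    finally show ?thesis .
  qed
  have "prob ?A = 0"
  proof (rule ccontr)
    assume "prob ?A \<noteq> 0"
    then have "0 < prob ?A" by (simp add: zero_less_measure_iff)
    then obtain N :: nat where "real k * h < real N * prob ?A" using reals_Archimedean3 by blast
    with bound[of N] show False by simp
  qed
  then show ?thesis using tau_infinite_event[of k] by (subst AE_iff_measurable[OF _ refl]) (auto simp: emeasure_eq_measure)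
qed

definition tau_real :: "nat \<Rightarrow> 'a \<Rightarrow> real" where
  "tau_real k \<omega> = real_of_ereal (tau W h k \<omega>)"


lemma tau_trunc_eq_min: "tau W h k \<omega> \<noteq> \<infinity> \<Longrightarrow> tau_trunc h k N \<omega> = min (tau_real k \<omega>) N"
  by (cases h k \<omega> rule: tau_finite_cases) (auto simp: tau_trunc_finite tau_real_def)

lemma tau_trunc_eventually: "tau W h k \<omega> \<noteq> \<infinity> \<Longrightarrow> eventually (\<lambda>N::nat. tau_trunc h k (real N) \<omega> = tau_real k \<omega>) sequentially"
  using eventually_ge_at_top[of "nat \<lceil>tau_real k \<omega>\<rceil>"] by (auto simp: tau_trunc_eq_min elim!: eventually_mono)

lemma measurable_tau_real [measurable]: "tau_real k \<in> borel_measurable M"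
proof (rule borel_measurable_LIMSEQ_real)
  let ?g = "\<lambda>N::nat. \<lambda>\<omega>. if tau W h k \<omega> = \<infinity> then 0 else tau_trunc h k (real N) \<omega>"
  show "?g N \<in> borel_measurable M" for N
    using tau_infinite_event[of k] by (intro measurable_If) auto
  show "(\<lambda>N. ?g N \<omega>) \<longlonglongrightarrow> tau_real k \<omega>" for \<omega>
  proof (cases "tau W h k \<omega> = \<infinity>")
    case True
    then show ?thesis by (simp add: tau_real_def)
  next
    case False
    from tau_trunc_eventually[OF this] show ?thesis using False by (simp add: tendsto_eventually)
  qed
qed

lemma measurable_at_tau: "at_time W (tau W h k) \<in> borel_measurable M"
proof (rule borel_measurable_LIMSEQ_real)
  let ?g = "\<lambda>N::nat. \<lambda>\<omega>. if tau W h k \<omega> = \<infinity> then W 0 \<omega> else B (tau_trunc h k (real N) \<omega>) \<omega> + W 0 \<omega>"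
  show "?g N \<in> borel_measurable M" for N
    using tau_infinite_event[of k] measurable_B_tau_trunc[of "real N" k] measurable_W[of 0]
    by (intro measurable_If borel_measurable_add) auto
  show "(\<lambda>N. ?g N \<omega>) \<longlonglongrightarrow> at_time W (tau W h k) \<omega>" for \<omega>
  proof (cases "tau W h k \<omega> = \<infinity>")
    case True
    then show ?thesis by (simp add: at_time_def)
  next
    case False
    have "eventually (\<lambda>N. ?g N \<omega> = at_time W (tau W h k) \<omega>) sequentially"
      using tau_trunc_eventually[OF False] by eventually_elim (simp add: False at_time_def B_def tau_real_def)
    then show ?thesis by (rule tendsto_eventually)
  qed
qed

lemma integrable_tau_square: "integrable M (\<lambda>\<omega>. (tau_real k \<omega>)\<^sup>2)"
proof -
  obtain C where C: "\<And>N. 0 \<le> N \<Longrightarrow> (\<integral>\<omega>. (tau_trunc h k N \<omega>)\<^sup>2 \<partial>M) \<le> C"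
    using expectation_tau_trunc_square_bounded by auto
  show ?thesis
  proof (rule integrable_limit_of_bounded_expectations)
    show "integrable M (\<lambda>\<omega>. (tau_trunc h k (real N) \<omega>)\<^sup>2)" for N by (rule integrable_steps) simp
    show "(\<integral>\<omega>. (tau_trunc h k (real N) \<omega>)\<^sup>2 \<partial>M) \<le> C" for N by (rule C) simp
    show "AE \<omega> in M. (\<lambda>N. (tau_trunc h k (real N) \<omega>)\<^sup>2) \<longlonglongrightarrow> (tau_real k \<omega>)\<^sup>2"
      using AE_tau_finite[of k] by eventually_elim (intro tendsto_power tendsto_eventually tau_trunc_eventually)
  qed auto
qed

lemma integrable_tau: "integrable M (tau_real k)"
  by (rule square_integrable_imp_integrable[OF measurable_tau_real integrable_tau_square])

lemma step_eventually:
  assumes \<omega>: "\<omega> \<in> space M" and fin: "tau W h (Suc k) \<omega> \<noteq> \<infinity>"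
  shows "eventually (\<lambda>N::nat. tau_trunc h k N \<omega> = tau_real k \<omega> \<and> time_step h k N \<omega> = tau_real (Suc k) \<omega> - tau_real k \<omega> \<and> (space_step h k N \<omega>)\<^sup>2 = h) sequentially"
proof -
  obtain r where r: "tau W h (Suc k) \<omega> = ereal r" using fin by (cases h "Suc k" \<omega> rule: tau_finite_cases) auto
  obtain s where s: "tau W h k \<omega> = ereal s" "0 \<le> s" "s \<le> r" "\<bar>B r \<omega> - B s \<omega>\<bar> = sqrt h"
    by (rule B_at_tau_Suc[OF \<omega> r])
  have "(B r \<omega> - B s \<omega>)\<^sup>2 = \<bar>B r \<omega> - B s \<omega>\<bar>\<^sup>2" by simp
  also have "\<dots> = h" unfolding s(4) using h by simp
  finally have sq: "(B r \<omega> - B s \<omega>)\<^sup>2 = h" .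
  have fin': "tau W h k \<omega> \<noteq> \<infinity>" using s by simp
  show ?thesis
    using tau_trunc_eventually[OF fin] tau_trunc_eventually[OF fin']
    by eventually_elim (simp add: time_step_def space_step_def tau_real_def r s(1) sq)
qed


text \<open>Dominated convergence for sequences that become stationary: this is the way in which a finite
  hitting time is recovered from its cut-offs.\<close>

lemma integral_zero_limit:
  fixes f :: "nat \<Rightarrow> 'a \<Rightarrow> real"
  assumes "\<And>N. (\<integral>\<omega>. f N \<omega> \<partial>M) = 0" "\<And>N. f N \<in> borel_measurable M" "g \<in> borel_measurable M"
    "AE \<omega> in M. eventually (\<lambda>N. f N \<omega> = g \<omega>) sequentially"
    "\<And>N. AE \<omega> in M. \<bar>f N \<omega>\<bar> \<le> w \<omega>" "integrable M w"
  shows "(\<integral>\<omega>. g \<omega> \<partial>M) = 0" "integrable M g"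
proof -
  have lim: "AE \<omega> in M. (\<lambda>N. f N \<omega>) \<longlonglongrightarrow> g \<omega>"
    using assms(4) by eventually_elim (rule tendsto_eventually)
  have bound: "AE \<omega> in M. norm (f N \<omega>) \<le> w \<omega>" for N using assms(5) by simp
  have "(\<lambda>N. \<integral>\<omega>. f N \<omega> \<partial>M) \<longlonglongrightarrow> (\<integral>\<omega>. g \<omega> \<partial>M)"
    by (rule integral_dominated_convergence[OF assms(3,2,6) lim bound])
  then show "(\<integral>\<omega>. g \<omega> \<partial>M) = 0" by (simp add: assms(1) LIMSEQ_const_iff)
  show "integrable M g" by (rule integrable_dominated_convergence[OF assms(3,2,6) lim bound])
qed

text \<open>The limits of the identities for one step as the cut-off disappears, with \<open>X\<^sup>2 = h\<close> inserted. They determine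
  the mean of a step, its covariance with the starting time, and its second moment.\<close>

lemma tau_step_identities:
  shows "(\<integral>\<omega>. tau_real (Suc k) \<omega> - tau_real k \<omega> - h \<partial>M) = 0"
    and "(\<integral>\<omega>. tau_real k \<omega> * (tau_real (Suc k) \<omega> - tau_real k \<omega> - h) \<partial>M) = 0"
    and "integrable M (\<lambda>\<omega>. tau_real k \<omega> * (tau_real (Suc k) \<omega> - tau_real k \<omega> - h))"
    and "(\<integral>\<omega>. h\<^sup>2 - 6 * h * (tau_real (Suc k) \<omega> - tau_real k \<omega>) + 3 * (tau_real (Suc k) \<omega> - tau_real k \<omega>)\<^sup>2 \<partial>M) = 0"
    and "integrable M (\<lambda>\<omega>. h\<^sup>2 - 6 * h * (tau_real (Suc k) \<omega> - tau_real k \<omega>) + 3 * (tau_real (Suc k) \<omega> - tau_real k \<omega>)\<^sup>2)"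
proof -
  let ?T = "tau_real (Suc k)"
  have [measurable]: "space_step h k (real N) \<in> borel_measurable M" for N :: nat by (rule measurable_space_step) simp
  have int: "integrable M (\<lambda>\<omega>. (1 + ?T \<omega>) * (?T \<omega> + h))" "integrable M (\<lambda>\<omega>. h\<^sup>2 + 6 * h * ?T \<omega> + 3 * (?T \<omega>)\<^sup>2)"
  proof -
    have "integrable M (\<lambda>\<omega>. ?T \<omega> + h + (?T \<omega>)\<^sup>2 + h * ?T \<omega>)"
      using integrable_tau[of "Suc k"] integrable_tau_square[of "Suc k"] by simp
    then show "integrable M (\<lambda>\<omega>. (1 + ?T \<omega>) * (?T \<omega> + h))" by (simp add: algebra_simps power2_eq_square)
    show "integrable M (\<lambda>\<omega>. h\<^sup>2 + 6 * h * ?T \<omega> + 3 * (?T \<omega>)\<^sup>2)"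
      using integrable_tau[of "Suc k"] integrable_tau_square[of "Suc k"] by simp
  qed
  have bds: "AE \<omega> in M. 0 \<le> tau_trunc h k N \<omega> \<and> tau_trunc h k N \<omega> \<le> ?T \<omega> \<and> 0 \<le> time_step h k N \<omega> \<and> time_step h k N \<omega> \<le> ?T \<omega> \<and> (space_step h k N \<omega>)\<^sup>2 \<le> h"
    for N :: nat
    using AE_tau_finite[of "Suc k"] AE_space
  proof eventually_elim
    case (elim \<omega>)
    have "tau_trunc h (Suc k) N \<omega> \<le> ?T \<omega>" using tau_trunc_eq_min[OF elim(1)] by simp
    then show ?case
      using tau_trunc_bounds[of "real N" h k \<omega>] tau_trunc_le_Suc[of h k "real N" \<omega>] time_step_bounds[of "real N" k \<omega>] space_step_square_le[OF elim(2), of "real N" k] by auto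
  qed
  have ev: "AE \<omega> in M. eventually (\<lambda>N::nat. tau_trunc h k N \<omega> = tau_real k \<omega> \<and> time_step h k N \<omega> = ?T \<omega> - tau_real k \<omega> \<and> (space_step h k N \<omega>)\<^sup>2 = h) sequentially"
    using AE_tau_finite[of "Suc k"] AE_space
  proof eventually_elim
    case (elim \<omega>)
    show ?case by (rule step_eventually[OF elim(2,1)])
  qed
  have bound: "\<bar>z * (s - x)\<bar> \<le> (1 + t) * (t + h)" if "\<bar>z\<bar> \<le> 1 + t" "0 \<le> s" "s \<le> t" "0 \<le> x" "x \<le> h" for z s t x :: real
    unfolding abs_mult using that by (intro mult_mono) auto
  have *: "(\<integral>\<omega>. z (tau_real k \<omega>) * (?T \<omega> - tau_real k \<omega> - h) \<partial>M) = 0 \<and> integrable M (\<lambda>\<omega>. z (tau_real k \<omega>) * (?T \<omega> - tau_real k \<omega> - h))"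
    if [measurable]: "z \<in> borel_measurable borel" and z: "\<And>r t. 0 \<le> r \<Longrightarrow> r \<le> t \<Longrightarrow> \<bar>z r\<bar> \<le> 1 + t" for z
  proof -
    have 1: "(\<integral>\<omega>. z (tau_trunc h k (real N) \<omega>) * (time_step h k (real N) \<omega> - (space_step h k (real N) \<omega>)\<^sup>2) \<partial>M) = 0" for N
      by (rule step_identities(1)[where K = "1 + real N"]) (use z in auto)
    have 2: "AE \<omega> in M. eventually (\<lambda>N::nat. z (tau_trunc h k N \<omega>) * (time_step h k N \<omega> - (space_step h k N \<omega>)\<^sup>2) = z (tau_real k \<omega>) * (?T \<omega> - tau_real k \<omega> - h)) sequentially"
      using ev by eventually_elim (auto elim!: eventually_mono)
    have 3: "AE \<omega> in M. \<bar>z (tau_trunc h k N \<omega>) * (time_step h k N \<omega> - (space_step h k N \<omega>)\<^sup>2)\<bar> \<le> (1 + ?T \<omega>) * (?T \<omega> + h)" for N :: nat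
      using bds[of N] by eventually_elim (rule bound, auto intro: z)
    show ?thesis
      by (intro conjI integral_zero_limit[OF 1 _ _ 2 3 int(1)]) measurable
  qed
  show "(\<integral>\<omega>. tau_real (Suc k) \<omega> - tau_real k \<omega> - h \<partial>M) = 0" using *[of "\<lambda>_. 1"] by simp
  show "(\<integral>\<omega>. tau_real k \<omega> * (tau_real (Suc k) \<omega> - tau_real k \<omega> - h) \<partial>M) = 0"
    "integrable M (\<lambda>\<omega>. tau_real k \<omega> * (tau_real (Suc k) \<omega> - tau_real k \<omega> - h))" using *[of "\<lambda>r. r"] by simp_all
  have 1: "(\<integral>\<omega>. space_step h k (real N) \<omega> ^ 4 - 6 * (space_step h k (real N) \<omega>)\<^sup>2 * time_step h k (real N) \<omega> + 3 * (time_step h k (real N) \<omega>)\<^sup>2 \<partial>M) = 0" for N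
    using step_identities(2)[of "real N" "\<lambda>_. 1" 1 k] by simp
  have 4: "x ^ 4 = (x\<^sup>2)\<^sup>2" for x :: real by (simp flip: power_mult)
  have 2: "AE \<omega> in M. eventually (\<lambda>N::nat. space_step h k N \<omega> ^ 4 - 6 * (space_step h k N \<omega>)\<^sup>2 * time_step h k N \<omega> + 3 * (time_step h k N \<omega>)\<^sup>2
      = h\<^sup>2 - 6 * h * (?T \<omega> - tau_real k \<omega>) + 3 * (?T \<omega> - tau_real k \<omega>)\<^sup>2) sequentially"
    using ev
  proof eventually_elim
    case (elim \<omega>)
    then show ?case
    proof (rule eventually_mono)
      fix N :: nat
      assume "tau_trunc h k N \<omega> = tau_real k \<omega> \<and> time_step h k N \<omega> = ?T \<omega> - tau_real k \<omega> \<and> (space_step h k N \<omega>)\<^sup>2 = h"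
      then have "time_step h k N \<omega> = ?T \<omega> - tau_real k \<omega>" "(space_step h k N \<omega>)\<^sup>2 = h" by auto
      then show "space_step h k N \<omega> ^ 4 - 6 * (space_step h k N \<omega>)\<^sup>2 * time_step h k N \<omega> + 3 * (time_step h k N \<omega>)\<^sup>2
          = h\<^sup>2 - 6 * h * (?T \<omega> - tau_real k \<omega>) + 3 * (?T \<omega> - tau_real k \<omega>)\<^sup>2"
        by (simp only: 4)
    qed
  qed
  have 3: "AE \<omega> in M. \<bar>space_step h k N \<omega> ^ 4 - 6 * (space_step h k N \<omega>)\<^sup>2 * time_step h k N \<omega> + 3 * (time_step h k N \<omega>)\<^sup>2\<bar>
      \<le> h\<^sup>2 + 6 * h * ?T \<omega> + 3 * (?T \<omega>)\<^sup>2" for N :: nat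
    using bds[of N]
  proof eventually_elim
    case (elim \<omega>)
    let ?x = "(space_step h k N \<omega>)\<^sup>2" and ?s = "time_step h k N \<omega>"
    have "?x\<^sup>2 \<le> h\<^sup>2" using elim by (intro power_mono) auto
    moreover have "?x * ?s \<le> h * ?T \<omega>" "?s\<^sup>2 \<le> (?T \<omega>)\<^sup>2" "0 \<le> ?x\<^sup>2" "0 \<le> ?x * ?s" "0 \<le> ?s\<^sup>2"
      using elim h by (auto intro!: power_mono mult_mono)
    ultimately show ?case unfolding 4 mult.assoc by linarith
  qed
  show "(\<integral>\<omega>. h\<^sup>2 - 6 * h * (tau_real (Suc k) \<omega> - tau_real k \<omega>) + 3 * (tau_real (Suc k) \<omega> - tau_real k \<omega>)\<^sup>2 \<partial>M) = 0"
    and "integrable M (\<lambda>\<omega>. h\<^sup>2 - 6 * h * (tau_real (Suc k) \<omega> - tau_real k \<omega>) + 3 * (tau_real (Suc k) \<omega> - tau_real k \<omega>)\<^sup>2)"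
    by (rule integral_zero_limit[OF 1 _ _ 2 3 int(2)], measurable)+
qed

lemma expectation_tau: "expectation (tau_real k) = real k * h"
proof (induction k)
  case 0
  show ?case by (simp add: tau_real_def)
next
  case (Suc k)
  have "expectation (tau_real (Suc k)) - expectation (tau_real k) - h = 0"
    using tau_step_identities(1)[of k] integrable_tau by (simp add: prob_space)
  then show ?case using Suc by (simp add: algebra_simps)
qed

text \<open>Since a step has mean \<open>h\<close> given its starting time, variances add up; each step contributes
  \<open>5 h\<^sup>2 / 3 - h\<^sup>2 = 2 h\<^sup>2 / 3\<close>.\<close>

lemma expectation_tau_square: "(\<integral>\<omega>. (tau_real k \<omega>)\<^sup>2 \<partial>M) = (real k * h)\<^sup>2 + 2 / 3 * real k * h\<^sup>2"
proof (induction k)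
  case 0
  show ?case by (simp add: tau_real_def)
next
  case (Suc k)
  let ?u = "\<lambda>\<omega>. tau_real k \<omega> * (tau_real (Suc k) \<omega> - tau_real k \<omega> - h)"
  let ?v = "\<lambda>\<omega>. h\<^sup>2 - 6 * h * (tau_real (Suc k) \<omega> - tau_real k \<omega>) + 3 * (tau_real (Suc k) \<omega> - tau_real k \<omega>)\<^sup>2"
  \<comment> \<open>With \<open>\<Delta>\<close> the step, the square \<open>(\<tau>\<^sub>k + \<Delta>)\<^sup>2\<close> is written in terms of the two expressions of mean zero.\<close>
  have "(tau_real (Suc k) \<omega>)\<^sup>2 = (tau_real k \<omega>)\<^sup>2 + 2 * ?u \<omega> + 1 / 3 * ?v \<omega> + 2 * h * tau_real (Suc k) \<omega> - h\<^sup>2 / 3" for \<omega>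
    by (simp add: power2_eq_square field_simps)
  then have "(\<integral>\<omega>. (tau_real (Suc k) \<omega>)\<^sup>2 \<partial>M) = (\<integral>\<omega>. (tau_real k \<omega>)\<^sup>2 + 2 * ?u \<omega> + 1 / 3 * ?v \<omega> + 2 * h * tau_real (Suc k) \<omega> - h\<^sup>2 / 3 \<partial>M)"
    by presburger
  also have "\<dots> = (\<integral>\<omega>. (tau_real k \<omega>)\<^sup>2 \<partial>M) + 2 * (\<integral>\<omega>. ?u \<omega> \<partial>M) + 1 / 3 * (\<integral>\<omega>. ?v \<omega> \<partial>M) + 2 * h * expectation (tau_real (Suc k)) - h\<^sup>2 / 3"
  proof -
    have "(\<integral>\<omega>. f \<omega> + 2 * u \<omega> + 1 / 3 * v \<omega> + 2 * h * g \<omega> - h\<^sup>2 / 3 \<partial>M) =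
       (\<integral>\<omega>. f \<omega> \<partial>M) + 2 * (\<integral>\<omega>. u \<omega> \<partial>M) + 1 / 3 * (\<integral>\<omega>. v \<omega> \<partial>M) + 2 * h * (\<integral>\<omega>. g \<omega> \<partial>M) - h\<^sup>2 / 3"
      if "integrable M f" "integrable M u" "integrable M v" "integrable M g" for f u v g :: "'a \<Rightarrow> real"
      using that by (simp add: prob_space)
    from this[OF integrable_tau_square tau_step_identities(3,5) integrable_tau] show ?thesis .
  qed
  finally show ?case unfolding Suc tau_step_identities expectation_tau
    by (simp add: power2_eq_square field_simps)
qed

lemma expectation_tau_diff_square:
  "(\<integral>\<omega>. (tau_real k \<omega> - c)\<^sup>2 \<partial>M) = (real k * h - c)\<^sup>2 + 2 / 3 * real k * h\<^sup>2"
proof -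
  have "(\<integral>\<omega>. (tau_real k \<omega> - c)\<^sup>2 \<partial>M) = (\<integral>\<omega>. (tau_real k \<omega>)\<^sup>2 - 2 * c * tau_real k \<omega> + c\<^sup>2 \<partial>M)"
    by (intro Bochner_Integration.integral_cong) (auto simp: power2_eq_square algebra_simps)
  also have "\<dots> = (\<integral>\<omega>. (tau_real k \<omega>)\<^sup>2 \<partial>M) - 2 * c * expectation (tau_real k) + c\<^sup>2"
    using integrable_tau[of k] integrable_tau_square[of k] by (simp add: prob_space)
  finally show ?thesis unfolding expectation_tau expectation_tau_square by (simp add: power2_eq_square algebra_simps)
qed

end
end

section \<open>Comparing time and space errors\<close>

lemma sixth_power_sum_le:
  fixes a b :: real
  assumes "0 \<le> a" "0 \<le> b" shows "(a + b) ^ 6 \<le> 64 * (a ^ 6 + b ^ 6)"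
proof -
  have "(a + b) ^ 6 \<le> (2 * max a b) ^ 6" using assms by (intro power_mono) auto
  also have "\<dots> = 64 * (max a b) ^ 6" by (simp add: power_mult_distrib)
  also have "(max a b) ^ 6 \<le> a ^ 6 + b ^ 6" by (simp add: max_def)
  finally show ?thesis by simp
qed

context brownian begin

text \<open>Sixth moments dominate the displacements in the passage from cut-off to unbounded hitting times below.\<close>

lemma integrable_B_6:
  assumes "0 < t" shows "integrable M (\<lambda>\<omega>. B t \<omega> ^ 6)"
proof -
  have D: "distributed M lborel (\<lambda>\<omega>. B t \<omega> - B 0 \<omega>) (normal_density 0 (sqrt (t - 0)))"
    by (rule distributed_increment) (use assms in auto)
  have "integrable lborel (\<lambda>x. normal_density 0 (sqrt t) x * (x - 0) ^ 6)"
    by (rule integrable_normal_moment) (use assms in simp)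
  then show ?thesis
    using distributed_integrable[OF D, of "\<lambda>x. x ^ 6"] by simp
qed

context
  fixes h :: real
  assumes h: "0 < h"
begin

lemma abs_B_tau_trunc_le:
  assumes "\<omega> \<in> space M" "0 \<le> N"
  shows "\<bar>B (tau_trunc h k N \<omega>) \<omega>\<bar> \<le> real k * sqrt h"
proof (induction k)
  case 0
  show ?case using assms by (simp add: tau_trunc_0)
next
  case (Suc k)
  then show ?case using B_tau_trunc_step[OF assms(1) h assms(2), of k] by (simp add: algebra_simps)
qed

text \<open>The central estimate. For the cut-off time the fourth order identity and
  \<open>6 X\<^sup>2 s \<le> 9 X\<^sup>4 + s\<^sup>2\<close> combine to \<open>2 E s\<^sup>2 \<le> 8 E X\<^sup>4\<close>. Both sides converge as the cut-off level grows,
  because \<open>\<tau>\<^sub>n\<close> is square integrable and the stopped path stays within \<open>n sqrt h\<close> of its starting point.\<close>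

lemma time_error_le_space_error:
  fixes n :: nat and t :: real
  assumes t: "0 < t"
  defines "D \<equiv> \<lambda>\<omega>. at_time W (tau W h n) \<omega> - W t \<omega>"
  shows "integrable M (\<lambda>\<omega>. D \<omega> ^ 4)" "(\<integral>\<omega>. (tau_real h n \<omega> - t)\<^sup>2 \<partial>M) \<le> 4 * (\<integral>\<omega>. D \<omega> ^ 4 \<partial>M)"
proof -
  \<comment> \<open>Cut-off levels above \<open>t\<close>, so that the later of the two times is bounded by the level.\<close>
  define N where "N m = real m + t" for m :: nat
  define r where "r m = tau_trunc h n (N m)" for m
  define Y where "Y m \<omega> = B (r m \<omega>) \<omega> - B t \<omega>" for m \<omega>
  \<comment> \<open>One function dominates all even powers of the displacement up to the sixth.\<close>
  define w where "w \<omega> = 1 + 64 * ((real n * sqrt h) ^ 6 + B t \<omega> ^ 6)" for \<omega>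
  have N0: "0 \<le> N m" and tN: "t \<le> N m" for m using t by (simp_all add: N_def)
  have r: "0 \<le> r m \<omega>" "r m \<omega> \<le> N m" for m \<omega> unfolding r_def using tau_trunc_bounds[OF N0] by auto
  have [measurable]: "r m \<in> borel_measurable M" for m unfolding r_def by (rule measurable_tau_trunc[OF h])
  have Bt [measurable]: "B t \<in> borel_measurable M" by (rule measurable_B) (use t in simp)
  have Wt [measurable]: "W t \<in> borel_measurable M" by (rule measurable_W) (use t in simp)
  have Dm [measurable]: "D \<in> borel_measurable M"
    unfolding D_def using measurable_at_tau[OF h, of n] by measurable
  have Ym [measurable]: "Y m \<in> borel_measurable M" for m
    unfolding Y_def r_def using measurable_B_tau_trunc[OF h N0] by measurable
  have int_w: "integrable M w" unfolding w_def using integrable_B_6[OF t] by simp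
  have Y6: "1 + Y m \<omega> ^ 6 \<le> w \<omega>" if "\<omega> \<in> space M" for m \<omega>
  proof -
    have "\<bar>Y m \<omega>\<bar> \<le> real n * sqrt h + \<bar>B t \<omega>\<bar>"
      unfolding Y_def r_def using abs_B_tau_trunc_le[OF that N0[of m], of n] by linarith
    then have "\<bar>Y m \<omega>\<bar> ^ 6 \<le> (real n * sqrt h + \<bar>B t \<omega>\<bar>) ^ 6" by (rule power_mono) simp
    also have "\<dots> \<le> 64 * ((real n * sqrt h) ^ 6 + \<bar>B t \<omega>\<bar> ^ 6)" using h by (intro sixth_power_sum_le) auto
    finally show ?thesis by (simp add: w_def power_even_abs)
  qed
  have Y4w: "Y m \<omega> ^ 4 \<le> w \<omega>" and Y2w: "(Y m \<omega>)\<^sup>2 \<le> w \<omega>" and Y6w: "Y m \<omega> ^ 6 \<le> w \<omega>" if "\<omega> \<in> space M" for m \<omega>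
    using Y6[OF that, of m] powers_le_1_plus_sixth[of "Y m \<omega>"] by linarith+
  have even0: "0 \<le> x ^ 4" "0 \<le> x ^ 6" for x :: real by simp_all
  have int4: "integrable M (\<lambda>\<omega>. Y m \<omega> ^ 4)" and int6: "integrable M (\<lambda>\<omega>. Y m \<omega> ^ 6)" for m
    by (rule Bochner_Integration.integrable_bound[OF int_w]; auto intro!: AE_I2 order_trans[OF Y4w] order_trans[OF Y6w])+
  have int_s: "integrable M (\<lambda>\<omega>. (r m \<omega> - t)\<^sup>2)" for m
  proof (rule integrable_const_bound[where B = "(N m)\<^sup>2"])
    show "AE \<omega> in M. norm ((r m \<omega> - t)\<^sup>2) \<le> (N m)\<^sup>2"
    proof (rule AE_I2)
      fix \<omega>
      have "\<bar>r m \<omega> - t\<bar> \<le> N m" using r[of m \<omega>] t tN[of m] by linarith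
      from power_mono[OF this abs_ge_zero, of 2] show "norm ((r m \<omega> - t)\<^sup>2) \<le> (N m)\<^sup>2" by simp
    qed
  qed measurable
  have int_Ys: "integrable M (\<lambda>\<omega>. (Y m \<omega>)\<^sup>2 * \<bar>r m \<omega> - t\<bar>)" for m
  proof (rule Bochner_Integration.integrable_bound)
    show "integrable M (\<lambda>\<omega>. w \<omega> * N m)" using int_w by simp
    show "AE \<omega> in M. norm ((Y m \<omega>)\<^sup>2 * \<bar>r m \<omega> - t\<bar>) \<le> norm (w \<omega> * N m)"
    proof (rule AE_I2)
      fix \<omega> assume \<omega>: "\<omega> \<in> space M"
      have "0 \<le> w \<omega>" using Y2w[OF \<omega>, of m] zero_le_power2[of "Y m \<omega>"] by linarith
      moreover have "\<bar>r m \<omega> - t\<bar> \<le> N m" using r[of m \<omega>] t tN[of m] by linarith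
      ultimately show "norm ((Y m \<omega>)\<^sup>2 * \<bar>r m \<omega> - t\<bar>) \<le> norm (w \<omega> * N m)"
        using Y2w[OF \<omega>, of m] N0[of m] by (simp add: abs_mult mult_mono)
    qed
  qed measurable
  have truncated: "(\<integral>\<omega>. (r m \<omega> - t)\<^sup>2 \<partial>M) \<le> 4 * (\<integral>\<omega>. Y m \<omega> ^ 4 \<partial>M)" for m
  proof -
    define \<rho> \<sigma> where "\<rho> \<omega> = min (r m \<omega>) t" and "\<sigma> \<omega> = max (r m \<omega>) t" for \<omega>
    have opt: "optional \<rho>" "optional \<sigma>"
      unfolding \<rho>_def \<sigma>_def r_def by (intro optional_min optional_max optional_const optional_tau_trunc h)+
    have bds: "0 \<le> \<rho> \<omega> \<and> \<rho> \<omega> \<le> \<sigma> \<omega> \<and> \<sigma> \<omega> \<le> N m" for \<omega>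
      using r[of m \<omega>] t tN[of m] by (auto simp: \<rho>_def \<sigma>_def)
    \<comment> \<open>Which of the two times comes first affects the sign of the displacement only.\<close>
    have even: "(B (\<sigma> \<omega>) \<omega> - B (\<rho> \<omega>) \<omega>) ^ j = Y m \<omega> ^ j" if "even j" for j \<omega>
    proof (cases "r m \<omega> \<le> t")
      case True
      then have "B (\<sigma> \<omega>) \<omega> - B (\<rho> \<omega>) \<omega> = - Y m \<omega>" by (simp add: \<sigma>_def \<rho>_def Y_def)
      then show ?thesis using that by simp
    next
      case False
      then show ?thesis by (simp add: \<sigma>_def \<rho>_def Y_def)
    qed
    have s: "\<sigma> \<omega> - \<rho> \<omega> = \<bar>r m \<omega> - t\<bar>" for \<omega> by (simp add: \<sigma>_def \<rho>_def)
    have "(\<integral>\<omega>. 1 * ((B (\<sigma> \<omega>) \<omega> - B (\<rho> \<omega>) \<omega>) ^ 4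
            - 6 * (B (\<sigma> \<omega>) \<omega> - B (\<rho> \<omega>) \<omega>)\<^sup>2 * (\<sigma> \<omega> - \<rho> \<omega>) + 3 * (\<sigma> \<omega> - \<rho> \<omega>)\<^sup>2) \<partial>M) = 0"
      by (rule moment_identities(2)[OF opt bds, of "\<lambda>_. 1" 1]) (simp_all add: even int6)
    then have zero: "(\<integral>\<omega>. Y m \<omega> ^ 4 - 6 * (Y m \<omega>)\<^sup>2 * \<bar>r m \<omega> - t\<bar> + 3 * (r m \<omega> - t)\<^sup>2 \<partial>M) = 0"
      by (simp add: even s)
    have "(\<integral>\<omega>. 2 * (r m \<omega> - t)\<^sup>2 - 8 * Y m \<omega> ^ 4 \<partial>M)
        \<le> (\<integral>\<omega>. Y m \<omega> ^ 4 - 6 * (Y m \<omega>)\<^sup>2 * \<bar>r m \<omega> - t\<bar> + 3 * (r m \<omega> - t)\<^sup>2 \<partial>M)"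
    proof (rule integral_mono)
      show "integrable M (\<lambda>\<omega>. 2 * (r m \<omega> - t)\<^sup>2 - 8 * Y m \<omega> ^ 4)" using int_s int4 by simp
      show "integrable M (\<lambda>\<omega>. Y m \<omega> ^ 4 - 6 * (Y m \<omega>)\<^sup>2 * \<bar>r m \<omega> - t\<bar> + 3 * (r m \<omega> - t)\<^sup>2)"
        using int_s[of m] int4[of m] int_Ys[of m] by (simp add: mult.assoc)
      fix \<omega>
      let ?s = "\<bar>r m \<omega> - t\<bar>" and ?x = "(Y m \<omega>)\<^sup>2"
      \<comment> \<open>The weights are chosen to make the discriminant vanish: \<open>6 x s \<le> 9 x\<^sup>2 + s\<^sup>2\<close>.\<close>
      have "0 \<le> (3 * ?x - ?s)\<^sup>2" by simp
      also have "\<dots> = 9 * Y m \<omega> ^ 4 - 6 * ?x * ?s + (r m \<omega> - t)\<^sup>2"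
        by (simp add: power2_diff power_mult_distrib algebra_simps)
      finally show "2 * (r m \<omega> - t)\<^sup>2 - 8 * Y m \<omega> ^ 4 \<le> Y m \<omega> ^ 4 - 6 * ?x * ?s + 3 * (r m \<omega> - t)\<^sup>2" by linarith
    qed
    then show ?thesis unfolding zero using int_s[of m] int4[of m] by simp
  qed
  have ev: "AE \<omega> in M. eventually (\<lambda>m. r m \<omega> = tau_real h n \<omega> \<and> Y m \<omega> = D \<omega>) sequentially"
    using AE_tau_finite[OF h, of n]
  proof eventually_elim
    case (elim \<omega>)
    have "r m \<omega> = tau_real h n \<omega> \<and> Y m \<omega> = D \<omega>" if "nat \<lceil>tau_real h n \<omega>\<rceil> \<le> m" for m
    proof -
      have "tau_real h n \<omega> \<le> N m" using that t by (simp add: N_def)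
      then have "r m \<omega> = tau_real h n \<omega>" using tau_trunc_eq_min[OF h elim, of "N m"] by (simp add: r_def)
      then show ?thesis by (simp add: Y_def D_def B_diff at_time_def tau_real_def[OF h])
    qed
    then show ?case unfolding eventually_sequentially by blast
  qed
  have lim4: "AE \<omega> in M. (\<lambda>m. Y m \<omega> ^ 4) \<longlonglongrightarrow> D \<omega> ^ 4"
    using ev
  proof eventually_elim
    case (elim \<omega>)
    then have "eventually (\<lambda>m. Y m \<omega> ^ 4 = D \<omega> ^ 4) sequentially" by (rule eventually_mono) simp
    then show ?case by (rule tendsto_eventually)
  qed
  have lim2: "AE \<omega> in M. (\<lambda>m. (r m \<omega> - t)\<^sup>2) \<longlonglongrightarrow> (tau_real h n \<omega> - t)\<^sup>2"
    using ev
  proof eventually_elim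
    case (elim \<omega>)
    then have "eventually (\<lambda>m. (r m \<omega> - t)\<^sup>2 = (tau_real h n \<omega> - t)\<^sup>2) sequentially" by (rule eventually_mono) simp
    then show ?case by (rule tendsto_eventually)
  qed
  have b4: "AE \<omega> in M. norm (Y m \<omega> ^ 4) \<le> w \<omega>" for m
    by (rule AE_I2) (simp add: Y4w)
  have b2: "AE \<omega> in M. norm ((r m \<omega> - t)\<^sup>2) \<le> (tau_real h n \<omega>)\<^sup>2 + 2 * t * tau_real h n \<omega> + t\<^sup>2" for m
    using AE_tau_finite[OF h, of n]
  proof eventually_elim
    case (elim \<omega>)
    have "r m \<omega> \<le> tau_real h n \<omega>" using tau_trunc_eq_min[OF h elim, of "N m"] by (simp add: r_def)
    then have "\<bar>r m \<omega> - t\<bar> \<le> tau_real h n \<omega> + t" using r[of m \<omega>] t by linarith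
    from power_mono[OF this abs_ge_zero, of 2] show ?case by (simp add: power2_sum mult_ac)
  qed
  have int_T: "integrable M (\<lambda>\<omega>. (tau_real h n \<omega>)\<^sup>2 + 2 * t * tau_real h n \<omega> + t\<^sup>2)"
    using integrable_tau[OF h, of n] integrable_tau_square[OF h, of n] by simp
  have Tm [measurable]: "tau_real h n \<in> borel_measurable M" by (rule measurable_tau_real[OF h])
  show "integrable M (\<lambda>\<omega>. D \<omega> ^ 4)"
    by (rule integrable_dominated_convergence[OF _ _ int_w lim4 b4]) measurable
  have l4: "(\<lambda>m. \<integral>\<omega>. Y m \<omega> ^ 4 \<partial>M) \<longlonglongrightarrow> (\<integral>\<omega>. D \<omega> ^ 4 \<partial>M)"
    by (rule integral_dominated_convergence[OF _ _ int_w lim4 b4]) measurable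
  have l2: "(\<lambda>m. \<integral>\<omega>. (r m \<omega> - t)\<^sup>2 \<partial>M) \<longlonglongrightarrow> (\<integral>\<omega>. (tau_real h n \<omega> - t)\<^sup>2 \<partial>M)"
    by (rule integral_dominated_convergence[OF _ _ int_T lim2 b2]) measurable
  show "(\<integral>\<omega>. (tau_real h n \<omega> - t)\<^sup>2 \<partial>M) \<le> 4 * (\<integral>\<omega>. D \<omega> ^ 4 \<partial>M)"
    by (rule LIMSEQ_le[OF l2 tendsto_mult_left[OF l4]]) (use truncated in auto)
qed

lemma space_error_lower_bound:
  assumes t: "0 < t"
  shows "1 / 6 * real n * h\<^sup>2 \<le> (\<integral>\<omega>. (at_time W (tau W h n) \<omega> - W t \<omega>) ^ 4 \<partial>M)"
proof -
  have "2 / 3 * real n * h\<^sup>2 \<le> (\<integral>\<omega>. (tau_real h n \<omega> - t)\<^sup>2 \<partial>M)"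
    unfolding expectation_tau_diff_square[OF h] by simp
  also have "\<dots> \<le> 4 * (\<integral>\<omega>. (at_time W (tau W h n) \<omega> - W t \<omega>) ^ 4 \<partial>M)"
    by (rule time_error_le_space_error(2)[OF t])
  finally show ?thesis by simp
qed

end

text \<open>As for the steps of the walk, with the interval \<open>{0..r}\<close> and the distance of \<open>\<bar>W\<bar>\<close> from 1.\<close>

lemma exit_time_less_iff:
  assumes \<omega>: "\<omega> \<in> space M"
  shows "exit_time (-1) 1 W \<omega> < ereal t \<longleftrightarrow>
    (\<exists>r\<in>\<rat>. r < t \<and> (\<forall>n::nat. \<exists>q\<in>\<rat>. 0 \<le> q \<and> q \<le> r \<and> \<bar>\<bar>W q \<omega>\<bar> - 1\<bar> < 1 / (real n + 1)))" (is "?L \<longleftrightarrow> ?R")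
proof
  assume ?L
  then obtain s where s: "0 \<le> s" "s < t" "\<bar>\<bar>W s \<omega>\<bar> - 1\<bar> = 0"
    unfolding exit_time_def Inf_less_iff by force
  obtain r where r: "r \<in> \<rat>" "s < r" "r < t" using Rats_dense_in_real[OF s(2)] by auto
  have "\<exists>q\<in>\<rat>. 0 \<le> q \<and> q \<le> r \<and> \<bar>\<bar>W q \<omega>\<bar> - 1\<bar> < 1 / (real n + 1)" for n :: nat
  proof -
    have "((\<lambda>x. W x \<omega>) \<longlongrightarrow> W s \<omega>) (at s within {0..})"
      using continuous_W[OF \<omega>] s by (auto simp: continuous_on_def)
    then have "((\<lambda>x. W x \<omega>) \<longlongrightarrow> W s \<omega>) (at s within {0..} \<inter> {s<..})"
      by (rule tendsto_within_subset) auto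
    also have "{0..} \<inter> {s<..} = {s<..}" using s by auto
    finally have "((\<lambda>x. \<bar>\<bar>W x \<omega>\<bar> - 1\<bar>) \<longlongrightarrow> \<bar>\<bar>W s \<omega>\<bar> - 1\<bar>) (at_right s)" by (intro tendsto_intros)
    then have "eventually (\<lambda>x. \<bar>\<bar>W x \<omega>\<bar> - 1\<bar> < 1 / (real n + 1)) (at_right s)"
      by (rule order_tendstoD) (use s(3) in simp)
    then obtain b where b: "s < b" "\<And>x. s < x \<Longrightarrow> x < b \<Longrightarrow> \<bar>\<bar>W x \<omega>\<bar> - 1\<bar> < 1 / (real n + 1)"
      unfolding eventually_at_right_field by auto
    obtain q where "q \<in> \<rat>" "s < q" "q < min b r" using Rats_dense_in_real[of s "min b r"] b r by auto
    then show ?thesis using b(2)[of q] s by (intro bexI[of _ q]) auto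
  qed
  then show ?R using r by blast
next
  assume ?R
  then obtain r where r: "r < t" and q: "\<And>n::nat. \<exists>q. 0 \<le> q \<and> q \<le> r \<and> \<bar>\<bar>W q \<omega>\<bar> - 1\<bar> < 1 / (real n + 1)" by blast
  have "0 \<le> r" using q[of 0] by auto
  have "continuous_on {0..r} (\<lambda>x. \<bar>\<bar>W x \<omega>\<bar> - 1\<bar>)"
    by (intro continuous_intros continuous_on_subset[OF continuous_W[OF \<omega>]]) auto
  then obtain x where x: "x \<in> {0..r}" "\<And>z. z \<in> {0..r} \<Longrightarrow> \<bar>\<bar>W x \<omega>\<bar> - 1\<bar> \<le> \<bar>\<bar>W z \<omega>\<bar> - 1\<bar>"
    using continuous_attains_inf[of "{0..r}" "\<lambda>x. \<bar>\<bar>W x \<omega>\<bar> - 1\<bar>"] \<open>0 \<le> r\<close> by auto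
  have "\<bar>\<bar>W x \<omega>\<bar> - 1\<bar> \<le> 1 / (real n + 1)" for n :: nat
    using q[of n] x(2) by fastforce
  moreover have "(\<lambda>n::nat. 1 / (real n + 1)) \<longlonglongrightarrow> 0" by real_asymp
  ultimately have "\<bar>\<bar>W x \<omega>\<bar> - 1\<bar> \<le> 0" by (intro LIMSEQ_le_const) auto
  then have "W x \<omega> \<in> {-1, 1}" by (auto simp: abs_if split: if_splits)
  then have "exit_time (-1) 1 W \<omega> \<le> ereal x" unfolding exit_time_def using x by (intro Inf_lower) auto
  also have "\<dots> < ereal t" using x r by simp
  finally show ?L .
qed

lemma measurable_exit_time: "exit_time (-1) 1 W \<in> borel_measurable M"
proof (rule borel_measurableI_less)
  fix a :: ereal
  have real: "{\<omega> \<in> space M. exit_time (-1) 1 W \<omega> < ereal t} \<in> sets M" for t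
  proof -
    let ?G = "\<lambda>n::nat. \<lambda>q. {\<omega> \<in> space M. 0 \<le> q \<and> \<bar>\<bar>W q \<omega>\<bar> - 1\<bar> < 1 / (real n + 1)}"
    have G: "?G n q \<in> sets M" for n q
    proof (cases "0 \<le> q")
      case True
      then have [measurable]: "W q \<in> borel_measurable M" by (rule measurable_W)
      show ?thesis by measurable
    qed simp
    have "{\<omega> \<in> space M. exit_time (-1) 1 W \<omega> < ereal t} = (\<Union>r\<in>\<rat> \<inter> {..<t}. \<Inter>n. \<Union>q\<in>\<rat> \<inter> {..r}. ?G n q)"
    proof (intro set_eqI)
      fix \<omega>
      show "\<omega> \<in> {\<omega> \<in> space M. exit_time (-1) 1 W \<omega> < ereal t} \<longleftrightarrow>
         \<omega> \<in> (\<Union>r\<in>\<rat> \<inter> {..<t}. \<Inter>n. \<Union>q\<in>\<rat> \<inter> {..r}. ?G n q)"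
      proof (cases "\<omega> \<in> space M")
        case True
        show ?thesis
          unfolding mem_Collect_eq exit_time_less_iff[OF True] UN_iff INT_iff Int_iff lessThan_iff atMost_iff
          using True by blast
      next
        case False
        then show ?thesis by simp
      qed
    qed
    also have "\<dots> \<in> sets M"
      by (intro sets.countable_UN' sets.countable_INT'[of UNIV] image_subsetI G) (auto simp: countable_rat)
    finally show ?thesis .
  qed
  show "{\<omega> \<in> space M. exit_time (-1) 1 W \<omega> < a} \<in> sets M"
  proof (cases a)
    case (real t)
    then show ?thesis using \<open>\<And>t. {\<omega> \<in> space M. exit_time (-1) 1 W \<omega> < ereal t} \<in> sets M\<close> by simp
  next
    case PInf
    have "{\<omega> \<in> space M. exit_time (-1) 1 W \<omega> < \<infinity>} = (\<Union>N::nat. {\<omega> \<in> space M. exit_time (-1) 1 W \<omega> < ereal (real N)})"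
      by (auto simp: less_PInf_Ex_of_nat)
    then show ?thesis using PInf real by auto
  qed simp
qed

text \<open>Started at 0, leaving \<open>(-1, 1)\<close> is the first step of the walk for \<open>h = 1\<close>. Measurability
  of the exit time itself matters because the two times agree only almost surely.\<close>

lemma variance_exit_time:
  assumes "y = 0"
  shows "variance (\<lambda>\<omega>. real_of_ereal (exit_time (-1) 1 W \<omega>)) = 2 / 3"
proof -
  let ?H = "\<lambda>\<omega>. real_of_ereal (exit_time (-1) 1 W \<omega>)"
  have [measurable]: "?H \<in> borel_measurable M" "tau_real 1 1 \<in> borel_measurable M"
    using measurable_exit_time by (auto intro: measurable_tau_real)
  have "AE \<omega> in M. W 0 \<omega> = 0" using brownian assms by (simp add: brownian_motion_def)
  then have eq: "AE \<omega> in M. ?H \<omega> = tau_real 1 1 \<omega>"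
  proof eventually_elim
    case (elim \<omega>)
    have "{t. 0 \<le> t \<and> W t \<omega> \<in> {-1, 1}} = {t. tau W 1 0 \<omega> \<le> ereal t \<and> \<bar>W t \<omega> - at_time W (tau W 1 0) \<omega>\<bar> = sqrt 1}"
      using elim by (auto simp: at_time_def abs_if split: if_splits)
    then have "exit_time (-1) 1 W \<omega> = tau W 1 (Suc 0) \<omega>" unfolding exit_time_def tau.simps(2) by (rule arg_cong)
    then show ?case by (simp add: tau_real_def)
  qed
  have 1: "expectation ?H = 1"
    using integral_cong_AE[OF _ _ eq] expectation_tau[of 1 1] by simp
  have "(\<integral>\<omega>. (?H \<omega> - 1)\<^sup>2 \<partial>M) = (\<integral>\<omega>. (tau_real 1 1 \<omega> - 1)\<^sup>2 \<partial>M)"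
    using eq by (intro integral_cong_AE) (auto elim!: eventually_mono)
  also have "\<dots> = 2 / 3" using expectation_tau_diff_square[of 1 1 1] by simp
  finally show ?thesis unfolding 1 .
qed

end

section \<open>Norms, the speed measure integral, and the result\<close>

text \<open>Young's inequality for the normalised variable \<open>\<bar>X\<bar> powr q / E \<bar>X\<bar> powr q\<close> and the constant 1, integrated.\<close>

lemma (in prob_space) Lp_norm_mono:
  assumes [measurable]: "X \<in> borel_measurable M" and pq: "0 < p" "p \<le> q"
  shows "Lp_norm M p X \<le> Lp_norm M q X"
proof (cases "(\<integral>\<^sup>+ \<omega>. ennreal (\<bar>X \<omega>\<bar> powr q) \<partial>M) = \<infinity>")
  case True
  then show ?thesis by (simp add: Lp_norm_def Let_def)
next
  case False
  have int_q: "integrable M (\<lambda>\<omega>. \<bar>X \<omega>\<bar> powr q)"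
    using False by (intro integrableI_nonneg) (auto simp: top.not_eq_extremum)
  have int_p: "integrable M (\<lambda>\<omega>. \<bar>X \<omega>\<bar> powr p)"
  proof (rule Bochner_Integration.integrable_bound[of _ "\<lambda>\<omega>. 1 + \<bar>X \<omega>\<bar> powr q"])
    have "x powr p \<le> 1 + x powr q" if "0 \<le> x" for x :: real
    proof (cases "x \<le> 1")
      case True
      then have "x powr p \<le> 1" using that pq by (simp add: powr_le1)
      then show ?thesis using powr_ge_zero[of x q] by linarith
    next
      case False
      then show ?thesis using powr_mono[OF pq(2), of x] by linarith
    qed
    then show "AE \<omega> in M. norm (\<bar>X \<omega>\<bar> powr p) \<le> norm (1 + \<bar>X \<omega>\<bar> powr q)"
      by (intro AE_I2) (simp add: abs_of_nonneg add_nonneg_nonneg)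
  qed (use int_q in auto)
  define a where "a = (\<integral>\<omega>. \<bar>X \<omega>\<bar> powr p \<partial>M)"
  define b where "b = (\<integral>\<omega>. \<bar>X \<omega>\<bar> powr q \<partial>M)"
  have ab: "0 \<le> a" "0 \<le> b" by (simp_all add: a_def b_def)
  have Ip: "(\<integral>\<^sup>+ \<omega>. ennreal (\<bar>X \<omega>\<bar> powr p) \<partial>M) = ennreal a"
    unfolding a_def by (rule nn_integral_eq_integral[OF int_p]) simp
  have Iq: "(\<integral>\<^sup>+ \<omega>. ennreal (\<bar>X \<omega>\<bar> powr q) \<partial>M) = ennreal b"
    unfolding b_def by (rule nn_integral_eq_integral[OF int_q]) simp
  have "a \<le> b powr (p / q)"
  proof (cases "b = 0")
    case True
    then have "AE \<omega> in M. \<bar>X \<omega>\<bar> powr q = 0"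
      using integral_nonneg_eq_0_iff_AE[OF int_q] by (simp add: b_def)
    then have "AE \<omega> in M. \<bar>X \<omega>\<bar> powr p = 0" by eventually_elim simp
    then have "a = 0" unfolding a_def by (rule integral_eq_zero_AE)
    then show ?thesis by simp
  next
    case False
    then have b: "0 < b" using ab by simp
    have young: "x powr p / b powr (p / q) \<le> (p / q) * (x powr q / b) + (1 - p / q)" if "0 \<le> x" for x :: real
    proof (cases "x = 0")
      case True
      then show ?thesis using pq by simp
    next
      case False
      have "(x powr q / b) powr (p / q) * 1 powr (1 - p / q) \<le> (p / q) * (x powr q / b) + (1 - p / q) * 1"
        using pq b that False by (intro Youngs_inequality_0) auto
      then show ?thesis using pq b by (simp add: powr_divide powr_powr)
    qed
    have "a / b powr (p / q) = (\<integral>\<omega>. \<bar>X \<omega>\<bar> powr p / b powr (p / q) \<partial>M)" by (simp add: a_def)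
    also have "\<dots> \<le> (\<integral>\<omega>. (p / q) * (\<bar>X \<omega>\<bar> powr q / b) + (1 - p / q) \<partial>M)"
      using int_p int_q young by (intro integral_mono) auto
    also have "\<dots> = (p / q) * (b / b) + (1 - p / q)"
      using int_q by (simp add: b_def prob_space)
    also have "\<dots> = 1" using b by simp
    finally show ?thesis using b by (simp add: divide_le_eq)
  qed
  then have "a powr (1 / p) \<le> (b powr (p / q)) powr (1 / p)" using ab pq by (intro powr_mono2) auto
  also have "\<dots> = b powr (1 / q)" using pq by (simp add: powr_powr)
  finally show ?thesis using ab by (simp add: Lp_norm_def Let_def Ip Iq ennreal_leI)
qed

lemma (in prob_space) Lp_norm_4_ge:
  assumes int: "integrable M (\<lambda>\<omega>. X \<omega> ^ 4)" and c: "0 \<le> c" "c \<le> (\<integral>\<omega>. X \<omega> ^ 4 \<partial>M)"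
  shows "ennreal (c powr (1 / 4)) \<le> Lp_norm M 4 X"
proof -
  have "\<bar>x\<bar> powr 4 = x ^ 4" for x :: real
    by (cases "x = 0") (simp_all add: powr_numeral power_even_abs)
  then have "(\<integral>\<^sup>+ \<omega>. ennreal (\<bar>X \<omega>\<bar> powr 4) \<partial>M) = ennreal (\<integral>\<omega>. X \<omega> ^ 4 \<partial>M)"
    using nn_integral_eq_integral[OF int] by simp
  moreover have "c powr (1 / 4) \<le> (\<integral>\<omega>. X \<omega> ^ 4 \<partial>M) powr (1 / 4)" using c by (intro powr_mono2) auto
  ultimately show ?thesis using c by (simp add: Lp_norm_def Let_def ennreal_leI)
qed

text \<open>The antiderivative \<open>s u - (u - y) \<bar>u - y\<bar> / 2\<close> is differentiable also at the tip of the tent.\<close>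

lemma integral_tent:
  fixes y s :: real
  assumes s: "0 \<le> s"
  shows "(LINT u:{y - s<..<y + s}|density lborel (\<lambda>_. 2). s - \<bar>u - y\<bar>) = 2 * s\<^sup>2"
proof -
  let ?F = "\<lambda>u. s * u - (u - y) * \<bar>u - y\<bar> / 2"
  have deriv: "(?F has_real_derivative s - \<bar>u - y\<bar>) (at u)" for u
  proof -
    have half_square: "((\<lambda>z. z * \<bar>z\<bar> / 2) has_real_derivative \<bar>z\<bar>) (at z)" for z :: real
    proof (cases "z = 0")
      case True
      have "((\<lambda>h. \<bar>h\<bar> / 2) \<longlongrightarrow> \<bar>0\<bar> / 2) (at (0::real))" by (intro tendsto_intros) auto
      then have "((\<lambda>h. (h * \<bar>h\<bar> / 2) / h) \<longlongrightarrow> 0) (at (0::real))"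
        using LIM_equal[of 0 "\<lambda>h. (h * \<bar>h\<bar> / 2) / h" "\<lambda>h. \<bar>h\<bar> / 2" "0 :: real"] by simp
      then show ?thesis by (simp add: True DERIV_def)
    next
      case False
      define c :: real where "c = sgn z"
      have "((\<lambda>z. c * z\<^sup>2 / 2) has_real_derivative \<bar>z\<bar>) (at z)"
        by (auto intro!: derivative_eq_intros simp: c_def sgn_real_def)
      then show ?thesis
      proof (rule has_field_derivative_transform_within_open)
        show "open {x. 0 < c * x}" by (intro open_Collect_less continuous_intros)
        show "z \<in> {x. 0 < c * x}" using False by (simp add: c_def sgn_real_def)
        show "c * x\<^sup>2 / 2 = x * \<bar>x\<bar> / 2" if "x \<in> {x. 0 < c * x}" for x
          using that False by (auto simp: c_def sgn_real_def power2_eq_square split: if_splits)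
      qed
    qed
    have "((\<lambda>u. (u - y) * \<bar>u - y\<bar> / 2) has_real_derivative \<bar>u - y\<bar> * 1) (at u)"
      by (rule DERIV_chain2[where g = "\<lambda>u. u - y", OF half_square]) (auto intro!: derivative_eq_intros)
    moreover have "((\<lambda>u. s * u) has_real_derivative s) (at u)" by (auto intro!: derivative_eq_intros)
    ultimately show ?thesis using DERIV_diff by fastforce
  qed
  have "(LINT u:{y - s<..<y + s}|density lborel (\<lambda>_. 2). s - \<bar>u - y\<bar>) =
      (\<integral>u. 2 * (indicator {y - s<..<y + s} u * (s - \<bar>u - y\<bar>)) \<partial>lborel)"
    unfolding set_lebesgue_integral_def
    using integral_density[of "\<lambda>u. indicator {y - s<..<y + s} u *\<^sub>R (s - \<bar>u - y\<bar>)" lborel "\<lambda>_. 2"] by simp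
  also have "\<dots> = 2 * (\<integral>u. (s - \<bar>u - y\<bar>) * indicator {y - s..y + s} u \<partial>lborel)"
  proof -
    have "indicator {y - s<..<y + s} u * (s - \<bar>u - y\<bar>) = (s - \<bar>u - y\<bar>) * indicator {y - s..y + s} u" for u
      by (auto simp: indicator_def)
    then show ?thesis by (simp only: integral_mult_right_zero)
  qed
  also have "(\<integral>u. (s - \<bar>u - y\<bar>) * indicator {y - s..y + s} u \<partial>lborel) = ?F (y + s) - ?F (y - s)"
    by (rule integral_FTC_Icc_real) (use s deriv in \<open>auto intro!: continuous_intros\<close>)
  also have "\<dots> = s\<^sup>2" using s by (simp add: power2_eq_square algebra_simps)
  finally show ?thesis .
qed

theorem proposition5p3:
  fixes P :: "real \<Rightarrow> 'a measure"
    and W :: "real \<Rightarrow> 'a \<Rightarrow> real"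
    and m :: "real measure"
    and a :: "real \<Rightarrow> real \<Rightarrow> real"
  assumes same_space: "\<And>y. sets (P y) = sets (P 0)"
    and bm: "\<And>y. brownian_motion (P y) W y"
    and speed: "m = density lborel (\<lambda>_. 2)"
    and scale: "\<And>h y. 0 < h \<Longrightarrow> h < 1 \<Longrightarrow> a h y = sqrt h"
  shows "(\<forall>(y::real) (h::real). 0 < h \<and> h < 1 \<longrightarrow>
            1 / 2 * (LINT u:{y - a h y<..<y + a h y}|m. a h y - \<bar>u - y\<bar>) = h) \<and>
         (\<forall>(p::real) (y::real) (T::real) (h::real). 4 \<le> p \<and> 0 < T \<and> 0 < h \<and> h < min 1 T \<longrightarrow>
            (let D = (\<lambda>\<omega>. at_time W (tau W h (nat \<lfloor>T / h\<rfloor>)) \<omega> - W T \<omega>) in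
             Lp_norm (P y) p D \<ge> Lp_norm (P y) 4 D \<and>
             Lp_norm (P y) 4 D \<ge>
               ennreal (((T - h) * prob_space.variance (P 0) (\<lambda>\<omega>. real_of_ereal (exit_time (-1) 1 W \<omega>)) / 4)
                          powr (1 / 4) * h powr (1 / 4))))"
proof (intro conjI allI impI)
  fix y h :: real
  assume h: "0 < h \<and> h < 1"
  then show "1 / 2 * (LINT u:{y - a h y<..<y + a h y}|m. a h y - \<bar>u - y\<bar>) = h"
    using integral_tent[of "sqrt h" y] by (simp add: scale speed)
next
  fix p y T h :: real
  assume asm: "4 \<le> p \<and> 0 < T \<and> 0 < h \<and> h < min 1 T"
  then have h: "0 < h" and T: "0 < T" "h < T" by auto
  define n where "n = nat \<lfloor>T / h\<rfloor>"
  define D where "D \<omega> = at_time W (tau W h n) \<omega> - W T \<omega>" for \<omega>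
  interpret b0: brownian "P 0" W 0 by unfold_locales (rule bm)
  interpret b: brownian "P y" W y by unfold_locales (rule bm)
  have var: "prob_space.variance (P 0) (\<lambda>\<omega>. real_of_ereal (exit_time (-1) 1 W \<omega>)) = 2 / 3"
    by (rule b0.variance_exit_time) simp
  have D [measurable]: "D \<in> borel_measurable (P y)"
    unfolding D_def using b.measurable_at_tau[OF h, of n] b.measurable_W[of T] T by (intro borel_measurable_diff) auto
  have n: "T - h \<le> real n * h"
  proof -
    have "T / h - 1 \<le> real n" using T h by (simp add: n_def)
    then have "(T / h - 1) * h \<le> real n * h" using h by (intro mult_right_mono) auto
    then show ?thesis using h by (simp add: algebra_simps)
  qed
  have "(T - h) * (2 / 3) / 4 * h = 1 / 6 * (T - h) * h" by simp
  also have "\<dots> \<le> 1 / 6 * (real n * h) * h" using n h by (intro mult_right_mono mult_left_mono) auto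
  also have "\<dots> = 1 / 6 * real n * h\<^sup>2" by (simp add: power2_eq_square)
  also have "\<dots> \<le> (\<integral>\<omega>. D \<omega> ^ 4 \<partial>P y)" unfolding D_def by (rule b.space_error_lower_bound[OF h T(1)])
  finally have "ennreal (((T - h) * (2 / 3) / 4 * h) powr (1 / 4)) \<le> Lp_norm (P y) 4 D"
    using b.time_error_le_space_error(1)[OF h T(1), of n] T h
    by (intro b.Lp_norm_4_ge) (auto simp: D_def)
  also have "((T - h) * (2 / 3) / 4 * h) powr (1 / 4) = ((T - h) * (2 / 3) / 4) powr (1 / 4) * h powr (1 / 4)"
    by (rule powr_mult)
  finally have lower: "ennreal (((T - h) * (2 / 3) / 4) powr (1 / 4) * h powr (1 / 4)) \<le> Lp_norm (P y) 4 D" .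
  have mono: "Lp_norm (P y) 4 D \<le> Lp_norm (P y) p D"
    by (rule b.Lp_norm_mono[OF D]) (use asm in auto)
  have "(\<lambda>\<omega>. at_time W (tau W h (nat \<lfloor>T / h\<rfloor>)) \<omega> - W T \<omega>) = D" by (simp add: D_def n_def fun_eq_iff)
  then show "let D = (\<lambda>\<omega>. at_time W (tau W h (nat \<lfloor>T / h\<rfloor>)) \<omega> - W T \<omega>) in
             Lp_norm (P y) p D \<ge> Lp_norm (P y) 4 D \<and>
             Lp_norm (P y) 4 D \<ge>
               ennreal (((T - h) * prob_space.variance (P 0) (\<lambda>\<omega>. real_of_ereal (exit_time (-1) 1 W \<omega>)) / 4)
                          powr (1 / 4) * h powr (1 / 4))"
    unfolding Let_def var using lower mono by simp
qed

end
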